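(* Let $\Omega$ be a domain in $\mathbb C^n$, let $h=(h_1,\ldots,h_N)^T:\Omega\to\mathbb C^N_{(0,1)}$, and let $A=(A_{jk})_{1\le j,k\le N}:\Omega\to\mathbb C^{N^2}_{(0,1)}$ with $A\in L^2_{loc}(\Omega)$. Suppose $f,g:\Omega\to\mathbb C^N$ belong to $H^1_{loc}(\Omega)$ and are both solutions to $$\bar\partial u=Au+h\quad\text{on }\Omega.$$ If $f=g$ in a nonempty open subset of $\Omega$, then $f\equiv g$ on $\Omega$.
   Context: A domain is a connected open set. $\mathbb C^N_{(0,1)}$ denotes the space of $N$-vectors each of whose components is a $(0,1)$ form; likewise $\mathbb C^{N^2}_{(0,1)}$ denotes the space of $N\times N$ matrices each of whose entries is a $(0,1)$ form. $A\in L^2_{loc}(\Omega)$ means that all coefficients of all entries $A_{jk}$ are in $L^2_{loc}(\Omega)$. $H^1_{loc}(\Omega)$ is the local Sobolev space of functions whose weak derivatives up to order $1$ are in $L^2_{loc}(\Omega)$ (componentwise). For $u=(u_1,\ldots,u_N)^T\in H^1_{loc}(\Omega)$, $\bar\partial u$ is the vector of $(0,1)$ forms $\bar\partial u_j=\sum_{l=1}^n\frac{\partial u_j}{\partial\bar z_l}d\bar z_l$ with weak derivatives as coefficients, and the equation reads $\bar\partial u_j=\sum_{k=1}^N u_kA_{jk}+h_j$ for $1\le j\le N$, almost everywhere. Equality of functions is in the almost-everywhere sense. *)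

theory Defs
  imports "HOL-Analysis.Analysis"
begin

text \<open>
  Functions on an open set \<open>\<Omega>\<close> are total functions of which only the values on \<open>\<Omega>\<close> matter.
  \<open>\<complex>\<^sup>n\<close> is \<^typ>\<open>complex^'n\<close>, whose real basis \<^term>\<open>Basis\<close> consists of
  the vectors \<^term>\<open>axis l 1\<close> (direction \<open>x\<^sub>l\<close>) and \<^term>\<open>axis l \<i>\<close>
  (direction \<open>y\<^sub>l\<close>), where \<open>z\<^sub>l = x\<^sub>l + \<i> y\<^sub>l\<close>.
\<close>

definition L1_loc :: "'a::euclidean_space set \<Rightarrow> ('a \<Rightarrow> complex) set" where
  "L1_loc \<Omega> = {f. f \<in> borel_measurable (lebesgue_on \<Omega>) \<and>
     (\<forall>K. compact K \<longrightarrow> K \<subseteq> \<Omega> \<longrightarrow> set_integrable lebesgue K f)}"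

definition L2_loc :: "'a::euclidean_space set \<Rightarrow> ('a \<Rightarrow> complex) set" where
  "L2_loc \<Omega> = {f. f \<in> borel_measurable (lebesgue_on \<Omega>) \<and>
     (\<forall>K. compact K \<longrightarrow> K \<subseteq> \<Omega> \<longrightarrow> set_integrable lebesgue K (\<lambda>x. (norm (f x))\<^sup>2))}"

fun Ck_function :: "nat \<Rightarrow> ('a::euclidean_space \<Rightarrow> complex) \<Rightarrow> bool" where
  "Ck_function 0 \<phi> \<longleftrightarrow> continuous_on UNIV \<phi>"
| "Ck_function (Suc k) \<phi> \<longleftrightarrow> (\<forall>x. \<phi> differentiable (at x)) \<and>
     (\<forall>v. Ck_function k (\<lambda>x. frechet_derivative \<phi> (at x) v))"

text \<open>The space \<open>C\<^sub>c\<^sup>\<infinity>(\<Omega>)\<close>, its elements being extended by zero to the whole space.\<close>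

definition test_functions :: "'a::euclidean_space set \<Rightarrow> ('a \<Rightarrow> complex) set" where
  "test_functions \<Omega> = {\<phi>. (\<forall>k. Ck_function k \<phi>) \<and>
     compact (closure {x. \<phi> x \<noteq> 0}) \<and> closure {x. \<phi> x \<noteq> 0} \<subseteq> \<Omega>}"

definition has_weak_deriv ::
    "'a::euclidean_space set \<Rightarrow> 'a \<Rightarrow> ('a \<Rightarrow> complex) \<Rightarrow> ('a \<Rightarrow> complex) \<Rightarrow> bool" where
  "has_weak_deriv \<Omega> v u w \<longleftrightarrow> u \<in> L1_loc \<Omega> \<and> w \<in> L1_loc \<Omega> \<and>
     (\<forall>\<phi> \<in> test_functions \<Omega>.
        (LINT x:\<Omega>|lebesgue. u x * frechet_derivative \<phi> (at x) v) =
        - (LINT x:\<Omega>|lebesgue. w x * \<phi> x))"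

text \<open>
  A representative of the weak derivative in direction \<open>v\<close>. Weak derivatives are unique only up to
  null sets, so this may be used only in statements that hold almost everywhere; it is
  unspecified if no weak derivative exists.
\<close>

definition weak_deriv ::
    "'a::euclidean_space set \<Rightarrow> 'a \<Rightarrow> ('a \<Rightarrow> complex) \<Rightarrow> 'a \<Rightarrow> complex" where
  "weak_deriv \<Omega> v u = (SOME w. has_weak_deriv \<Omega> v u w)"

definition H1_loc :: "'a::euclidean_space set \<Rightarrow> ('a \<Rightarrow> complex) set" where
  "H1_loc \<Omega> = {u. u \<in> L2_loc \<Omega> \<and>
     (\<forall>b \<in> Basis. \<exists>w \<in> L2_loc \<Omega>. has_weak_deriv \<Omega> b u w)}"

text \<open>
  A \<open>(0,1)\<close> form at a point is given by its vector of coefficients with respect to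
  \<open>d\<bar>z\<^sub>1, \<dots>, d\<bar>z\<^sub>n\<close>, where \<open>d\<bar>z\<^sub>l\<close> is the differential of the conjugate of \<open>z\<^sub>l\<close>.
  Vectors and matrices of forms have the form index \<open>l\<close> as their last index.
\<close>

type_synonym 'n form01 = "complex^'n"

text \<open>\<open>\<partial>/\<partial>\<bar>z\<^sub>l = (\<partial>/\<partial>x\<^sub>l + \<i> \<partial>/\<partial>y\<^sub>l) / 2\<close>, weakly.\<close>

definition weak_dzbar ::
    "(complex^'n) set \<Rightarrow> 'n::finite \<Rightarrow> (complex^'n \<Rightarrow> complex) \<Rightarrow> complex^'n \<Rightarrow> complex" where
  "weak_dzbar \<Omega> l u z =
     (weak_deriv \<Omega> (axis l 1) u z + \<i> * weak_deriv \<Omega> (axis l \<i>) u z) / 2"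

definition dbar ::
    "(complex^'n::finite) set \<Rightarrow> (complex^'n \<Rightarrow> complex^'m) \<Rightarrow> complex^'n \<Rightarrow> ('n form01)^'m::finite"
  where
  "dbar \<Omega> u z = (\<chi> j l. weak_dzbar \<Omega> l (\<lambda>y. u y $ j) z)"

definition form_matrix_mult ::
    "('n::finite form01)^'m^'m \<Rightarrow> complex^'m \<Rightarrow> ('n form01)^'m::finite" where
  "form_matrix_mult A u = (\<chi> j. \<Sum>k\<in>UNIV. (u $ k) *s (A $ j $ k))"

definition dbar_solution ::
    "(complex^'n::finite) set \<Rightarrow> (complex^'n \<Rightarrow> ('n form01)^'m^'m::finite) \<Rightarrow>
     (complex^'n \<Rightarrow> ('n form01)^'m) \<Rightarrow> (complex^'n \<Rightarrow> complex^'m) \<Rightarrow> bool" where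
  "dbar_solution \<Omega> A h u \<longleftrightarrow>
     (AE z in lebesgue. z \<in> \<Omega> \<longrightarrow> dbar \<Omega> u z = form_matrix_mult (A z) (u z) + h z)"

end

(* The difference u = f - g satisfies |dbar_l u| <= a |u| with a in L^2_loc. Cutting off and convolving
   with the Cauchy kernel in one complex variable bounds |u|, on almost every line parallel to a
   coordinate axis, by the potential of |dbar_l u| plus an error supported where the cutoff
   decreases. The weight |z|^-m passes through this estimate because z^-m is holomorphic away
   from 0, where u vanishes. With X = |u| |z|^-m and Y = |dbar_l u| |z|^-m the pairing of Y with the
   potential of Y is controlled by the Hardy-Littlewood-Sobolev inequality, L^(4/3) against L^4, and
   Y <= a X gives ||Y||_(4/3)^2 <= ||a||_2 (int X Y); so int X Y is absorbed as soon as ||a||_2 is small,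
   which holds on a thin annulus. Letting m tend to infinity shows that the zero set grows, first in
   discs of a line, then coordinate by coordinate in polydiscs, then along the connected set. *)

theory Submission
  imports Defs
begin

section \<open>Smooth functions\<close>

text \<open>The exponent shapes the proof. In real dimension 2n the scale-invariant class for a
  coefficient is L^(2n), so L^2 is too weak on balls of the full space once n > 1. But the equation
  bounds every dbar_l separately, and on a complex line L^2 is exactly critical. Critical means that
  the integral of a^2 does not change under dilations: smallness cannot be gained by rescaling, only
  by thinning the annulus, and how thin depends on a. Hence the zero set on a line is enlarged
  through a supremum of radii, with a threshold for ||a||_2 that may depend neither on m nor on the
  radii. Criticality also rules out a sup bound for the potential, so the quantity to be absorbed is
  the pairing int X Y rather than a norm of X. Absorbing it presupposes that it is finite, which the
  vanishing of u near 0 provides. The limit in m is taken twice: the absorbed estimate yields only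
  |u| |dbar_l u| = 0, hence dbar_l u = 0 by the differential inequality; the potential bound, which
  then sees only points outside the disc, finally gives u = 0.\<close>

lemma Ck_function_SucI:
  assumes "\<And>x. (\<phi> has_derivative \<phi>' x) (at x)" "\<And>v. Ck_function k (\<lambda>x. \<phi>' x v)"
  shows "Ck_function (Suc k) \<phi>"
proof -
  have "frechet_derivative \<phi> (at x) = \<phi>' x" for x
    using frechet_derivative_at[OF assms(1)] by simp
  then show ?thesis
    using assms by (auto simp: differentiable_def)
qed

lemma Ck_function_Suc_has_derivative:
  assumes "Ck_function (Suc k) \<phi>"
  shows "(\<phi> has_derivative frechet_derivative \<phi> (at x)) (at x)"
  using assms by (auto simp: frechet_derivative_works)

lemma Ck_function_decr: "Ck_function (Suc k) \<phi> \<Longrightarrow> Ck_function k \<phi>"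
proof (induction k arbitrary: \<phi>)
  case 0
  then show ?case
    by (auto simp: continuous_on_eq_continuous_at intro: differentiable_imp_continuous_within)
next
  case (Suc k)
  then show ?case by (metis Ck_function.simps(2))
qed

lemma Ck_function_const: "Ck_function k (\<lambda>x. c)"
proof (induction k arbitrary: c)
  case (Suc k)
  then show ?case
    by (intro Ck_function_SucI[where \<phi>' = "\<lambda>x v. 0"]) auto
qed auto

lemma Ck_function_add:
  "Ck_function k f \<Longrightarrow> Ck_function k g \<Longrightarrow> Ck_function k (\<lambda>x. f x + g x)"
proof (induction k arbitrary: f g)
  case (Suc k)
  show ?case
    by (rule Ck_function_SucI[OF has_derivative_add[OF
          Ck_function_Suc_has_derivative[OF Suc(2)] Ck_function_Suc_has_derivative[OF Suc(3)]]])
      (use Suc in auto)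
qed (auto intro: continuous_intros)

lemma Ck_function_mult:
  "Ck_function k f \<Longrightarrow> Ck_function k g \<Longrightarrow> Ck_function k (\<lambda>x. f x * g x)"
proof (induction k arbitrary: f g)
  case (Suc k)
  show ?case
    by (rule Ck_function_SucI[OF has_derivative_mult[OF
          Ck_function_Suc_has_derivative[OF Suc(2)] Ck_function_Suc_has_derivative[OF Suc(3)]]])
      (use Suc.prems Suc.prems[THEN Ck_function_decr] in \<open>auto intro!: Ck_function_add Suc.IH\<close>)
qed (auto intro: continuous_intros)

lemma Ck_function_prod:
  "(\<And>i. i \<in> I \<Longrightarrow> Ck_function k (f i)) \<Longrightarrow> Ck_function k (\<lambda>x. \<Prod>i\<in>I. f i x)"
  by (induction I rule: infinite_finite_induct) (auto intro: Ck_function_const Ck_function_mult)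

lemma Ck_function_inverse:
  "Ck_function k f \<Longrightarrow> (\<And>x. f x \<noteq> 0) \<Longrightarrow> Ck_function k (\<lambda>x. inverse (f x))"
proof (induction k arbitrary: f)
  case (Suc k)
  have "Ck_function k (\<lambda>x. inverse (f x))"
    using Suc Ck_function_decr by blast
  then have "Ck_function k (\<lambda>x. (- 1) * (inverse (f x) * frechet_derivative f (at x) v * inverse (f x)))" for v
    using Suc.prems(1) by (intro Ck_function_mult Ck_function_const) auto
  then show ?case
    by (intro Ck_function_SucI[OF Deriv.has_derivative_inverse[OF Suc.prems(2)
            Ck_function_Suc_has_derivative[OF Suc.prems(1)]]]) simp
qed (auto intro: continuous_intros)

lemma Ck_function_linear:
  fixes A :: "'a::euclidean_space \<Rightarrow> complex"
  assumes "bounded_linear A"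
  shows "Ck_function k A"
proof (cases k)
  case 0
  then show ?thesis
    using assms by (auto intro: linear_continuous_on)
next
  case (Suc l)
  have "Ck_function (Suc l) A"
    by (intro Ck_function_SucI[where \<phi>' = "\<lambda>x. A"] bounded_linear_imp_has_derivative assms
        Ck_function_const)
  with Suc show ?thesis by simp
qed

lemma Ck_function_affine:
  fixes A :: "'a::euclidean_space \<Rightarrow> 'b::euclidean_space"
  assumes "bounded_linear A"
  shows "Ck_function k f \<Longrightarrow> Ck_function k (\<lambda>x. f (b + A x))"
proof (induction k arbitrary: f)
  case 0
  have "continuous_on UNIV (\<lambda>x. f (b + A x))"
    using 0 continuous_on_add[OF continuous_on_const linear_continuous_on[OF assms]]
    by (auto intro: continuous_on_compose2[of UNIV f])
  then show ?case by simp
next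
  case (Suc k)
  have *: "((\<lambda>x. b + A x) has_derivative A) (at x)" for x
    using bounded_linear_imp_has_derivative[OF assms] by (auto intro!: derivative_eq_intros)
  show ?case
    by (rule Ck_function_SucI[OF has_derivative_compose[OF * Ck_function_Suc_has_derivative[OF Suc(2)]]])
      (use Suc in auto)
qed

text \<open>Since the intermediate variable is real, the derivative of the composite is a scalar
  factor times a one-variable derivative. The product rule therefore closes the induction. Squared
  norms are the inner functions in view.\<close>

lemma Ck_function_compose_real:
  fixes q :: "'a::euclidean_space \<Rightarrow> real"
  assumes q: "\<And>x. (q has_derivative q' x) (at x)" "\<And>v k. Ck_function k (\<lambda>x. of_real (q' x v))"
  shows "Ck_function k g \<Longrightarrow> Ck_function k (\<lambda>x. g (q x))"
proof (induction k arbitrary: g)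
  case 0
  have "continuous_on UNIV q"
    using q(1) by (meson continuous_at_imp_continuous_on has_derivative_continuous)
  then have "continuous_on UNIV (\<lambda>x. g (q x))"
    using 0 by (auto intro!: continuous_on_compose2[of UNIV g])
  then show ?case by simp
next
  case (Suc k)
  note g = Ck_function_Suc_has_derivative[OF Suc(2)]
  have "frechet_derivative g (at t) s = of_real s * frechet_derivative g (at t) 1" for s t
    using linear_scale[OF has_derivative_linear[OF g], of t s 1]
    by (simp add: scaleR_conv_of_real)
  then have *: "(\<lambda>x. frechet_derivative g (at (q x)) (q' x v)) =
      (\<lambda>x. of_real (q' x v) * frechet_derivative g (at (q x)) 1)" for v
    by (intro ext) blast
  have "Ck_function k (\<lambda>x. frechet_derivative g (at (q x)) 1)"
    using Suc.IH[of "\<lambda>t. frechet_derivative g (at t) 1"] Suc.prems by simp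
  from Ck_function_mult[OF q(2) this] show ?case
    unfolding *[symmetric] by (rule Ck_function_SucI[OF has_derivative_compose[OF q(1) g]])
qed

lemma Ck_function_compose_norm_sq:
  assumes "Ck_function k g"
  shows "Ck_function k (\<lambda>z::complex. g ((norm z)\<^sup>2))"
proof (rule Ck_function_compose_real[OF _ _ assms])
  show "((\<lambda>z::complex. (norm z)\<^sup>2) has_derivative (\<lambda>v. 2 * (z \<bullet> v))) (at z)" for z
    unfolding power2_norm_eq_inner
    by (auto intro!: derivative_eq_intros simp: inner_commute)
  have "bounded_linear (\<lambda>z::complex. complex_of_real (2 * (z \<bullet> v)))" for v
    by (intro bounded_linear_compose[OF bounded_linear_of_real] bounded_linear_const_mult
        bounded_linear_inner_left)
  then show "Ck_function k (\<lambda>z::complex. complex_of_real (2 * (z \<bullet> v)))" for v k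
    by (rule Ck_function_linear)
qed

text \<open>The factor \<open>t\<^sup>-\<^sup>m\<close> makes the family closed under differentiation.\<close>

definition flat :: "nat \<Rightarrow> real \<Rightarrow> complex" where
  "flat m t = (if t \<le> 0 then 0 else of_real (inverse t ^ m * exp (- inverse t)))"

lemma flat_tendsto_0: "(flat m \<longlongrightarrow> 0) (at 0)"
proof -
  have "((\<lambda>s. s ^ m / exp s) \<longlongrightarrow> (0::real)) at_top"
    by (rule tendsto_power_div_exp_0)
  then have "((\<lambda>t. inverse t ^ m / exp (inverse t)) \<longlongrightarrow> (0::real)) (at_right 0)"
    by (rule filterlim_compose) (rule filterlim_inverse_at_top_right)
  then have "((\<lambda>t. complex_of_real (inverse t ^ m / exp (inverse t))) \<longlongrightarrow> of_real 0) (at_right 0)"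
    by (rule tendsto_of_real)
  moreover have "eventually (\<lambda>t. complex_of_real (inverse t ^ m / exp (inverse t)) = flat m t) (at_right 0)"
    by (auto simp: eventually_at_filter flat_def exp_minus divide_inverse)
  ultimately have "(flat m \<longlongrightarrow> 0) (at_right 0)"
    using tendsto_cong by fastforce
  moreover have "eventually (\<lambda>t. 0 = flat m t) (at_left 0)"
    by (auto simp: eventually_at_filter flat_def)
  then have "(flat m \<longlongrightarrow> 0) (at_left 0)"
    by (rule Lim_transform_eventually[OF tendsto_const])
  ultimately show ?thesis
    using filterlim_split_at_real by blast
qed

lemma flat_has_vector_derivative:
  "(flat m has_vector_derivative (flat (m + 2) t - of_nat m * flat (m + 1) t)) (at t)"
proof -
  consider "t < 0" | "t = 0" | "t > 0" by linarith
  then show ?thesis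
  proof cases
    case 1
    have "((\<lambda>t. 0) has_vector_derivative 0) (at t)" by simp
    then have "(flat m has_vector_derivative 0) (at t)"
      by (rule has_vector_derivative_transform_within_open[of _ _ _ "{..<0}"]) (use 1 in \<open>auto simp: flat_def\<close>)
    then show ?thesis using 1 by (simp add: flat_def)
  next
    case 2
    \<comment> \<open>Dividing \<open>flat m h\<close> by |h| raises the exponent by one, so
      differentiability at 0 is the limit statement for \<open>Suc m\<close>.\<close>
    have "((\<lambda>h. norm (flat (Suc m) h)) \<longlongrightarrow> 0) (at 0)"
      using flat_tendsto_0 tendsto_norm_zero by blast
    then have "((\<lambda>h. norm (flat m h) / \<bar>h\<bar>) \<longlongrightarrow> 0) (at 0)"
      by (rule Lim_transform_eventually)
        (auto simp: eventually_at_filter flat_def norm_mult norm_power norm_inverse divide_inverse)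
    then have "(flat m has_vector_derivative 0) (at 0)"
      by (simp add: has_vector_derivative_def has_derivative_at flat_def[of m 0])
    then show ?thesis using 2 by (simp add: flat_def)
  next
    case 3
    have "((\<lambda>t. inverse t ^ m * exp (- inverse t)) has_real_derivative
       (inverse t ^ (m + 2) * exp (- inverse t) - m * (inverse t ^ (m + 1) * exp (- inverse t)))) (at t)"
      using 3
      by (auto intro!: derivative_eq_intros) (cases m; auto simp: algebra_simps power2_eq_square)
    then have "((\<lambda>t. complex_of_real (inverse t ^ m * exp (- inverse t))) has_vector_derivative
       of_real (inverse t ^ (m + 2) * exp (- inverse t) - m * (inverse t ^ (m + 1) * exp (- inverse t)))) (at t)"
      by (intro has_vector_derivative_of_real) (simp add: has_real_derivative_iff_has_vector_derivative)
    then have "(flat m has_vector_derivative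
       of_real (inverse t ^ (m + 2) * exp (- inverse t) - m * (inverse t ^ (m + 1) * exp (- inverse t)))) (at t)"
      by (rule has_vector_derivative_transform_within_open[of _ _ _ "{0<..}"]) (use 3 in \<open>auto simp: flat_def\<close>)
    then show ?thesis using 3 by (simp add: flat_def)
  qed
qed

lemma Ck_function_flat: "Ck_function k (flat m)"
proof (induction k arbitrary: m)
  case 0
  show ?case
    using flat_has_vector_derivative has_vector_derivative_continuous continuous_at_imp_continuous_on
    by (metis Ck_function.simps(1))
next
  case (Suc k)
  show ?case
  proof (rule Ck_function_SucI)
    show "(flat m has_derivative (\<lambda>s. s *\<^sub>R (flat (m + 2) t - of_nat m * flat (m + 1) t))) (at t)" for t
      using flat_has_vector_derivative by (simp add: has_vector_derivative_def)
    show "Ck_function k (\<lambda>t. s *\<^sub>R (flat (m + 2) t - of_nat m * flat (m + 1) t))" for s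
      using Ck_function_mult[OF Ck_function_const[of k "of_real s"]
          Ck_function_add[OF Suc Ck_function_mult[OF Ck_function_const[of k "- of_nat m"] Suc]]]
      by (simp add: scaleR_conv_of_real)
  qed
qed

lemma flat_0_eq_0_iff: "flat 0 t = 0 \<longleftrightarrow> t \<le> 0"
  by (simp add: flat_def)

lemma norm_flat_0_le: "norm (flat 0 t) \<le> 1"
  by (simp add: flat_def)

lemma Re_flat_0: "t > 0 \<Longrightarrow> Re (flat 0 t) > 0" "Re (flat 0 t) \<ge> 0" "Im (flat 0 t) = 0"
  by (auto simp: flat_def)

text \<open>The standard smooth transition from 0 to 1 across the interval from \<open>a\<close> to
  \<open>b\<close>, written with \<open>inverse\<close> to match the closure rules for
  \<open>Ck_function\<close>.\<close>

definition smooth_step :: "real \<Rightarrow> real \<Rightarrow> real \<Rightarrow> complex" where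
  "smooth_step a b t = flat 0 (t - a) * inverse (flat 0 (t - a) + flat 0 (b - t))"

lemma smooth_step:
  assumes "a < b"
  shows "Ck_function k (smooth_step a b)" "t \<le> a \<Longrightarrow> smooth_step a b t = 0"
    "t \<ge> b \<Longrightarrow> smooth_step a b t = 1" "norm (smooth_step a b t) \<le> 1"
    "norm (1 - smooth_step a b t) \<le> 1"
proof -
  \<comment> \<open>For every \<open>t\<close> at least one of \<open>t > a\<close> and
    \<open>t < b\<close> holds, so the denominator is positive.\<close>
  have nz: "Re (flat 0 (t - a) + flat 0 (b - t)) > 0" for t
    using assms Re_flat_0[of "t - a"] Re_flat_0[of "b - t"] by (cases "t > a") auto
  then have nz': "flat 0 (t - a) + flat 0 (b - t) \<noteq> 0" for t
    by (metis less_irrefl zero_complex.simps(1))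
  have 1: "Ck_function k (\<lambda>t. flat 0 (t - a))"
    using Ck_function_affine[OF bounded_linear_ident Ck_function_flat, of k 0 "-a"] by simp
  have 2: "Ck_function k (\<lambda>t. flat 0 (b - t))"
    using Ck_function_affine[OF bounded_linear_minus[OF bounded_linear_ident] Ck_function_flat, of k 0 b]
    by simp
  show "Ck_function k (smooth_step a b)"
    unfolding smooth_step_def[abs_def]
    by (intro Ck_function_mult Ck_function_inverse Ck_function_add 1 2 nz')
  show "t \<le> a \<Longrightarrow> smooth_step a b t = 0"
    by (simp add: smooth_step_def flat_def)
  show "t \<ge> b \<Longrightarrow> smooth_step a b t = 1"
    using nz'[of t] by (auto simp: smooth_step_def flat_def)
  define p q where "p = Re (flat 0 (t - a))" "q = Re (flat 0 (b - t))"
  have pq: "flat 0 (t - a) = of_real p" "flat 0 (b - t) = of_real q" "p \<ge> 0" "q \<ge> 0" "p + q > 0"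
    using nz[of t] by (auto simp: p_q_def complex_eq_iff Re_flat_0)
  have *: "smooth_step a b t = of_real (p / (p + q))"
    by (simp add: smooth_step_def pq divide_inverse)
  then have "1 - smooth_step a b t = of_real (q / (p + q))"
    using pq by (simp add: field_simps flip: of_real_add)
  then show "norm (1 - smooth_step a b t) \<le> 1"
    using pq by (simp add: norm_divide del: of_real_divide of_real_add)
  show "norm (smooth_step a b t) \<le> 1"
    unfolding * using pq by (simp add: norm_divide del: of_real_divide of_real_add)
qed

section \<open>The Cauchy kernel and test functions\<close>

text \<open>Kernels are integrated by dominating them with a series of multiples of indicators of
  discs. The area of a disc then replaces polar coordinates.\<close>

lemma nn_integral_suminf_balls:
  assumes "\<And>k. c k \<ge> 0" "\<And>k. r k \<ge> 0" "(\<lambda>k. c k * (pi * (r k)\<^sup>2)) sums s"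
  shows "(\<integral>\<^sup>+z. (\<Sum>k. ennreal (c k) * indicator (ball (0::complex) (r k)) z) \<partial>lborel) = ennreal s"
proof -
  have [measurable]: "ball (0::complex) (r k) \<in> sets borel" for k by auto
  have "(\<integral>\<^sup>+z. (\<Sum>k. ennreal (c k) * indicator (ball (0::complex) (r k)) z) \<partial>lborel)
      = (\<Sum>k. \<integral>\<^sup>+z. ennreal (c k) * indicator (ball (0::complex) (r k)) z \<partial>lborel)"
    by (intro nn_integral_suminf) measurable
  also have "\<dots> = (\<Sum>k. ennreal (c k * (pi * (r k)\<^sup>2)))"
    using assms by (intro suminf_cong)
      (simp add: nn_integral_cmult_indicator emeasure_ball unit_ball_vol_2 ennreal_mult)
  also have "\<dots> = ennreal s"
    using assms by (intro suminf_ennreal_eq) auto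
  finally show ?thesis .
qed

lemma ennreal_le_suminf:
  fixes f :: "nat \<Rightarrow> ennreal"
  shows "f k \<le> suminf f"
  using sum_le_suminf[of f "{k}"] by simp

text \<open>For R/2^(k+1) <= |z| < R/2^k the kernel is at most 2^(k+1)/R, and the geometric series
  sums up. Using whole discs instead of annuli costs a factor 2 against the exact value 2 pi R; only
  the linear growth in \<open>R\<close> matters.\<close>

lemma nn_integral_inverse_norm_ball_le:
  assumes "R > 0"
  shows "(\<integral>\<^sup>+z. ennreal (inverse (norm z)) * indicator (ball (0::complex) R) z \<partial>lborel) \<le> ennreal (4 * pi * R)"
proof -
  define c r where "c = (\<lambda>k. 2 ^ Suc k / R)" and "r = (\<lambda>k. R / 2 ^ k)"
  have le: "ennreal (inverse (norm z)) * indicator (ball (0::complex) R) z \<le>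
      (\<Sum>k. ennreal (c k) * indicator (ball 0 (r k)) z)" for z
  proof (cases "z \<noteq> 0 \<and> norm z < R")
    case True
    define n where "n = (LEAST n. R / 2 ^ n \<le> norm z)"
    obtain m where "R * (1 / 2) ^ m < norm z"
      using True assms real_arch_pow_inv[of "norm z / R" "1/2"] by (auto simp: field_simps)
    then have "R / 2 ^ m \<le> norm z" by (simp add: power_divide)
    then have n: "R / 2 ^ n \<le> norm z" unfolding n_def by (rule LeastI)
    with True obtain k where k: "n = Suc k" by (cases n) auto
    have "\<not> R / 2 ^ k \<le> norm z"
      using k not_less_Least[of k "\<lambda>n. R / 2 ^ n \<le> norm z"] by (simp add: n_def)
    then have "z \<in> ball 0 (r k)" by (simp add: r_def)
    moreover have "inverse (norm z) \<le> c k"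
      using n k True assms by (simp add: c_def field_simps)
    ultimately have "ennreal (inverse (norm z)) * indicator (ball (0::complex) R) z \<le>
      ennreal (c k) * indicator (ball 0 (r k)) z"
      by (auto simp: indicator_def intro: ennreal_leI)
    also have "\<dots> \<le> (\<Sum>k. ennreal (c k) * indicator (ball 0 (r k)) z)"
      by (rule ennreal_le_suminf)
    finally show ?thesis .
  qed auto
  have "(\<integral>\<^sup>+z. ennreal (inverse (norm z)) * indicator (ball (0::complex) R) z \<partial>lborel) \<le>
      (\<integral>\<^sup>+z. (\<Sum>k. ennreal (c k) * indicator (ball (0::complex) (r k)) z) \<partial>lborel)"
    by (intro nn_integral_mono le)
  also have "(\<lambda>k. (2 * pi * R) * (1 / 2) ^ k) sums ((2 * pi * R) * (1 / (1 - 1 / 2)))"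
    by (intro sums_mult geometric_sums) simp
  then have "(\<lambda>k. c k * (pi * (r k)\<^sup>2)) sums (4 * pi * R)"
    using assms by (simp add: c_def r_def field_simps power2_eq_square)
  then have "(\<integral>\<^sup>+z. (\<Sum>k. ennreal (c k) * indicator (ball (0::complex) (r k)) z) \<partial>lborel) = ennreal (4 * pi * R)"
    using assms by (intro nn_integral_suminf_balls) (auto simp: c_def r_def)
  finally show ?thesis .
qed

text \<open>The same dyadic argument outwards. The fourth power is what \<open>young_4_3\<close>
  leaves of the kernel 1/|z| away from its singularity; it also controls the tail of the integrand
  of \<open>cauchy_const\<close>.\<close>

lemma nn_integral_inverse_norm4_le:
  assumes "R > 0"
  shows "(\<integral>\<^sup>+z. ennreal (inverse (norm z ^ 4)) * indicator (- ball (0::complex) R) z \<partial>lborel)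
    \<le> ennreal (16 / 3 * pi / R\<^sup>2)"
proof -
  define c r where "c = (\<lambda>k. inverse ((R * 2 ^ k) ^ 4))" and "r = (\<lambda>k. R * 2 ^ Suc k)"
  have le: "ennreal (inverse (norm z ^ 4)) * indicator (- ball (0::complex) R) z \<le>
      (\<Sum>k. ennreal (c k) * indicator (ball 0 (r k)) z)" for z
  proof (cases "norm z \<ge> R")
    case True
    define n where "n = (LEAST n. norm z < R * 2 ^ n)"
    obtain m where "norm z / R < 2 ^ m"
      using real_arch_pow[of 2 "norm z / R"] by auto
    then have "norm z < R * 2 ^ m" using assms by (simp add: field_simps)
    then have n: "norm z < R * 2 ^ n" unfolding n_def by (rule LeastI)
    with True obtain k where k: "n = Suc k" by (cases n) auto
    have "\<not> norm z < R * 2 ^ k"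
      using k not_less_Least[of k "\<lambda>n. norm z < R * 2 ^ n"] by (simp add: n_def)
    then have "inverse (norm z ^ 4) \<le> c k"
      unfolding c_def using assms by (intro le_imp_inverse_le power_mono zero_less_power) auto
    moreover have "z \<in> ball 0 (r k)" using n k by (simp add: r_def)
    ultimately have "ennreal (inverse (norm z ^ 4)) * indicator (- ball (0::complex) R) z \<le>
      ennreal (c k) * indicator (ball 0 (r k)) z"
      by (auto simp: indicator_def intro: ennreal_leI)
    also have "\<dots> \<le> (\<Sum>k. ennreal (c k) * indicator (ball 0 (r k)) z)"
      by (rule ennreal_le_suminf)
    finally show ?thesis .
  qed auto
  have "(\<integral>\<^sup>+z. ennreal (inverse (norm z ^ 4)) * indicator (- ball (0::complex) R) z \<partial>lborel) \<le>
      (\<integral>\<^sup>+z. (\<Sum>k. ennreal (c k) * indicator (ball (0::complex) (r k)) z) \<partial>lborel)"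
    by (intro nn_integral_mono le)
  also have "(\<lambda>k. (4 * pi / R\<^sup>2) * (1 / 4) ^ k) sums ((4 * pi / R\<^sup>2) * (1 / (1 - 1 / 4)))"
    by (intro sums_mult geometric_sums) simp
  then have S: "(\<lambda>k. (4 * pi / R\<^sup>2) * (1 / 4) ^ k) sums (16 / 3 * pi / R\<^sup>2)"
    by (simp add: mult.commute)
  have T: "c k * (pi * (r k)\<^sup>2) = (4 * pi / R\<^sup>2) * (1 / 4) ^ k" for k
  proof -
    have "(2::real) ^ k * (2 ^ k * (2 ^ k * 2 ^ k)) = 4 ^ k * (2 ^ k * 2 ^ k)"
      by (simp flip: power_mult_distrib)
    then show ?thesis
      using assms by (simp add: c_def r_def field_simps power2_eq_square eval_nat_numeral)
  qed
  have "(\<integral>\<^sup>+z. (\<Sum>k. ennreal (c k) * indicator (ball (0::complex) (r k)) z) \<partial>lborel) = ennreal (16 / 3 * pi / R\<^sup>2)"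
    using assms by (intro nn_integral_suminf_balls) (use S in \<open>simp_all only: T\<close>, auto simp: c_def r_def)
  finally show ?thesis .
qed

lemma integrable_inverse_on_cball:
  "integrable lborel (\<lambda>z::complex. indicator (cball 0 R) z *\<^sub>R inverse z)"
proof (rule integrableI_bounded)
  have "(\<integral>\<^sup>+ z. ennreal (norm (indicator (cball 0 R) z *\<^sub>R inverse (z::complex))) \<partial>lborel) \<le>
     (\<integral>\<^sup>+z. ennreal (inverse (norm z)) * indicator (ball (0::complex) (\<bar>R\<bar> + 1)) z \<partial>lborel)"
    by (intro nn_integral_mono) (auto simp: indicator_def norm_inverse)
  also have "\<dots> \<le> ennreal (4 * pi * (\<bar>R\<bar> + 1))"
    by (intro nn_integral_inverse_norm_ball_le) auto
  finally show "(\<integral>\<^sup>+ z. ennreal (norm (indicator (cball 0 R) z *\<^sub>R inverse (z::complex))) \<partial>lborel) < \<infinity>"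
    by (simp add: order_le_less_trans)
  have "cball (0::complex) R \<in> sets borel" by auto
  then show "(\<lambda>z::complex. indicator (cball 0 R) z *\<^sub>R inverse z) \<in> borel_measurable lborel"
    by measurable
qed

section \<open>Translation invariance and the calculus of test functions\<close>

lemma nn_integral_translation:
  fixes f :: "'a::euclidean_space \<Rightarrow> ennreal"
  assumes [measurable]: "f \<in> borel_measurable borel"
  shows "(\<integral>\<^sup>+x. f (c + x) \<partial>lborel) = (\<integral>\<^sup>+x. f x \<partial>lborel)"
  by (subst (2) lborel_distr_plus[of c, symmetric]) (auto intro!: nn_integral_distr[symmetric])

lemma integral_translation:
  fixes f :: "'a::euclidean_space \<Rightarrow> complex"
  assumes [measurable]: "f \<in> borel_measurable borel"
  shows "(LINT x|lborel. f (c + x)) = (LINT x|lborel. f x)"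
  by (subst (2) lborel_distr_plus[of c, symmetric]) (auto intro!: integral_distr[symmetric])

lemma integrable_translation:
  fixes f :: "'a::euclidean_space \<Rightarrow> complex"
  assumes "integrable lborel f"
  shows "integrable lborel (\<lambda>x. f (c + x))"
proof -
  have "integrable (distr lborel borel ((+) c)) f"
    using assms by (simp add: lborel_distr_plus)
  then show ?thesis
    using borel_measurable_integrable[OF assms] by (subst (asm) integrable_distr_eq) auto
qed

lemma test_functionsI:
  assumes "\<And>k. Ck_function k \<phi>" "compact K" "K \<subseteq> \<Omega>" "\<And>x. \<phi> x \<noteq> 0 \<Longrightarrow> x \<in> K"
  shows "\<phi> \<in> test_functions \<Omega>"
proof -
  have "closure {x. \<phi> x \<noteq> 0} \<subseteq> K"
    using assms by (intro closure_minimal compact_imp_closed) auto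
  then show ?thesis
    using assms bounded_subset[OF compact_imp_bounded[OF assms(2)]]
    by (auto simp: test_functions_def compact_eq_bounded_closed)
qed

lemma test_functionsD:
  assumes "\<phi> \<in> test_functions \<Omega>"
  shows "Ck_function k \<phi>" "continuous_on S \<phi>" "\<phi> \<in> borel_measurable borel"
    "(\<phi> has_derivative frechet_derivative \<phi> (at x)) (at x)"
proof -
  show *: "Ck_function k \<phi>" for k using assms by (auto simp: test_functions_def)
  show "continuous_on S \<phi>" using *[of 0] continuous_on_subset by auto
  show "\<phi> \<in> borel_measurable borel" using *[of 0] by (auto intro: borel_measurable_continuous_onI)
  show "(\<phi> has_derivative frechet_derivative \<phi> (at x)) (at x)"
    by (rule Ck_function_Suc_has_derivative[OF *[of "Suc 0"]])
qed

lemma test_functions_supportE: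
  assumes "\<phi> \<in> test_functions \<Omega>"
  obtains K where "compact K" "K \<subseteq> \<Omega>" "\<And>x. \<phi> x \<noteq> 0 \<Longrightarrow> x \<in> K"
proof (rule that)
  show "compact (closure {x. \<phi> x \<noteq> 0})" "closure {x. \<phi> x \<noteq> 0} \<subseteq> \<Omega>"
    using assms unfolding test_functions_def by blast+
qed (use closure_subset[of "{x. \<phi> x \<noteq> 0}"] in blast)

lemma test_functions_mult:
  assumes "\<phi> \<in> test_functions \<Omega>" "\<And>k. Ck_function k f"
  shows "(\<lambda>x. \<phi> x * f x) \<in> test_functions \<Omega>"
proof -
  obtain K where "compact K" "K \<subseteq> \<Omega>" "\<And>x. \<phi> x \<noteq> 0 \<Longrightarrow> x \<in> K"
    using assms(1) by (rule test_functions_supportE) blast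
  then show ?thesis
    using assms(2)
    by (intro test_functionsI[of _ K] Ck_function_mult test_functionsD(1)[OF assms(1)]) auto
qed

lemma frechet_derivative_outside_support:
  assumes "closed K" "\<And>x. \<phi> x \<noteq> 0 \<Longrightarrow> x \<in> K" "x \<notin> K"
  shows "frechet_derivative \<phi> (at x) = (\<lambda>v. 0)"
proof -
  have "((\<lambda>x. 0) has_derivative (\<lambda>v. 0)) (at x)" by simp
  then have "(\<phi> has_derivative (\<lambda>v. 0)) (at x)"
    by (rule has_derivative_transform_within_open[where s = "- K"]) (use assms in auto)
  then show ?thesis by (rule frechet_derivative_at[symmetric])
qed

lemma test_functions_deriv:
  assumes "\<phi> \<in> test_functions \<Omega>"
  shows "(\<lambda>x. frechet_derivative \<phi> (at x) v) \<in> test_functions \<Omega>"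
proof -
  obtain K where K: "compact K" "K \<subseteq> \<Omega>" "\<And>x. \<phi> x \<noteq> 0 \<Longrightarrow> x \<in> K"
    using assms by (rule test_functions_supportE) blast
  show ?thesis
  proof (rule test_functionsI[OF _ K(1,2)])
    show "Ck_function k (\<lambda>x. frechet_derivative \<phi> (at x) v)" for k
      using test_functionsD(1)[OF assms, of "Suc k"] by simp
    show "x \<in> K" if "frechet_derivative \<phi> (at x) v \<noteq> 0" for x
      using that frechet_derivative_outside_support[OF compact_imp_closed[OF K(1)] K(3)] by metis
  qed
qed

lemma test_functions_boundedE:
  assumes "\<phi> \<in> test_functions \<Omega>"
  obtains B where "B > 0" "\<And>x. norm (\<phi> x) \<le> B"
proof -
  obtain K where K: "compact K" "K \<subseteq> \<Omega>" "\<And>x. \<phi> x \<noteq> 0 \<Longrightarrow> x \<in> K"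
    using assms by (rule test_functions_supportE) blast
  have "bounded (\<phi> ` K)"
    using K test_functionsD(2)[OF assms] by (intro compact_imp_bounded compact_continuous_image)
  then obtain B where "B > 0" "\<And>x. x \<in> K \<Longrightarrow> norm (\<phi> x) \<le> B"
    by (auto simp: bounded_pos)
  moreover from this K have "norm (\<phi> x) \<le> B" for x by (cases "\<phi> x = 0") auto
  ultimately show ?thesis using that by blast
qed

lemma test_functions_support_cballE:
  assumes "\<phi> \<in> test_functions \<Omega>"
  obtains r where "r > 0" "\<And>x. norm x > r \<Longrightarrow> \<phi> x = 0"
proof -
  obtain K where K: "compact K" "K \<subseteq> \<Omega>" "\<And>x. \<phi> x \<noteq> 0 \<Longrightarrow> x \<in> K"
    using assms by (rule test_functions_supportE) blast
  obtain r where "r > 0" "\<And>x. x \<in> K \<Longrightarrow> norm x \<le> r"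
    using compact_imp_bounded[OF K(1)] by (auto simp: bounded_pos)
  with K show ?thesis using that[of r] by force
qed

lemma test_functions_integrable:
  assumes "\<phi> \<in> test_functions \<Omega>"
  shows "integrable lborel \<phi>"
proof -
  obtain K where K: "compact K" "K \<subseteq> \<Omega>" "\<And>x. \<phi> x \<noteq> 0 \<Longrightarrow> x \<in> K"
    using assms by (rule test_functions_supportE) blast
  have "integrable lborel (\<lambda>x. indicator K x *\<^sub>R \<phi> x)"
    by (intro borel_integrable_compact K test_functionsD(2)[OF assms])
  moreover have "(\<lambda>x. indicator K x *\<^sub>R \<phi> x) = \<phi>"
    using K(3) by (intro ext) (metis (no_types) indicator_simps scaleR_one scaleR_zero_left scaleR_zero_right)
  ultimately show ?thesis by simp
qed

text \<open>One constant serves both as derivative bound and as Lipschitz constant, which is the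
  form needed to dominate difference quotients.\<close>

lemma test_functions_deriv_boundE:
  assumes "\<phi> \<in> test_functions \<Omega>"
  obtains B where "B > 0" "\<And>x v. norm (frechet_derivative \<phi> (at x) v) \<le> B * norm v"
    "\<And>x y. norm (\<phi> x - \<phi> y) \<le> B * norm (x - y)"
proof -
  have "\<forall>b. \<exists>B>0. \<forall>x. norm (frechet_derivative \<phi> (at x) b) \<le> B"
    using test_functions_boundedE[OF test_functions_deriv[OF assms]] by metis
  then obtain C where C: "\<And>b. C b > 0" "\<And>b x. norm (frechet_derivative \<phi> (at x) b) \<le> C b"
    by metis
  define B where "B = (\<Sum>b\<in>Basis. C b)"
  have "B > 0" unfolding B_def using C by (intro sum_pos) auto
  moreover have *: "norm (frechet_derivative \<phi> (at x) v) \<le> B * norm v" for x v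
  proof -
    have "frechet_derivative \<phi> (at x) v = frechet_derivative \<phi> (at x) (\<Sum>b\<in>Basis. (v \<bullet> b) *\<^sub>R b)"
      by (simp add: euclidean_representation)
    also have "\<dots> = (\<Sum>b\<in>Basis. (v \<bullet> b) *\<^sub>R frechet_derivative \<phi> (at x) b)"
      using has_derivative_linear[OF test_functionsD(4)[OF assms]]
      by (simp add: linear_sum linear_scale)
    also have "norm \<dots> \<le> (\<Sum>b\<in>Basis. norm v * C b)"
      using C by (intro sum_norm_le) (auto intro!: mult_mono Basis_le_norm less_imp_le[OF C(1)])
    finally show ?thesis by (simp add: B_def sum_distrib_left mult.commute)
  qed
  moreover have "norm (\<phi> x - \<phi> y) \<le> B * norm (x - y)" for x y
  proof (rule differentiable_bound[where S = UNIV and f' = "\<lambda>x. frechet_derivative \<phi> (at x)"])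
    show "onorm (frechet_derivative \<phi> (at x)) \<le> B" for x
      using * \<open>B > 0\<close> by (intro onorm_bound) auto
  qed (use test_functionsD(4)[OF assms] in auto)
  ultimately show ?thesis using that by blast
qed

section \<open>The Cauchy-Pompeiu formula\<close>

lemma directional_derivative_tendsto:
  fixes F :: "'a::euclidean_space \<Rightarrow> complex"
  assumes "(F has_derivative F') (at x)"
  shows "((\<lambda>t. (F (t *\<^sub>R v + x) - F x) /\<^sub>R t) \<longlongrightarrow> F' v) (at 0)"
proof -
  have "((\<lambda>t. t *\<^sub>R v + x) has_derivative (\<lambda>t. t *\<^sub>R v)) (at 0)"
    by (auto intro!: derivative_eq_intros)
  moreover have "(F has_derivative F') (at (0 *\<^sub>R v + x))"
    using assms by simp
  ultimately have "((\<lambda>t. F (t *\<^sub>R v + x)) has_derivative (\<lambda>t. F' (t *\<^sub>R v))) (at 0)"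
    by (rule has_derivative_compose)
  then have "((\<lambda>h. norm (F (h *\<^sub>R v + x) - F x - F' (h *\<^sub>R v)) / norm h) \<longlongrightarrow> 0) (at 0)"
    by (simp add: has_derivative_at)
  then have "((\<lambda>h. norm ((F (h *\<^sub>R v + x) - F x) /\<^sub>R h - F' v)) \<longlongrightarrow> 0) (at 0)"
  proof (rule Lim_transform_eventually, unfold eventually_at_filter, intro always_eventually allI impI)
    fix h :: real assume "h \<noteq> 0"
    then have "(F (h *\<^sub>R v + x) - F x) /\<^sub>R h - F' v = (F (h *\<^sub>R v + x) - F x - F' (h *\<^sub>R v)) /\<^sub>R h"
      using linear_scale[OF has_derivative_linear[OF assms], of h v]
      by (simp add: scaleR_diff_right)
    then show "norm (F (h *\<^sub>R v + x) - F x - F' (h *\<^sub>R v)) / norm h = norm ((F (h *\<^sub>R v + x) - F x) /\<^sub>R h - F' v)"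
      by (simp add: divide_inverse mult.commute)
  qed
  then show ?thesis
    by (rule LIM_zero_cancel[OF tendsto_norm_zero_cancel])
qed

text \<open>Translation invariance makes the integral of every difference quotient vanish, and
  dominated convergence passes to the derivative.\<close>

lemma integral_derivative_test_function:
  assumes F: "F \<in> test_functions UNIV"
  shows "(LINT x|lborel. frechet_derivative F (at x) v) = 0"
proof -
  obtain B where B: "B > 0" "\<And>x y. norm (F x - F y) \<le> B * norm (x - y)"
    using test_functions_deriv_boundE[OF F] by metis
  obtain r where r: "r > 0" "\<And>x. norm x > r \<Longrightarrow> F x = 0"
    using test_functions_support_cballE[OF F] by metis
  have [measurable]: "F \<in> borel_measurable borel"
    "(\<lambda>x. frechet_derivative F (at x) v) \<in> borel_measurable borel"
    using test_functionsD(3) F test_functions_deriv by blast+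
  define h where "h n = inverse (real (Suc n))" for n
  have h: "h n > 0" "h n \<le> 1" for n by (auto simp: h_def field_simps)
  have h0: "filterlim h (at 0) sequentially"
    unfolding filterlim_at using h LIMSEQ_inverse_real_of_nat
    by (auto simp: h_def[abs_def] eventually_sequentially intro!: always_eventually)
  define q where "q n x = (F (h n *\<^sub>R v + x) - F x) /\<^sub>R h n" for n x
  have "(\<lambda>n. LINT x|lborel. q n x) \<longlonglongrightarrow> (LINT x|lborel. frechet_derivative F (at x) v)"
  proof (rule integral_dominated_convergence)
    show "(\<lambda>x. frechet_derivative F (at x) v) \<in> borel_measurable lborel" "\<And>n. q n \<in> borel_measurable lborel"
      unfolding q_def by measurable
    \<comment> \<open>Because \<open>h n \<le> 1\<close>, the supports of all shifted functions stay
      in this ball.\<close>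
    show "integrable lborel (\<lambda>x. indicator (cball 0 (r + norm v)) x *\<^sub>R (B * norm v))"
      by (intro borel_integrable_compact) auto
    show "AE x in lborel. (\<lambda>n. q n x) \<longlonglongrightarrow> frechet_derivative F (at x) v"
      unfolding q_def
      by (intro always_eventually allI
          filterlim_compose[OF directional_derivative_tendsto[OF test_functionsD(4)[OF F]] h0])
    show "AE x in lborel. norm (q n x) \<le> indicator (cball 0 (r + norm v)) x *\<^sub>R (B * norm v)" for n
    proof (intro always_eventually allI)
      fix x
      have hv: "norm (h n *\<^sub>R v) \<le> norm v"
        using h[of n] by (simp add: mult_left_le_one_le)
      show "norm (q n x) \<le> indicator (cball 0 (r + norm v)) x *\<^sub>R (B * norm v)"
      proof (cases "norm x \<le> r + norm v")
        case True
        have "norm (F (h n *\<^sub>R v + x) - F x) \<le> B * norm v * h n"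
          using B(2)[of "h n *\<^sub>R v + x" x] h[of n] by (simp add: ac_simps)
        moreover have "norm (q n x) = norm (F (h n *\<^sub>R v + x) - F x) / h n"
          using h[of n] by (simp add: q_def divide_inverse mult.commute)
        ultimately have "norm (q n x) \<le> B * norm v"
          using h[of n] by (simp only: pos_divide_le_eq)
        with True show ?thesis by simp
      next
        case False
        then have "norm x > r" using norm_ge_zero[of v] by linarith
        moreover have "norm (h n *\<^sub>R v + x) > r"
          using hv False norm_diff_ineq[of x "h n *\<^sub>R v"] by (simp add: add.commute)
        ultimately show ?thesis using r(2) False by (simp add: q_def)
      qed
    qed
  qed
  moreover have "(LINT x|lborel. q n x) = 0" for n
  proof -
    have "integrable lborel F" using test_functions_integrable[OF F] .
    then have "(LINT x|lborel. q n x) =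
        ((LINT x|lborel. F (h n *\<^sub>R v + x)) - (LINT x|lborel. F x)) /\<^sub>R h n"
      unfolding q_def integral_scaleR_right
      by (subst Bochner_Integration.integral_diff[OF integrable_translation]) simp_all
    then show ?thesis by (simp add: integral_translation)
  qed
  ultimately show ?thesis by (simp add: LIMSEQ_const_iff)
qed

text \<open>Twice the usual derivative with respect to the conjugate variable: the factor 1/2 is
  dropped. \<open>L\<close> embeds the complex line; it is the identity in one variable and
  \<open>axis l\<close> in several.\<close>

definition dbar_along :: "(complex \<Rightarrow> 'a) \<Rightarrow> ('a::euclidean_space \<Rightarrow> complex) \<Rightarrow> 'a \<Rightarrow> complex" where
  "dbar_along L \<phi> x = frechet_derivative \<phi> (at x) (L 1) + \<i> * frechet_derivative \<phi> (at x) (L \<i>)"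

lemma frechet_derivative_mult:
  fixes f g :: "'a::euclidean_space \<Rightarrow> complex"
  assumes "Ck_function (Suc 0) f" "Ck_function (Suc 0) g"
  shows "frechet_derivative (\<lambda>x. f x * g x) (at x) v =
    f x * frechet_derivative g (at x) v + frechet_derivative f (at x) v * g x"
  by (rule fun_cong[OF frechet_derivative_at[OF has_derivative_mult[OF
          Ck_function_Suc_has_derivative[OF assms(1)] Ck_function_Suc_has_derivative[OF assms(2)]]], symmetric])

lemma dbar_along_mult:
  assumes "Ck_function (Suc 0) f" "Ck_function (Suc 0) g"
  shows "dbar_along L (\<lambda>x. f x * g x) x = f x * dbar_along L g x + dbar_along L f x * g x"
  unfolding dbar_along_def frechet_derivative_mult[OF assms] by (simp add: algebra_simps)

lemma test_functions_cmult:
  "\<phi> \<in> test_functions \<Omega> \<Longrightarrow> (\<lambda>x. c * \<phi> x) \<in> test_functions \<Omega>"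
  using test_functions_mult[OF _ Ck_function_const, of \<phi> \<Omega> c] by (simp add: mult.commute)

lemma test_functions_add:
  assumes "\<phi> \<in> test_functions \<Omega>" "\<psi> \<in> test_functions \<Omega>"
  shows "(\<lambda>x. \<phi> x + \<psi> x) \<in> test_functions \<Omega>"
proof -
  obtain K where K: "compact K" "K \<subseteq> \<Omega>" "\<And>x. \<phi> x \<noteq> 0 \<Longrightarrow> x \<in> K"
    using assms(1) by (rule test_functions_supportE) blast
  obtain K' where K': "compact K'" "K' \<subseteq> \<Omega>" "\<And>x. \<psi> x \<noteq> 0 \<Longrightarrow> x \<in> K'"
    using assms(2) by (rule test_functions_supportE) blast
  show ?thesis
  proof (rule test_functionsI)
    show "Ck_function k (\<lambda>x. \<phi> x + \<psi> x)" for k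
      by (intro Ck_function_add test_functionsD(1)[OF assms(1)] test_functionsD(1)[OF assms(2)])
    show "x \<in> K \<union> K'" if "\<phi> x + \<psi> x \<noteq> 0" for x
      using that K(3)[of x] K'(3)[of x] by (cases "\<phi> x = 0") auto
  qed (use K K' in auto)
qed

lemma test_functions_dbar_along:
  assumes "\<phi> \<in> test_functions \<Omega>"
  shows "dbar_along L \<phi> \<in> test_functions \<Omega>"
  unfolding dbar_along_def[abs_def]
  by (intro test_functions_add test_functions_cmult test_functions_deriv assms)

lemma integral_dbar_along_test_function:
  assumes F: "F \<in> test_functions UNIV"
  shows "(LINT x|lborel. dbar_along L F x) = 0"
  unfolding dbar_along_def
  by (subst Bochner_Integration.integral_add)
    (auto simp: integral_derivative_test_function F intro!: test_functions_integrable[OF test_functions_deriv[OF F]] integrable_mult_right)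

lemma integrable_mult_inverse:
  fixes g :: "complex \<Rightarrow> complex"
  assumes [measurable]: "g \<in> borel_measurable borel"
    and "\<And>z. norm (g z) \<le> B" "\<And>z. norm z > R \<Longrightarrow> g z = 0"
  shows "integrable lborel (\<lambda>z. g z * inverse z)"
proof (rule Bochner_Integration.integrable_bound)
  show "integrable lborel (\<lambda>z::complex. B *\<^sub>R (indicator (cball 0 R) z *\<^sub>R inverse z))"
    by (intro integrable_scaleR_right integrable_inverse_on_cball)
  have "norm (g z * inverse z) \<le> norm (B *\<^sub>R (indicator (cball 0 R) z *\<^sub>R inverse z))" for z
  proof (cases "norm z > R")
    case False
    then show ?thesis
      using order_trans[OF assms(2)[of z] abs_ge_self[of B]]
      by (auto simp: norm_mult intro!: mult_right_mono)
  qed (use assms in auto)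
  then show "AE z in lborel. norm (g z * inverse z) \<le> norm (B *\<^sub>R (indicator (cball 0 R) z *\<^sub>R inverse z))"
    by simp
qed measurable

text \<open>Only positivity of this constant matters; its value \<open>2 * pi\<close> is not needed.\<close>

definition cauchy_const :: real where
  "cauchy_const = (LINT s::complex|lborel. 2 / (1 + (norm s)\<^sup>2)\<^sup>2)"

lemma integrable_cauchy_const: "integrable lborel (\<lambda>s::complex. 2 / (1 + (norm s)\<^sup>2)\<^sup>2)"
proof (rule integrableI_bounded)
  have [measurable]: "ball (0::complex) 1 \<in> sets borel" by auto
  have le: "ennreal (norm (2 / (1 + (norm s)\<^sup>2)\<^sup>2)) \<le>
      2 * indicator (ball 0 1) s + 2 * (ennreal (inverse (norm s ^ 4)) * indicator (- ball 0 1) s)" for s :: complex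
  proof (cases "norm s < 1")
    case True
    have "1 \<le> (1 + (norm s)\<^sup>2)\<^sup>2" by (simp add: one_le_power)
    then have "2 / (1 + (norm s)\<^sup>2)\<^sup>2 \<le> 2 / 1" by (intro divide_left_mono) (auto simp: zero_less_power2 add_nonneg_eq_0_iff)
    then have "norm (2 / (1 + (norm s)\<^sup>2)\<^sup>2) \<le> 2" by simp
    then have "ennreal (norm (2 / (1 + (norm s)\<^sup>2)\<^sup>2)) \<le> ennreal 2" by (rule ennreal_leI)
    with True show ?thesis by simp
  next
    case False
    then have "norm s ^ 4 > 0" by (intro zero_less_power) linarith
    moreover have "norm s ^ 4 \<le> (1 + (norm s)\<^sup>2)\<^sup>2"
      by (simp add: power2_eq_square eval_nat_numeral algebra_simps)
    ultimately have "norm (2 / (1 + (norm s)\<^sup>2)\<^sup>2) \<le> 2 * inverse (norm s ^ 4)"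
      by (simp add: divide_inverse le_imp_inverse_le)
    then have "ennreal (norm (2 / (1 + (norm s)\<^sup>2)\<^sup>2)) \<le> ennreal (2 * inverse (norm s ^ 4))" by (rule ennreal_leI)
    with False show ?thesis by (simp add: ennreal_mult)
  qed
  have "(\<integral>\<^sup>+ s. ennreal (norm (2 / (1 + (norm (s::complex))\<^sup>2)\<^sup>2)) \<partial>lborel) \<le>
    (\<integral>\<^sup>+ s. 2 * indicator (ball (0::complex) 1) s + 2 * (ennreal (inverse (norm s ^ 4)) * indicator (- ball 0 1) s) \<partial>lborel)"
    by (intro nn_integral_mono le)
  also have "\<dots> = 2 * emeasure lborel (ball (0::complex) 1) +
      2 * (\<integral>\<^sup>+ s. ennreal (inverse (norm s ^ 4)) * indicator (- ball (0::complex) 1) s \<partial>lborel)"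
    by (subst nn_integral_add) (auto simp: nn_integral_cmult nn_integral_cmult_indicator)
  also have "\<dots> < \<infinity>"
    using nn_integral_inverse_norm4_le[of 1]
    by (auto simp: emeasure_ball ennreal_mult_less_top intro: order_le_less_trans)
  finally show "(\<integral>\<^sup>+ s. ennreal (norm (2 / (1 + (norm (s::complex))\<^sup>2)\<^sup>2)) \<partial>lborel) < \<infinity>" .
qed auto

lemma cauchy_const_pos: "cauchy_const > 0"
proof -
  have pos: "1 + (norm s)\<^sup>2 > 0" for s :: complex
    by (simp add: add_pos_nonneg)
  have "cauchy_const \<noteq> 0"
  proof
    assume "cauchy_const = 0"
    then have "AE s::complex in lborel. 2 / (1 + (norm s)\<^sup>2)\<^sup>2 = 0"
      unfolding cauchy_const_def
      by (subst (asm) integral_nonneg_eq_0_iff_AE[OF integrable_cauchy_const]) auto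
    then have "AE s::complex in lborel. False"
      using pos by (auto simp: less_le)
    then have "emeasure lborel (UNIV::complex set) = 0"
      by (auto simp: AE_iff_measurable[of UNIV])
    then show False by simp
  qed
  moreover have "cauchy_const \<ge> 0"
    unfolding cauchy_const_def by (intro integral_nonneg_AE) auto
  ultimately show ?thesis by linarith
qed

lemma integral_complex_scale:
  fixes f :: "complex \<Rightarrow> complex"
  assumes [measurable]: "f \<in> borel_measurable borel" and "c > 0"
  shows "(LINT z|lborel. f z) = (LINT z|lborel. c\<^sup>2 *\<^sub>R f (c *\<^sub>R z))"
proof -
  have "(LINT z|lborel. f z) =
      (LINT z|density (distr lborel borel (\<lambda>x::complex. 0 + c *\<^sub>R x)) (\<lambda>_. ennreal (\<bar>c\<bar> ^ DIM(complex))). f z)"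
    using lborel_affine[of c "0::complex"] assms(2) by (simp add: ennreal_power)
  also have "\<dots> = (LINT z|lborel. c\<^sup>2 *\<^sub>R f (c *\<^sub>R z))"
    using assms(2) by (subst integral_density) (auto simp: integral_distr)
  finally show ?thesis .
qed

text \<open>The singular kernel 1/z is replaced by the smooth \<open>K n\<close>, which is cnj z /
  (|z|^2 + \<epsilon>^2). Its dbar derivative 2 \<epsilon>^2 / (|z|^2 + \<epsilon>^2)^2 is an
  approximate identity of mass \<open>cauchy_const\<close>. Integration by parts against the smooth
  kernel followed by \<epsilon> to 0 replaces the usual excision of a small disc with its boundary
  integral.\<close>

lemma cauchy_pompeiu:
  assumes \<psi>: "\<psi> \<in> test_functions (UNIV :: complex set)"
  shows "(LINT z|lborel. dbar_along (\<lambda>z. z) \<psi> z * inverse z) = - (of_real cauchy_const * \<psi> 0)"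
proof -
  define \<epsilon> where "\<epsilon> n = inverse (real (Suc n))" for n
  have \<epsilon>: "\<epsilon> n > 0" for n by (simp add: \<epsilon>_def)
  have \<epsilon>_lim: "\<epsilon> \<longlonglongrightarrow> 0" unfolding \<epsilon>_def[abs_def] by (rule LIMSEQ_inverse_real_of_nat)
  define s where "s n z = complex_of_real ((norm z)\<^sup>2) + of_real ((\<epsilon> n)\<^sup>2)" for n and z :: complex
  define K where "K n z = cnj z * inverse (s n z)" for n z
  have s_real: "s n z = of_real ((norm z)\<^sup>2 + (\<epsilon> n)\<^sup>2)" for n z by (simp add: s_def)
  have s_pos: "(norm z)\<^sup>2 + (\<epsilon> n)\<^sup>2 > 0" for n and z :: complex
    using \<epsilon>[of n] by (simp add: add_nonneg_pos)
  have s_nz: "s n z \<noteq> 0" for n z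
    unfolding s_real of_real_eq_0_iff using s_pos[of z n] by linarith
  have Ck_s: "Ck_function k (s n)" for k n
  proof -
    have "Ck_function k (\<lambda>t. complex_of_real t + of_real ((\<epsilon> n)\<^sup>2))"
      by (intro Ck_function_add Ck_function_const Ck_function_linear bounded_linear_of_real)
    from Ck_function_compose_norm_sq[OF this] show ?thesis
      by (simp add: s_def[abs_def])
  qed
  have Ck_K: "Ck_function k (K n)" for k n
    unfolding K_def[abs_def]
    by (intro Ck_function_mult Ck_function_inverse Ck_s s_nz Ck_function_linear bounded_linear_cnj)
  have dbar_K: "dbar_along (\<lambda>z. z) (K n) z = 2 * of_real ((\<epsilon> n)\<^sup>2) * inverse ((s n z)\<^sup>2)" for n z
  proof -
    have "(s n has_derivative (\<lambda>v. of_real (2 * (z \<bullet> v)))) (at z)"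
      unfolding s_def power2_norm_eq_inner
      by (auto intro!: derivative_eq_intros simp: inner_commute)
    then have "((\<lambda>z. inverse (s n z)) has_derivative
        (\<lambda>v. - (inverse (s n z) * of_real (2 * (z \<bullet> v)) * inverse (s n z)))) (at z)"
      by (rule Deriv.has_derivative_inverse[where f = "s n", OF s_nz])
    from has_derivative_mult[OF bounded_linear_imp_has_derivative[OF bounded_linear_cnj] this]
    have "(K n has_derivative (\<lambda>v. cnj z * - (inverse (s n z) * of_real (2 * (z \<bullet> v)) * inverse (s n z)) +
        cnj v * inverse (s n z))) (at z)"
      by (simp add: K_def[abs_def])
    from frechet_derivative_at[OF this, symmetric]
    have "dbar_along (\<lambda>z. z) (K n) z = 2 * inverse (s n z) -
        2 * (cnj z * (Re z + \<i> * Im z)) * (inverse (s n z) * inverse (s n z))"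
      unfolding dbar_along_def by (simp add: inner_complex_def algebra_simps)
    also have "cnj z * (Re z + \<i> * Im z) = s n z - of_real ((\<epsilon> n)\<^sup>2)"
      by (simp add: s_def complex_eq[symmetric] complex_norm_square mult.commute del: of_real_power)
    also have "2 * inverse (s n z) - 2 * (s n z - of_real ((\<epsilon> n)\<^sup>2)) * (inverse (s n z) * inverse (s n z)) =
        2 * of_real ((\<epsilon> n)\<^sup>2) * inverse ((s n z)\<^sup>2)"
      using s_nz[of n z] by (simp add: field_simps power2_eq_square)
    finally show ?thesis .
  qed
  have d\<psi>: "dbar_along (\<lambda>z. z) \<psi> \<in> test_functions UNIV"
    by (rule test_functions_dbar_along[OF \<psi>])
  obtain B where B: "\<And>x. norm (\<psi> x) \<le> B"
    using test_functions_boundedE[OF \<psi>] by metis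
  obtain C where C: "\<And>x. norm (dbar_along (\<lambda>z. z) \<psi> x) \<le> C"
    using test_functions_boundedE[OF d\<psi>] by metis
  obtain r where r: "\<And>x. norm x > r \<Longrightarrow> dbar_along (\<lambda>z. z) \<psi> x = 0"
    using test_functions_support_cballE[OF d\<psi>] by metis
  note [measurable] = test_functionsD(3)[OF \<psi>] test_functionsD(3)[OF d\<psi>]
  have [measurable]: "s n \<in> borel_measurable borel" for n
    using Ck_s[of 0 n] by (auto intro: borel_measurable_continuous_onI)
  have [measurable]: "K n \<in> borel_measurable borel" for n
    using Ck_K[of 0 n] by (auto intro: borel_measurable_continuous_onI)
  \<comment> \<open>After integration by parts, substituting \<open>\<epsilon> n *\<^sub>R z\<close>
    for \<open>z\<close> moves all dependence on \<open>n\<close> into the argument of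
    \<open>\<psi>\<close>; the density becomes fixed.\<close>
  have eq: "(LINT z|lborel. dbar_along (\<lambda>z. z) \<psi> z * K n z) =
      - (LINT z|lborel. \<psi> (\<epsilon> n *\<^sub>R z) * of_real (2 / (1 + (norm z)\<^sup>2)\<^sup>2))" for n
  proof -
    have pt: "(\<epsilon> n)\<^sup>2 *\<^sub>R (\<psi> (\<epsilon> n *\<^sub>R z) * dbar_along (\<lambda>z. z) (K n) (\<epsilon> n *\<^sub>R z)) =
        \<psi> (\<epsilon> n *\<^sub>R z) * of_real (2 / (1 + (norm z)\<^sup>2)\<^sup>2)" for z
    proof -
      define a b where "a = (\<epsilon> n)\<^sup>2" and "b = 1 + (norm z)\<^sup>2"
      have ab: "a \<noteq> 0" "b \<noteq> 0"
        using \<epsilon>[of n] by (auto simp: a_def b_def add_nonneg_eq_0_iff)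
      have "s n (\<epsilon> n *\<^sub>R z) = of_real (a * b)"
        by (simp add: s_real a_def b_def algebra_simps power_mult_distrib)
      then have "dbar_along (\<lambda>z. z) (K n) (\<epsilon> n *\<^sub>R z) = of_real (2 * a / (a * b)\<^sup>2)"
        unfolding dbar_K by (simp add: a_def[symmetric] divide_inverse)
      then have "a *\<^sub>R dbar_along (\<lambda>z. z) (K n) (\<epsilon> n *\<^sub>R z) = of_real (a * (2 * a / (a * b)\<^sup>2))"
        by (simp only: scaleR_conv_of_real of_real_mult)
      also have "a * (2 * a / (a * b)\<^sup>2) = 2 / b\<^sup>2"
        using ab by (simp add: power2_eq_square)
      finally have "(\<epsilon> n)\<^sup>2 *\<^sub>R dbar_along (\<lambda>z. z) (K n) (\<epsilon> n *\<^sub>R z) = of_real (2 / (1 + (norm z)\<^sup>2)\<^sup>2)"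
        by (simp only: a_def b_def)
      then show ?thesis by (simp add: mult_scaleR_right[symmetric] del: mult_scaleR_right)
    qed
    have 1: "integrable lborel (\<lambda>z. dbar_along (\<lambda>z. z) \<psi> z * K n z)"
      by (intro test_functions_integrable[OF test_functions_mult[OF d\<psi> Ck_K]])
    have "dbar_along (\<lambda>z. z) (K n) = (\<lambda>z. 2 * of_real ((\<epsilon> n)\<^sup>2) * (inverse (s n z) * inverse (s n z)))"
      using dbar_K by (auto simp: power2_eq_square)
    then have "\<And>k. Ck_function k (dbar_along (\<lambda>z. z) (K n))"
      by (simp only:) (intro Ck_function_mult Ck_function_const Ck_function_inverse Ck_s s_nz)
    then have 2: "integrable lborel (\<lambda>z. \<psi> z * dbar_along (\<lambda>z. z) (K n) z)"
      by (intro test_functions_integrable[OF test_functions_mult[OF \<psi>]])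
    have "0 = (LINT z|lborel. dbar_along (\<lambda>z. z) (\<lambda>z. \<psi> z * K n z) z)"
      by (rule integral_dbar_along_test_function[OF test_functions_mult[OF \<psi> Ck_K], symmetric])
    also have "\<dots> = (LINT z|lborel. \<psi> z * dbar_along (\<lambda>z. z) (K n) z) + (LINT z|lborel. dbar_along (\<lambda>z. z) \<psi> z * K n z)"
      by (subst dbar_along_mult[OF test_functionsD(1)[OF \<psi>] Ck_K]) (rule Bochner_Integration.integral_add[OF 2 1])
    finally have "(LINT z|lborel. dbar_along (\<lambda>z. z) \<psi> z * K n z) = - (LINT z|lborel. \<psi> z * dbar_along (\<lambda>z. z) (K n) z)"
      by (simp add: eq_neg_iff_add_eq_0 add.commute)
    also have "(LINT z|lborel. \<psi> z * dbar_along (\<lambda>z. z) (K n) z) =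
        (LINT z|lborel. (\<epsilon> n)\<^sup>2 *\<^sub>R (\<psi> (\<epsilon> n *\<^sub>R z) * dbar_along (\<lambda>z. z) (K n) (\<epsilon> n *\<^sub>R z)))"
      unfolding dbar_K by (rule integral_complex_scale[OF _ \<epsilon>]) measurable
    also have "\<dots> = (LINT z|lborel. \<psi> (\<epsilon> n *\<^sub>R z) * of_real (2 / (1 + (norm z)\<^sup>2)\<^sup>2))"
      by (simp only: pt)
    finally show ?thesis .
  qed
  \<comment> \<open>The regularised kernel never exceeds 1/|z| in norm, so the limit integrand
    itself dominates.\<close>
  have lim1: "(\<lambda>n. LINT z|lborel. dbar_along (\<lambda>z. z) \<psi> z * K n z) \<longlonglongrightarrow> (LINT z|lborel. dbar_along (\<lambda>z. z) \<psi> z * inverse z)"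
  proof (rule integral_dominated_convergence)
    show "integrable lborel (\<lambda>z. norm (dbar_along (\<lambda>z. z) \<psi> z * inverse z))"
      by (intro integrable_norm integrable_mult_inverse[OF _ C r]) auto
    have nz: "AE z in lborel. (z::complex) \<noteq> 0" by (rule AE_lborel_singleton)
    show "AE z in lborel. (\<lambda>n. dbar_along (\<lambda>z. z) \<psi> z * K n z) \<longlonglongrightarrow> dbar_along (\<lambda>z. z) \<psi> z * inverse z"
      using nz
    proof (rule eventually_mono)
      fix z :: complex assume "z \<noteq> 0"
      then have "(\<lambda>n. dbar_along (\<lambda>z. z) \<psi> z * K n z) \<longlonglongrightarrow>
          dbar_along (\<lambda>z. z) \<psi> z * (cnj z * inverse (of_real ((norm z)\<^sup>2) + of_real (0\<^sup>2)))"
        unfolding K_def s_def by (intro tendsto_intros \<epsilon>_lim) auto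
      also have "cnj z * inverse (of_real ((norm z)\<^sup>2) + of_real (0\<^sup>2)) = inverse z"
        using \<open>z \<noteq> 0\<close> by (simp add: complex_norm_square field_simps del: of_real_power)
      finally show "(\<lambda>n. dbar_along (\<lambda>z. z) \<psi> z * K n z) \<longlonglongrightarrow> dbar_along (\<lambda>z. z) \<psi> z * inverse z" .
    qed
    show "AE z in lborel. norm (dbar_along (\<lambda>z. z) \<psi> z * K n z) \<le> norm (dbar_along (\<lambda>z. z) \<psi> z * inverse z)" for n
      using nz
    proof (rule eventually_mono)
      fix z :: complex assume z: "z \<noteq> 0"
      have "norm (K n z) = norm z / ((norm z)\<^sup>2 + (\<epsilon> n)\<^sup>2)"
        using s_pos[of z n] unfolding K_def s_real by (simp add: norm_mult norm_inverse divide_inverse del: of_real_add)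
      also have "\<dots> \<le> norm z / (norm z)\<^sup>2"
        using z s_pos[of z n] by (intro divide_left_mono mult_pos_pos) auto
      also have "\<dots> = norm (inverse z)"
        using z by (simp add: norm_inverse power2_eq_square divide_inverse)
      finally show "norm (dbar_along (\<lambda>z. z) \<psi> z * K n z) \<le> norm (dbar_along (\<lambda>z. z) \<psi> z * inverse z)"
        unfolding norm_mult by (rule mult_left_mono) auto
    qed
  qed measurable
  have lim2: "(\<lambda>n. LINT z|lborel. \<psi> (\<epsilon> n *\<^sub>R z) * of_real (2 / (1 + (norm z)\<^sup>2)\<^sup>2)) \<longlonglongrightarrow>
      (LINT z::complex|lborel. \<psi> (0 *\<^sub>R z) * of_real (2 / (1 + (norm z)\<^sup>2)\<^sup>2))"
  proof (rule integral_dominated_convergence)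
    show "integrable lborel (\<lambda>z::complex. B * (2 / (1 + (norm z)\<^sup>2)\<^sup>2))"
      by (intro integrable_mult_right integrable_cauchy_const)
    have "isCont \<psi> x" for x
      using test_functionsD(2)[OF \<psi>, of UNIV] by (auto simp: continuous_on_eq_continuous_at)
    then show "AE z in lborel. (\<lambda>n. \<psi> (\<epsilon> n *\<^sub>R z) * of_real (2 / (1 + (norm z)\<^sup>2)\<^sup>2)) \<longlonglongrightarrow>
        \<psi> (0 *\<^sub>R z) * of_real (2 / (1 + (norm z)\<^sup>2)\<^sup>2)"
      by (intro always_eventually allI tendsto_mult tendsto_const isCont_tendsto_compose[of _ \<psi>] tendsto_scaleR \<epsilon>_lim)
    show "AE z in lborel. norm (\<psi> (\<epsilon> n *\<^sub>R z) * of_real (2 / (1 + (norm z)\<^sup>2)\<^sup>2)) \<le> B * (2 / (1 + (norm z)\<^sup>2)\<^sup>2)" for n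
      by (intro always_eventually allI, unfold norm_mult, intro mult_mono B order_trans[OF norm_ge_zero B])
        (auto simp del: of_real_divide)
  qed measurable
  have "(LINT z::complex|lborel. \<psi> (0 *\<^sub>R z) * of_real (2 / (1 + (norm z)\<^sup>2)\<^sup>2)) = of_real cauchy_const * \<psi> 0"
    unfolding cauchy_const_def by (simp add: mult.commute del: of_real_divide flip: integral_complex_of_real)
  with LIMSEQ_unique[OF lim1[unfolded eq] tendsto_minus[OF lim2]] show ?thesis
    by (simp only:)
qed

section \<open>The fundamental lemma and the Cauchy transform along a line\<close>

text \<open>The parameter \<open>c\<close> steepens the bump without moving its support: exp(-1/(c
  t)) tends to 1 for each t > 0, so the bumps tend to the indicator of the open box.\<close>

definition box_bump :: "'a::euclidean_space \<Rightarrow> 'a \<Rightarrow> real \<Rightarrow> 'a \<Rightarrow> complex" where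
  "box_bump a b c x = (\<Prod>i\<in>Basis. flat 0 (c * (x \<bullet> i - a \<bullet> i)) * flat 0 (c * (b \<bullet> i - x \<bullet> i)))"

lemma Ck_function_box_bump: "Ck_function k (box_bump a b c)"
proof -
  have L: "bounded_linear (\<lambda>x. c * (x \<bullet> i))" "bounded_linear (\<lambda>x. - (c * (x \<bullet> i)))" for i :: 'a
    by (intro bounded_linear_minus bounded_linear_const_mult bounded_linear_inner_left)+
  have "Ck_function k (\<lambda>x. flat 0 (- (c * (a \<bullet> i)) + c * (x \<bullet> i)))"
    "Ck_function k (\<lambda>x. flat 0 (c * (b \<bullet> i) + - (c * (x \<bullet> i))))" for i
    by (rule Ck_function_affine[OF L(1) Ck_function_flat], rule Ck_function_affine[OF L(2) Ck_function_flat])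
  then have "Ck_function k (\<lambda>x. flat 0 (c * (x \<bullet> i - a \<bullet> i)))"
    "Ck_function k (\<lambda>x. flat 0 (c * (b \<bullet> i - x \<bullet> i)))" for i
    by (simp_all add: right_diff_distrib)
  then show ?thesis
    unfolding box_bump_def[abs_def] by (intro Ck_function_prod Ck_function_mult)
qed

lemma box_bump_eq_0_iff: "c > 0 \<Longrightarrow> box_bump a b c x = 0 \<longleftrightarrow> x \<notin> box a b"
proof -
  assume "c > 0"
  then have "flat 0 (c * (x \<bullet> i - a \<bullet> i)) * flat 0 (c * (b \<bullet> i - x \<bullet> i)) = 0 \<longleftrightarrow> \<not> (a \<bullet> i < x \<bullet> i \<and> x \<bullet> i < b \<bullet> i)" for i
    by (auto simp: flat_0_eq_0_iff mult_le_0_iff)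
  then show ?thesis
    unfolding box_bump_def prod_zero_iff[OF finite_Basis] mem_box by blast
qed

lemma norm_box_bump_le: "norm (box_bump a b c x) \<le> 1"
  unfolding box_bump_def prod_norm[symmetric] norm_mult
  by (intro prod_le_1 conjI mult_nonneg_nonneg mult_le_one norm_flat_0_le) auto

lemma flat_0_scaled_tendsto_1:
  assumes "t > 0"
  shows "(\<lambda>n. flat 0 (real (Suc n) * t)) \<longlonglongrightarrow> 1"
proof -
  have "(\<lambda>n. inverse (real (Suc n)) * inverse t) \<longlonglongrightarrow> 0 * inverse t"
    by (intro tendsto_mult LIMSEQ_inverse_real_of_nat tendsto_const)
  then have "(\<lambda>n. complex_of_real (exp (- (inverse (real (Suc n)) * inverse t)))) \<longlonglongrightarrow> of_real (exp (- (0 * inverse t)))"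
    by (intro tendsto_of_real tendsto_exp tendsto_minus)
  moreover have "flat 0 (real (Suc n) * t) = of_real (exp (- (inverse (real (Suc n)) * inverse t)))" for n
    using assms by (simp add: flat_def mult_le_0_iff)
  ultimately show ?thesis by simp
qed

lemma box_bump_tendsto_indicator:
  "(\<lambda>n. box_bump a b (real (Suc n)) x) \<longlonglongrightarrow> indicator (box a b) x"
proof (cases "x \<in> box a b")
  case True
  have "(\<lambda>n. box_bump a b (real (Suc n)) x) \<longlonglongrightarrow> (\<Prod>i\<in>(Basis::'a set). 1 * 1)"
    unfolding box_bump_def
    using True by (intro tendsto_prod tendsto_mult flat_0_scaled_tendsto_1) (auto simp: mem_box)
  with True show ?thesis by simp
next
  case False
  then have "box_bump a b (real (Suc n)) x = 0" for n
    by (subst box_bump_eq_0_iff) auto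
  with False show ?thesis by simp
qed

text \<open>Bumps converging to the indicator of a box show that \<open>g\<close> has integral 0
  over every closed box in \<open>\<Omega>\<close>. Lebesgue differentiation over small cubes then
  gives \<open>g x = 0\<close> almost everywhere, and countably many boxes cover
  \<open>\<Omega>\<close>.\<close>

lemma AE_eq_0_if_integral_test_functions:
  fixes g :: "'a::euclidean_space \<Rightarrow> complex"
  assumes "open \<Omega>" and meas[measurable]: "g \<in> borel_measurable borel"
    and int: "\<And>K. compact K \<Longrightarrow> K \<subseteq> \<Omega> \<Longrightarrow> integrable lborel (\<lambda>x. indicator K x *\<^sub>R g x)"
    and zero: "\<And>\<phi>. \<phi> \<in> test_functions \<Omega> \<Longrightarrow> (LINT x|lborel. g x * \<phi> x) = 0"
  shows "AE x in lborel. x \<in> \<Omega> \<longrightarrow> g x = 0"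
proof -
  have box0: "integral (cbox a b) g = 0" if "cbox a b \<subseteq> \<Omega>" for a b
  proof -
    have int_ab: "integrable lborel (\<lambda>x. indicator (cbox a b) x *\<^sub>R g x)"
      by (rule int[OF compact_cbox that])
    have [measurable]: "box_bump a b c \<in> borel_measurable borel" for c
      using Ck_function_box_bump[of 0] by (auto intro: borel_measurable_continuous_onI)
    have "(\<lambda>n. LINT x|lborel. g x * box_bump a b (real (Suc n)) x) \<longlonglongrightarrow> (LINT x|lborel. g x * indicator (box a b) x)"
    proof (rule integral_dominated_convergence)
      show "integrable lborel (\<lambda>x. norm (indicator (cbox a b) x *\<^sub>R g x))"
        using int_ab by (rule integrable_norm)
      show "AE x in lborel. (\<lambda>n. g x * box_bump a b (real (Suc n)) x) \<longlonglongrightarrow> g x * indicator (box a b) x"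
        by (intro always_eventually allI tendsto_mult tendsto_const box_bump_tendsto_indicator)
      show "AE x in lborel. norm (g x * box_bump a b (real (Suc n)) x) \<le> norm (indicator (cbox a b) x *\<^sub>R g x)" for n
      proof (intro always_eventually allI)
        fix x show "norm (g x * box_bump a b (real (Suc n)) x) \<le> norm (indicator (cbox a b) x *\<^sub>R g x)"
        proof (cases "x \<in> box a b")
          case True
          then have "x \<in> cbox a b" using box_subset_cbox by blast
          then show ?thesis
            using mult_left_mono[OF norm_box_bump_le[of a b "real (Suc n)" x] norm_ge_zero[of "g x"]]
            by (simp add: norm_mult)
        next
          case False
          then have "box_bump a b (real (Suc n)) x = 0"
            by (subst box_bump_eq_0_iff) auto
          then show ?thesis by simp
        qed
      qed
    qed measurable
    moreover have "(LINT x|lborel. g x * box_bump a b (real (Suc n)) x) = 0" for n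
    proof (rule zero, rule test_functionsI[OF Ck_function_box_bump compact_cbox that])
      fix x assume "box_bump a b (real (Suc n)) x \<noteq> 0"
      then have "x \<in> box a b" by (subst (asm) box_bump_eq_0_iff) auto
      then show "x \<in> cbox a b" using box_subset_cbox by blast
    qed
    ultimately have "(LINT x|lborel. g x * indicator (box a b) x) = 0"
      by (simp add: LIMSEQ_const_iff)
    then have "(LINT x:box a b|lborel. g x) = 0"
      unfolding set_lebesgue_integral_def
      by (simp add: scaleR_conv_of_real mult.commute of_real_indicator)
    moreover have "set_integrable lborel (box a b) g"
      using int_ab unfolding set_integrable_def[symmetric]
      by (rule set_integrable_subset) (auto simp: box_subset_cbox)
    ultimately have "integral (box a b) g = 0"
      using set_borel_integral_eq_integral(2) by metis
    then show ?thesis by (simp add: integral_open_interval)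
  qed
  have box: "AE x in lborel. x \<in> cbox p q \<longrightarrow> g x = 0" if pq: "cbox p q \<subseteq> \<Omega>" for p q
  proof -
    define G where "G x = indicator (cbox p q) x *\<^sub>R g x" for x
    have "integrable lborel G" unfolding G_def[abs_def] by (rule int[OF compact_cbox pq])
    then have "G integrable_on UNIV" by (rule integrable_on_lborel)
    then have "G integrable_on cbox a b" for a b
      by (rule integrable_on_subcbox) auto
    then obtain N where N: "negligible N"
      "\<And>x e. x \<notin> N \<Longrightarrow> 0 < e \<Longrightarrow> \<exists>d>0. \<forall>h. 0 < h \<and> h < d \<longrightarrow>
        norm (integral (cbox x (x + h *\<^sub>R One)) G /\<^sub>R h ^ DIM('a) - G x) < e"
      by (rule integrable_ccontinuous_explicit) blast
    have "g x = 0" if x: "x \<in> box p q" "x \<notin> N" for x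
    proof (rule ccontr)
      assume "g x \<noteq> 0"
      then have "norm (g x) > 0" by simp
      from N(2)[OF x(2) this] obtain d where d: "d > 0"
        "\<And>h. 0 < h \<Longrightarrow> h < d \<Longrightarrow> norm (integral (cbox x (x + h *\<^sub>R One)) G /\<^sub>R h ^ DIM('a) - G x) < norm (g x)"
        by blast
      obtain \<delta> where \<delta>: "\<delta> > 0" "ball x \<delta> \<subseteq> box p q"
        using x(1) open_box open_contains_ball by blast
      \<comment> \<open>The cube of side \<open>h\<close> with corner \<open>x\<close> lies within
        l^1 distance \<open>h * DIM('a)\<close> of \<open>x\<close>, which is at most half of
        \<open>\<delta>\<close>.\<close>
      define h where "h = min (d / 2) (\<delta> / (2 * DIM('a)))"
      have h: "0 < h" "h < d" "h * DIM('a) < \<delta>"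
      proof -
        show "0 < h" "h < d" using d(1) \<delta>(1) by (auto simp: h_def min_def)
        have "h * DIM('a) \<le> \<delta> / (2 * DIM('a)) * DIM('a)"
          by (intro mult_right_mono) (auto simp: h_def)
        also have "\<dots> < \<delta>" using \<delta>(1) by simp
        finally show "h * DIM('a) < \<delta>" .
      qed
      have sub: "cbox x (x + h *\<^sub>R One) \<subseteq> cbox p q"
      proof
        fix y assume "y \<in> cbox x (x + h *\<^sub>R One)"
        then have "\<bar>(y - x) \<bullet> i\<bar> \<le> h" if "i \<in> Basis" for i
          using that by (auto simp: mem_box inner_diff_left inner_add_left inner_sum_left_Basis)
        then have "(\<Sum>i\<in>Basis. \<bar>(y - x) \<bullet> i\<bar>) \<le> (\<Sum>i\<in>(Basis::'a set). h)"
          by (rule sum_mono)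
        then have "norm (y - x) < \<delta>"
          using norm_le_l1[of "y - x"] h(3) by (simp add: mult.commute)
        then show "y \<in> cbox p q"
          using \<delta>(2) box_subset_cbox[of p q] by (auto simp: dist_norm norm_minus_commute subset_iff)
      qed
      have "integral (cbox x (x + h *\<^sub>R One)) G = integral (cbox x (x + h *\<^sub>R One)) g"
        by (rule integral_cong) (use sub in \<open>auto simp: G_def\<close>)
      also have "\<dots> = 0" using sub pq by (intro box0) auto
      finally have "norm (G x) < norm (g x)" using d(2)[OF h(1,2)] by simp
      moreover have "x \<in> cbox p q" using x(1) box_subset_cbox by blast
      ultimately show False by (simp add: G_def)
    qed
    then have "x \<notin> N \<union> (cbox p q - box p q) \<Longrightarrow> x \<in> cbox p q \<longrightarrow> g x = 0" for x by blast
    moreover have "negligible (N \<union> (cbox p q - box p q))"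
      using N(1) negligible_frontier_interval by (rule negligible_Un)
    ultimately have "AE x in lebesgue. x \<in> cbox p q \<longrightarrow> g x = 0"
      by (intro AE_I'[of "N \<union> (cbox p q - box p q)"]) (auto simp: negligible_iff_null_sets)
    then show ?thesis by (simp add: AE_completion_iff)
  qed
  obtain D where D: "countable D" "D \<subseteq> Pow \<Omega>" "\<And>X. X \<in> D \<Longrightarrow> \<exists>a b. X = cbox a b" "\<Union>D = \<Omega>"
    using open_countable_Union_open_cbox[OF \<open>open \<Omega>\<close>] by blast
  have "AE x in lborel. \<forall>X\<in>D. x \<in> X \<longrightarrow> g x = 0"
    using D(1)
  proof (rule AE_ball_countable[THEN iffD2], intro ballI)
    fix X assume X: "X \<in> D"
    with D(2,3) obtain a b where "X = cbox a b" "cbox a b \<subseteq> \<Omega>" by blast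
    with box show "AE x in lborel. x \<in> X \<longrightarrow> g x = 0" by blast
  qed
  then show ?thesis using D(4) by (auto elim!: eventually_mono)
qed

section \<open>Cauchy convolution along one complex coordinate\<close>

lemma norm_axis: "norm (axis l (z::complex)) = norm z"
  by (simp add: norm_eq_sqrt_inner inner_axis_axis)

lemma bounded_linear_axis: "bounded_linear (axis l :: complex \<Rightarrow> complex^'n)"
  by (rule bounded_linear_intro[where K = 1]) (auto simp: axis_def vec_eq_iff norm_axis[unfolded axis_def])

lemma borel_measurable_axis [measurable]: "(axis l :: complex \<Rightarrow> complex^'n) \<in> borel_measurable borel"
  by (intro borel_measurable_continuous_onI linear_continuous_on bounded_linear_axis)

lemma test_functions_line:
  assumes "\<phi> \<in> test_functions (UNIV :: (complex^'n) set)"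
  shows "(\<lambda>z. \<phi> (y + axis l z)) \<in> test_functions UNIV"
proof -
  obtain r where r: "r > 0" "\<And>x. norm x > r \<Longrightarrow> \<phi> x = 0"
    using test_functions_support_cballE[OF assms] by metis
  show ?thesis
  proof (rule test_functionsI[of _ "cball 0 (r + norm y)"])
    show "Ck_function k (\<lambda>z. \<phi> (y + axis l z))" for k
      by (intro Ck_function_affine bounded_linear_axis test_functionsD(1)[OF assms])
    show "z \<in> cball 0 (r + norm y)" if "\<phi> (y + axis l z) \<noteq> 0" for z
    proof -
      have "norm (y + axis l z) \<le> r" using that r(2) not_le by blast
      then have "norm z \<le> r + norm y"
        using norm_diff_ineq[of "axis l z" y] by (simp add: norm_axis add.commute)
      then show ?thesis by simp
    qed
  qed auto
qed

lemma dbar_along_line: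
  assumes "Ck_function (Suc 0) f"
  shows "dbar_along (axis l) f (y + axis l z) = dbar_along (\<lambda>z. z) (\<lambda>z. f (y + axis l z)) z"
proof -
  have "((\<lambda>z. y + axis l z) has_derivative axis l) (at z)"
    using bounded_linear_imp_has_derivative[OF bounded_linear_axis, of l "at z"]
    by (auto intro!: derivative_eq_intros)
  from frechet_derivative_at[OF has_derivative_compose[OF this Ck_function_Suc_has_derivative[OF assms]], symmetric]
  show ?thesis by (simp add: dbar_along_def)
qed

text \<open>The plus sign makes this the transpose of the Cauchy transform that later represents
  weak solutions. It is applied to test functions only.\<close>

definition cauchy_conv :: "'n::finite \<Rightarrow> (complex^'n \<Rightarrow> complex) \<Rightarrow> complex^'n \<Rightarrow> complex" where
  "cauchy_conv l \<phi> y = (LINT z|lborel. \<phi> (y + axis l z) * inverse z)"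

lemma integrable_cauchy_conv:
  assumes "\<phi> \<in> test_functions (UNIV :: (complex^'n) set)"
  shows "integrable lborel (\<lambda>z. \<phi> (y + axis l z) * inverse z)"
proof -
  have *: "(\<lambda>z. \<phi> (y + axis l z)) \<in> test_functions UNIV" by (rule test_functions_line[OF assms])
  obtain B where "\<And>x. norm (\<phi> (y + axis l x)) \<le> B"
    using test_functions_boundedE[OF *] by metis
  moreover obtain r where "\<And>x. norm x > r \<Longrightarrow> \<phi> (y + axis l x) = 0"
    using test_functions_support_cballE[OF *] by metis
  ultimately show ?thesis
    by (intro integrable_mult_inverse test_functionsD(3)[OF *])
qed

text \<open>Differentiation under the integral sign, dominated by a multiple of 1/|z| on a fixed
  disc. All real directions of the space are covered, not only those of the line, because the result
  has to multiply test functions of all variables.\<close>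

lemma cauchy_conv_has_derivative:
  assumes \<phi>: "\<phi> \<in> test_functions (UNIV :: (complex^'n) set)"
  shows "(cauchy_conv l \<phi> has_derivative (\<lambda>v. cauchy_conv l (\<lambda>x. frechet_derivative \<phi> (at x) v) y)) (at y)"
proof -
  let ?D = "\<lambda>v x. frechet_derivative \<phi> (at x) v"
  note \<phi>' = test_functions_deriv[OF \<phi>]
  note d\<phi> = test_functionsD(4)[OF \<phi>]
  note lin = has_derivative_linear[OF d\<phi>]
  obtain B where B: "B > 0" "\<And>x v. norm (?D v x) \<le> B * norm v" "\<And>x y. norm (\<phi> x - \<phi> y) \<le> B * norm (x - y)"
    using test_functions_deriv_boundE[OF \<phi>] by metis
  obtain r where r: "r > 0" "\<And>x. norm x > r \<Longrightarrow> \<phi> x = 0"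
    using test_functions_support_cballE[OF \<phi>] by metis
  have r': "?D v x = 0" if "norm x > r" for v x
  proof -
    have "\<phi> x \<noteq> 0 \<Longrightarrow> x \<in> cball 0 r" for x using r(2)[of x] by (cases "norm x > r") auto
    then have "frechet_derivative \<phi> (at x) = (\<lambda>v. 0)"
      by (rule frechet_derivative_outside_support[OF closed_cball]) (use that in auto)
    then show ?thesis by simp
  qed
  note [measurable] = test_functionsD(3)[OF \<phi>] test_functionsD(3)[OF \<phi>']
  have bl: "bounded_linear (\<lambda>v. cauchy_conv l (?D v) y)"
  proof (rule bounded_linear_intro)
    fix v w show "cauchy_conv l (?D (v + w)) y = cauchy_conv l (?D v) y + cauchy_conv l (?D w) y"
      unfolding cauchy_conv_def
      by (subst Bochner_Integration.integral_add[symmetric])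
        (auto simp: integrable_cauchy_conv[OF \<phi>'] linear_add[OF lin] distrib_right)
  next
    fix c v show "cauchy_conv l (?D (c *\<^sub>R v)) y = c *\<^sub>R cauchy_conv l (?D v) y"
      unfolding cauchy_conv_def
      by (subst integral_scaleR_right[symmetric]) (auto simp: linear_scale[OF lin])
  next
    fix v
    let ?I = "LINT z|lborel. norm (indicator (cball 0 (r + norm y)) z *\<^sub>R inverse (z::complex))"
    have "norm (cauchy_conv l (?D v) y) \<le>
      (LINT z|lborel. (B * norm v) * norm (indicator (cball 0 (r + norm y)) z *\<^sub>R inverse (z::complex)))"
      unfolding cauchy_conv_def
    proof (rule Bochner_Integration.integral_norm_bound_integral[OF integrable_cauchy_conv[OF \<phi>']])
      show "integrable lborel (\<lambda>z. (B * norm v) * norm (indicator (cball 0 (r + norm y)) z *\<^sub>R inverse (z::complex)))"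
        by (intro integrable_mult_right integrable_norm integrable_inverse_on_cball)
      fix z :: complex
      show "norm (?D v (y + axis l z) * inverse z) \<le> (B * norm v) * norm (indicator (cball 0 (r + norm y)) z *\<^sub>R inverse z)"
      proof (cases "norm z \<le> r + norm y")
        case True
        then show ?thesis
          using mult_right_mono[OF B(2)[of "y + axis l z" v] norm_ge_zero[of "inverse z"]] by (simp add: norm_mult)
      next
        case False
        then have "norm (y + axis l z) > r"
          using norm_diff_ineq[of "axis l z" y] by (simp add: norm_axis add.commute)
        from r'[OF this] show ?thesis using B(1) by simp
      qed
    qed
    also have "\<dots> = norm v * (B * ?I)" by (subst integral_mult_right_zero) simp
    finally show "norm (cauchy_conv l (?D v) y) \<le> norm v * (B * ?I)" .
  qed
  moreover have "((\<lambda>h. norm (cauchy_conv l \<phi> (y + h) - cauchy_conv l \<phi> y - cauchy_conv l (?D h) y) / norm h) \<longlongrightarrow> 0) (at 0)"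
    unfolding tendsto_at_iff_sequentially comp_def
  proof (intro allI impI)
    fix X :: "nat \<Rightarrow> complex^'n" assume X: "\<forall>i. X i \<in> UNIV - {0}" "X \<longlonglongrightarrow> 0"
    obtain M where M: "\<And>i. norm (X i) \<le> M"
      using convergent_imp_bounded[OF X(2)] by (auto simp: bounded_iff)
    \<comment> \<open>Beyond this radius \<open>\<phi>\<close>, its derivative and all translates by
      \<open>X i\<close> vanish on the line through \<open>y\<close>.\<close>
    define R where "R = r + norm y + M"
    define q where "q i z = ((\<phi> (y + axis l z + X i) - \<phi> (y + axis l z) - ?D (X i) (y + axis l z)) /\<^sub>R norm (X i)) * inverse z" for i z
    have Mpos: "M \<ge> 0" using M[of 0] norm_ge_zero order_trans by blast
    have out: "\<phi> (y + axis l z + X i) = 0" "\<phi> (y + axis l z) = 0" "?D (X i) (y + axis l z) = 0"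
      if "norm z > R" for z i
    proof -
      have a: "norm (y + axis l z) \<ge> norm z - norm y"
        using norm_diff_ineq[of "axis l z" y] by (simp add: norm_axis add.commute)
      then have b: "norm (y + axis l z) > r" using that Mpos by (simp add: R_def)
      have "norm (y + axis l z + X i) \<ge> norm (y + axis l z) - norm (X i)" by (rule norm_diff_ineq)
      then have c: "norm (y + axis l z + X i) > r" using a that M[of i] by (simp add: R_def)
      show "\<phi> (y + axis l z + X i) = 0" "\<phi> (y + axis l z) = 0" "?D (X i) (y + axis l z) = 0"
        using r(2) r' b c by auto
    qed
    have "(\<lambda>i. LINT z|lborel. q i z) \<longlonglongrightarrow> (LINT z::complex|lborel. 0)"
    proof (rule integral_dominated_convergence)
      show "integrable lborel (\<lambda>z. (2 * B) * norm (indicator (cball 0 R) z *\<^sub>R inverse (z::complex)))"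
        by (intro integrable_mult_right integrable_norm integrable_inverse_on_cball)
      show "AE z in lborel. (\<lambda>i. q i z) \<longlonglongrightarrow> 0"
      proof (intro always_eventually allI)
        fix z :: complex
        have "((\<lambda>h. norm (\<phi> (y + axis l z + h) - \<phi> (y + axis l z) - ?D h (y + axis l z)) / norm h) \<longlongrightarrow> 0) (at 0)"
          using d\<phi>[of "y + axis l z"] unfolding has_derivative_at by blast
        then have "(\<lambda>i. norm (\<phi> (y + axis l z + X i) - \<phi> (y + axis l z) - ?D (X i) (y + axis l z)) / norm (X i)) \<longlonglongrightarrow> 0"
          unfolding tendsto_at_iff_sequentially comp_def using X by blast
        then have "(\<lambda>i. norm (\<phi> (y + axis l z + X i) - \<phi> (y + axis l z) - ?D (X i) (y + axis l z)) / norm (X i) * norm (inverse z)) \<longlonglongrightarrow> 0"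
          by (rule tendsto_mult_left_zero)
        moreover have "norm (q i z) = norm (\<phi> (y + axis l z + X i) - \<phi> (y + axis l z) - ?D (X i) (y + axis l z)) / norm (X i) * norm (inverse z)" for i
          by (simp add: q_def norm_mult divide_inverse mult.commute)
        ultimately show "(\<lambda>i. q i z) \<longlonglongrightarrow> 0"
          by (intro tendsto_norm_zero_cancel[of "\<lambda>i. q i z"]) simp
      qed
      show "AE z in lborel. norm (q i z) \<le> (2 * B) * norm (indicator (cball 0 R) z *\<^sub>R inverse z)" for i
      proof (intro always_eventually allI)
        fix z :: complex
        show "norm (q i z) \<le> (2 * B) * norm (indicator (cball 0 R) z *\<^sub>R inverse z)"
        proof (cases "norm z \<le> R")
          case True
          have "norm (\<phi> (y + axis l z + X i) - \<phi> (y + axis l z) - ?D (X i) (y + axis l z)) \<le> B * norm (X i) + B * norm (X i)"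
            using B(2)[of "y + axis l z" "X i"] B(3)[of "y + axis l z + X i" "y + axis l z"]
            by (intro norm_triangle_le_diff) auto
          then have "norm (\<phi> (y + axis l z + X i) - \<phi> (y + axis l z) - ?D (X i) (y + axis l z)) / norm (X i) \<le> 2 * B"
            using X(1) by (simp add: pos_divide_le_eq)
          from mult_right_mono[OF this norm_ge_zero[of "inverse z"]]
          show ?thesis using True by (simp add: q_def norm_mult divide_inverse ac_simps)
        next
          case False
          then have "q i z = 0" using out(1)[of z i] out(2)[of z] out(3)[of z i] by (simp add: q_def)
          then show ?thesis using B(1) by simp
        qed
      qed
    qed (unfold q_def, measurable)
    moreover have "(LINT z|lborel. q i z) = (cauchy_conv l \<phi> (y + X i) - cauchy_conv l \<phi> y - cauchy_conv l (?D (X i)) y) /\<^sub>R norm (X i)" for i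
    proof -
      have "(LINT z|lborel. q i z) = (LINT z|lborel. (\<phi> (y + X i + axis l z) * inverse z - \<phi> (y + axis l z) * inverse z - ?D (X i) (y + axis l z) * inverse z) /\<^sub>R norm (X i))"
        unfolding q_def by (rule arg_cong[where f = "integral\<^sup>L lborel"]) (auto simp: algebra_simps)
      also have "\<dots> = (cauchy_conv l \<phi> (y + X i) - cauchy_conv l \<phi> y - cauchy_conv l (?D (X i)) y) /\<^sub>R norm (X i)"
        unfolding cauchy_conv_def integral_scaleR_right
        by (simp add: Bochner_Integration.integral_diff integrable_cauchy_conv[OF \<phi>] integrable_cauchy_conv[OF \<phi>'])
      finally show ?thesis .
    qed
    ultimately have "(\<lambda>i. norm ((cauchy_conv l \<phi> (y + X i) - cauchy_conv l \<phi> y - cauchy_conv l (?D (X i)) y) /\<^sub>R norm (X i))) \<longlonglongrightarrow> 0"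
      by (intro tendsto_norm_zero) simp
    then show "(\<lambda>i. norm (cauchy_conv l \<phi> (y + X i) - cauchy_conv l \<phi> y - cauchy_conv l (?D (X i)) y) / norm (X i)) \<longlonglongrightarrow> 0"
      by (simp add: divide_inverse mult.commute)
  qed
  ultimately show ?thesis unfolding has_derivative_at by blast
qed

text \<open>Smoothness is all that is available: the convolution need not have compact support, so
  it becomes a test function only after multiplication by a cutoff.\<close>

lemma Ck_function_cauchy_conv:
  assumes "\<phi> \<in> test_functions (UNIV :: (complex^'n) set)"
  shows "Ck_function k (cauchy_conv l \<phi>)"
  using assms
proof (induction k arbitrary: \<phi>)
  case 0
  then show ?case
    using has_derivative_continuous[OF cauchy_conv_has_derivative]
    by (auto intro!: continuous_at_imp_continuous_on)
next
  case (Suc k)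
  show ?case
    by (rule Ck_function_SucI[OF cauchy_conv_has_derivative[OF Suc.prems]])
      (rule Suc.IH[OF test_functions_deriv[OF Suc.prems]])
qed

text \<open>The derivative falls on \<open>\<phi>\<close>, and what remains is the Cauchy-Pompeiu
  formula on the line through \<open>y\<close>, evaluated at 0.\<close>

lemma dbar_along_cauchy_conv:
  assumes \<phi>: "\<phi> \<in> test_functions (UNIV :: (complex^'n) set)"
  shows "dbar_along (axis l) (cauchy_conv l \<phi>) y = - (of_real cauchy_const * \<phi> y)"
proof -
  note \<phi>' = test_functions_deriv[OF \<phi>]
  have line: "dbar_along (\<lambda>z. z) (\<lambda>z. \<phi> (y + axis l z)) z = dbar_along (axis l) \<phi> (y + axis l z)" for z
    by (rule dbar_along_line[OF test_functionsD(1)[OF \<phi>], symmetric])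
  have "dbar_along (axis l) (cauchy_conv l \<phi>) y =
      cauchy_conv l (\<lambda>x. frechet_derivative \<phi> (at x) (axis l 1)) y +
      \<i> * cauchy_conv l (\<lambda>x. frechet_derivative \<phi> (at x) (axis l \<i>)) y"
    unfolding dbar_along_def frechet_derivative_at[OF cauchy_conv_has_derivative[OF \<phi>], symmetric] ..
  also have "\<dots> = (LINT z|lborel. dbar_along (\<lambda>z. z) (\<lambda>z. \<phi> (y + axis l z)) z * inverse z)"
    unfolding line unfolding cauchy_conv_def dbar_along_def integral_mult_right_zero[symmetric]
    by (subst Bochner_Integration.integral_add[symmetric])
      (auto simp: integrable_cauchy_conv[OF \<phi>'] distrib_right mult.assoc)
  also have "\<dots> = - (of_real cauchy_const * \<phi> y)"
    using cauchy_pompeiu[OF test_functions_line[OF \<phi>, of y l]] by (simp add: linear_0[OF bounded_linear.linear[OF bounded_linear_axis]])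
  finally show ?thesis .
qed

section \<open>Representation of weak solutions\<close>

lemma integrable_test_function_mult:
  assumes \<phi>: "\<phi> \<in> test_functions \<Omega>" and [measurable]: "u \<in> borel_measurable borel"
    and int: "\<And>K. compact K \<Longrightarrow> K \<subseteq> \<Omega> \<Longrightarrow> integrable lborel (\<lambda>x. indicator K x *\<^sub>R (u x :: complex))"
  shows "integrable lborel (\<lambda>x. \<phi> x * u x)"
proof -
  obtain K where K: "compact K" "K \<subseteq> \<Omega>" "\<And>x. \<phi> x \<noteq> 0 \<Longrightarrow> x \<in> K"
    using test_functions_supportE[OF \<phi>] by metis
  obtain B where B: "B > 0" "\<And>x. norm (\<phi> x) \<le> B"
    using test_functions_boundedE[OF \<phi>] by metis
  note [measurable] = test_functionsD(3)[OF \<phi>]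
  show ?thesis
  proof (rule Bochner_Integration.integrable_bound)
    show "integrable lborel (\<lambda>x. B * norm (indicator K x *\<^sub>R u x))"
      by (intro integrable_mult_right integrable_norm int K)
    have "norm (\<phi> x * u x) \<le> norm (B * norm (indicator K x *\<^sub>R u x))" for x
    proof (cases "\<phi> x = 0")
      case False
      then show ?thesis
        using K(3)[OF False] B(1) mult_right_mono[OF B(2)[of x] norm_ge_zero[of "u x"]] by (simp add: norm_mult)
    qed simp
    then show "AE x in lborel. norm (\<phi> x * u x) \<le> norm (B * norm (indicator K x *\<^sub>R u x))"
      by simp
  qed measurable
qed

text \<open>For fixed \<open>z\<close> the substitution is a translation in \<open>x\<close>;
  Tonelli is used before and after it.\<close>

lemma nn_integral_shear:
  fixes f :: "complex^'n \<Rightarrow> complex \<Rightarrow> ennreal"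
  assumes [measurable]: "case_prod f \<in> borel_measurable (borel \<Otimes>\<^sub>M borel)"
  shows "(\<integral>\<^sup>+x. \<integral>\<^sup>+z. f (x - axis l z) z \<partial>lborel \<partial>lborel) = (\<integral>\<^sup>+x. \<integral>\<^sup>+z. f x z \<partial>lborel \<partial>lborel)"
proof -
  have "(\<integral>\<^sup>+x. \<integral>\<^sup>+z. f (x - axis l z) z \<partial>lborel \<partial>lborel) = (\<integral>\<^sup>+z. \<integral>\<^sup>+x. f (x - axis l z) z \<partial>lborel \<partial>lborel)"
    by (rule lborel_pair.Fubini') measurable
  also have "\<dots> = (\<integral>\<^sup>+z. \<integral>\<^sup>+x. f x z \<partial>lborel \<partial>lborel)"
    using nn_integral_translation[of "\<lambda>x. f x _" "- axis l _"] by simp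
  also have "\<dots> = (\<integral>\<^sup>+x. \<integral>\<^sup>+z. f x z \<partial>lborel \<partial>lborel)"
    by (rule lborel_pair.Fubini'[symmetric]) measurable
  finally show ?thesis .
qed

text \<open>Supplies the absolute convergence behind the Fubini steps. The bounded supports confine
  \<open>z\<close> to a disc, so the double integral is dominated by a product of two finite
  integrals.\<close>

lemma nn_integral_cauchy_pair_finite:
  fixes G \<phi> :: "complex^'n \<Rightarrow> complex"
  assumes G: "integrable lborel G" "\<And>x. norm x > R \<Longrightarrow> G x = 0"
    and [measurable]: "\<phi> \<in> borel_measurable borel"
    and \<phi>: "\<And>x. norm (\<phi> x) \<le> B" "\<And>x. norm x > s \<Longrightarrow> \<phi> x = 0"
  shows "(\<integral>\<^sup>+x. \<integral>\<^sup>+z. ennreal (norm (G x * \<phi> (x + axis l z) * inverse z)) \<partial>lborel \<partial>lborel) < \<infinity>"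
proof -
  have [measurable]: "G \<in> borel_measurable borel" using borel_measurable_integrable[OF G(1)] by simp
  have B: "B \<ge> 0" using order_trans[OF norm_ge_zero \<phi>(1)] .
  let ?k = "\<lambda>z::complex. B * norm (indicator (cball 0 (R + s)) z *\<^sub>R inverse z)"
  have k: "integrable lborel ?k"
    by (intro integrable_mult_right integrable_norm integrable_inverse_on_cball)
  note [measurable] = borel_measurable_integrable[OF k]
  have le: "norm (G x * \<phi> (x + axis l z) * inverse z) \<le> norm (G x) * ?k z" for x z
  proof (cases "norm x > R \<or> norm (x + axis l z) > s")
    case True
    then have "G x = 0 \<or> \<phi> (x + axis l z) = 0" using G(2) \<phi>(2) by blast
    then show ?thesis using B by auto
  next
    case False
    then have "norm z \<le> R + s"
      using norm_diff_ineq[of "axis l z" x] by (simp add: norm_axis add.commute)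
    then show ?thesis
      using mult_left_mono[OF mult_right_mono[OF \<phi>(1)[of "x + axis l z"] norm_ge_zero[of "inverse z"]] norm_ge_zero[of "G x"]]
      by (simp add: norm_mult mult.assoc)
  qed
  have "(\<integral>\<^sup>+x. \<integral>\<^sup>+z. ennreal (norm (G x * \<phi> (x + axis l z) * inverse z)) \<partial>lborel \<partial>lborel) \<le>
      (\<integral>\<^sup>+x. \<integral>\<^sup>+z. ennreal (norm (G x)) * ennreal (?k z) \<partial>lborel \<partial>lborel)"
    using B by (intro nn_integral_mono, subst ennreal_mult[symmetric]) (auto simp del: norm_scaleR norm_mult intro!: ennreal_leI le)
  also have "\<dots> = (\<integral>\<^sup>+x. ennreal (norm (G x)) \<partial>lborel) * (\<integral>\<^sup>+z. ennreal (?k z) \<partial>lborel)"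
    by (subst nn_integral_cmult, measurable, subst nn_integral_multc, measurable)
  also have "\<dots> < \<infinity>"
    using G(1) k B unfolding integrable_iff_bounded by (auto simp: ennreal_mult_less_top)
  finally show ?thesis .
qed

text \<open>The proof is by duality and never differentiates \<open>u\<close>. The weak equation is
  tested with \<open>\<eta>\<close> times the Cauchy convolution of an arbitrary
  \<open>\<phi>\<close>; the dbar derivative of the convolution gives back \<open>\<phi>\<close> up
  to the constant. Transposing the convolution shows that both sides have the same integral against
  every \<open>\<phi>\<close>.\<close>

lemma cauchy_representation:
  fixes u P \<eta> :: "complex^'n \<Rightarrow> complex"
  assumes [measurable]: "u \<in> borel_measurable borel" "P \<in> borel_measurable borel"
    and int_u: "\<And>K. compact K \<Longrightarrow> K \<subseteq> \<Omega> \<Longrightarrow> integrable lborel (\<lambda>x. indicator K x *\<^sub>R u x)"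
    and int_P: "\<And>K. compact K \<Longrightarrow> K \<subseteq> \<Omega> \<Longrightarrow> integrable lborel (\<lambda>x. indicator K x *\<^sub>R P x)"
    and weak: "\<And>\<phi>. \<phi> \<in> test_functions \<Omega> \<Longrightarrow>
      (LINT x|lborel. u x * dbar_along (axis l) \<phi> x) = - (LINT x|lborel. P x * \<phi> x)"
    and \<eta>: "\<eta> \<in> test_functions \<Omega>"
  defines "G \<equiv> \<lambda>x. \<eta> x * P x + dbar_along (axis l) \<eta> x * u x"
  shows "AE x in lborel. of_real cauchy_const * (\<eta> x * u x) = (LINT z|lborel. G (x - axis l z) * inverse z)"
proof -
  note d\<eta> = test_functions_dbar_along[OF \<eta>, of "axis l"]
  note [measurable] = test_functionsD(3)[OF \<eta>] test_functionsD(3)[OF d\<eta>]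
  have int_\<eta>P: "integrable lborel (\<lambda>x. \<eta> x * P x)"
    by (rule integrable_test_function_mult[OF \<eta> _ int_P]) auto
  have int_d\<eta>u: "integrable lborel (\<lambda>x. dbar_along (axis l) \<eta> x * u x)"
    by (rule integrable_test_function_mult[OF d\<eta> _ int_u]) auto
  have G: "integrable lborel G"
    unfolding G_def by (intro Bochner_Integration.integrable_add int_\<eta>P int_d\<eta>u)
  have [measurable]: "G \<in> borel_measurable borel" unfolding G_def by measurable
  obtain R1 where R1: "\<And>x. norm x > R1 \<Longrightarrow> \<eta> x = 0" using test_functions_support_cballE[OF \<eta>] by metis
  obtain R2 where R2: "\<And>x. norm x > R2 \<Longrightarrow> dbar_along (axis l) \<eta> x = 0" using test_functions_support_cballE[OF d\<eta>] by metis
  define R where "R = max R1 R2"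
  have GR: "G x = 0" if "norm x > R" for x
    using that R1 R2 by (simp add: G_def R_def)
  define T where "T x = (LINT z|lborel. G (x - axis l z) * inverse z)" for x
  have [measurable]: "T \<in> borel_measurable borel"
    unfolding T_def[abs_def] by measurable
  \<comment> \<open>Boundedness and bounded support of \<open>\<psi>\<close> suffice, so this serves
    test functions as well as indicators of compact sets.\<close>
  have pairB: "integrable (lborel \<Otimes>\<^sub>M lborel) (\<lambda>(x, z). \<psi> x * (G (x - axis l z) * inverse z))"
    if [measurable]: "\<psi> \<in> borel_measurable borel"
      and \<psi>: "\<And>x. norm (\<psi> x) \<le> B" "\<And>x. norm x > s \<Longrightarrow> \<psi> x = 0" for \<psi> B s
  proof (rule integrableI_bounded)
    have "(\<integral>\<^sup>+ p. ennreal (norm (case p of (x, z) \<Rightarrow> \<psi> x * (G (x - axis l z) * inverse z))) \<partial>(lborel \<Otimes>\<^sub>M lborel)) =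
        (\<integral>\<^sup>+x. \<integral>\<^sup>+z. ennreal (norm (\<psi> x * (G (x - axis l z) * inverse z))) \<partial>lborel \<partial>lborel)"
      by (subst lborel.nn_integral_fst[symmetric]) auto
    also have "\<dots> = (\<integral>\<^sup>+x. \<integral>\<^sup>+z. ennreal (norm (G x * \<psi> (x + axis l z) * inverse z)) \<partial>lborel \<partial>lborel)"
      using nn_integral_shear[of "\<lambda>x z. ennreal (norm (G x * \<psi> (x + axis l z) * inverse z))" l]
      by (simp add: ac_simps)
    also have "\<dots> < \<infinity>"
      by (rule nn_integral_cauchy_pair_finite[where R = R, OF G GR _ \<psi>]) auto
    finally show "(\<integral>\<^sup>+ p. ennreal (norm (case p of (x, z) \<Rightarrow> \<psi> x * (G (x - axis l z) * inverse z))) \<partial>(lborel \<Otimes>\<^sub>M lborel)) < \<infinity>" .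
  qed measurable
  have T_int: "integrable lborel (\<lambda>x. \<psi> x * T x)"
    if "\<psi> \<in> borel_measurable borel" "\<And>x. norm (\<psi> x) \<le> B" "\<And>x. norm x > s \<Longrightarrow> \<psi> x = 0" for \<psi> B s
    using lborel_pair.integrable_fst[OF pairB[OF that]] by (simp add: T_def)
  have T_eq: "(LINT x|lborel. \<phi> x * T x) = (LINT x|lborel. G x * cauchy_conv l \<phi> x)"
    if \<phi>: "\<phi> \<in> test_functions UNIV" for \<phi>
  proof -
    note [measurable] = test_functionsD(3)[OF \<phi>]
    obtain B where B: "\<And>x. norm (\<phi> x) \<le> B" using test_functions_boundedE[OF \<phi>] by metis
    obtain s where s: "\<And>x. norm x > s \<Longrightarrow> \<phi> x = 0" using test_functions_support_cballE[OF \<phi>] by metis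
    have pairA: "integrable (lborel \<Otimes>\<^sub>M lborel) (\<lambda>(x, z). G x * \<phi> (x + axis l z) * inverse z)"
    proof (rule integrableI_bounded)
      have "(\<integral>\<^sup>+ p. ennreal (norm (case p of (x, z) \<Rightarrow> G x * \<phi> (x + axis l z) * inverse z)) \<partial>(lborel \<Otimes>\<^sub>M lborel)) =
          (\<integral>\<^sup>+x. \<integral>\<^sup>+z. ennreal (norm (G x * \<phi> (x + axis l z) * inverse z)) \<partial>lborel \<partial>lborel)"
        by (subst lborel.nn_integral_fst[symmetric]) auto
      also have "\<dots> < \<infinity>"
        by (rule nn_integral_cauchy_pair_finite[where R = R, OF G GR _ B s]) auto
      finally show "(\<integral>\<^sup>+ p. ennreal (norm (case p of (x, z) \<Rightarrow> G x * \<phi> (x + axis l z) * inverse z)) \<partial>(lborel \<Otimes>\<^sub>M lborel)) < \<infinity>" .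
    qed measurable
    have tr: "(LINT x|lborel. \<phi> x * (G (x - axis l z) * inverse z)) = (LINT x|lborel. G x * \<phi> (x + axis l z) * inverse z)" for z
      using integral_translation[of "\<lambda>x. \<phi> x * (G (x - axis l z) * inverse z)" "axis l z"]
      by (auto simp: ac_simps)
    have "(LINT x|lborel. \<phi> x * T x) = (LINT x|lborel. LINT z|lborel. \<phi> x * (G (x - axis l z) * inverse z))"
      by (simp add: T_def)
    also have "\<dots> = (LINT z|lborel. LINT x|lborel. \<phi> x * (G (x - axis l z) * inverse z))"
      using lborel_pair.Fubini_integral[OF pairB[OF _ B s]] by simp
    also have "\<dots> = (LINT z|lborel. LINT x|lborel. G x * \<phi> (x + axis l z) * inverse z)"
      by (simp only: tr)
    also have "\<dots> = (LINT x|lborel. LINT z|lborel. G x * \<phi> (x + axis l z) * inverse z)"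
      using lborel_pair.Fubini_integral[OF pairA] by simp
    also have "\<dots> = (LINT x|lborel. G x * cauchy_conv l \<phi> x)"
      unfolding cauchy_conv_def mult.assoc integral_mult_right_zero ..
    finally show ?thesis .
  qed
  have int_\<eta>u: "integrable lborel (\<lambda>x. \<eta> x * u x)"
    by (rule integrable_test_function_mult[OF \<eta> _ int_u]) auto
  \<comment> \<open>Here \<open>\<phi>\<close> ranges over test functions on the whole space; the
    cutoff \<open>\<eta>\<close> brings the test function in the weak equation back into
    \<open>\<Omega>\<close>.\<close>
  have "AE x in lborel. x \<in> UNIV \<longrightarrow> of_real cauchy_const * (\<eta> x * u x) - T x = 0"
  proof (rule AE_eq_0_if_integral_test_functions)
    fix K :: "(complex^'n) set" assume K: "compact K" "K \<subseteq> UNIV"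
    obtain s where s: "\<And>x. x \<in> K \<Longrightarrow> norm x \<le> s"
      using compact_imp_bounded[OF K(1)] by (auto simp: bounded_iff)
    have [measurable]: "K \<in> sets borel" using K(1) by (simp add: borel_compact)
    have "integrable lborel (\<lambda>x. (indicator K x :: complex) * T x)"
      by (rule T_int[where B = 1 and s = s]) (use s in \<open>auto simp: indicator_def not_le[symmetric]\<close>)
    then have "integrable lborel (\<lambda>x. indicator K x *\<^sub>R T x)"
      by (simp add: scaleR_conv_of_real of_real_indicator)
    moreover have "integrable lborel (\<lambda>x. indicator K x *\<^sub>R (of_real cauchy_const * (\<eta> x * u x)))"
      by (intro integrable_mult_indicator integrable_mult_right int_\<eta>u) auto
    ultimately show "integrable lborel (\<lambda>x. indicator K x *\<^sub>R (of_real cauchy_const * (\<eta> x * u x) - T x))"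
      by (simp add: scaleR_diff_right)
  next
    fix \<phi> assume \<phi>: "\<phi> \<in> test_functions (UNIV :: (complex^'n) set)"
    note Ck = Ck_function_cauchy_conv[OF \<phi>]
    note \<eta>\<Phi> = test_functions_mult[OF \<eta> Ck, of l]
    note [measurable] = test_functionsD(3)[OF \<phi>]
    have [measurable]: "cauchy_conv l \<phi> \<in> borel_measurable borel"
      using Ck[of 0 l] by (auto intro: borel_measurable_continuous_onI)
    obtain B where B: "\<And>x. norm (\<phi> x) \<le> B" using test_functions_boundedE[OF \<phi>] by metis
    obtain s where s: "\<And>x. norm x > s \<Longrightarrow> \<phi> x = 0" using test_functions_support_cballE[OF \<phi>] by metis
    have 1: "integrable lborel (\<lambda>x. (\<eta> x * cauchy_conv l \<phi> x) * P x)"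
      by (rule integrable_test_function_mult[OF \<eta>\<Phi>]) (use int_P in auto)
    have 2: "integrable lborel (\<lambda>x. (dbar_along (axis l) \<eta> x * cauchy_conv l \<phi> x) * u x)"
      by (rule integrable_test_function_mult[OF test_functions_mult[OF d\<eta> Ck]]) (use int_u in auto)
    have 3: "integrable lborel (\<lambda>x. (\<eta> x * \<phi> x) * u x)"
      by (rule integrable_test_function_mult[OF test_functions_mult[OF \<eta> test_functionsD(1)[OF \<phi>]]]) (use int_u in auto)
    have "(LINT x|lborel. u x * dbar_along (axis l) (\<lambda>x. \<eta> x * cauchy_conv l \<phi> x) x) =
        (LINT x|lborel. (dbar_along (axis l) \<eta> x * cauchy_conv l \<phi> x) * u x - of_real cauchy_const * ((\<eta> x * \<phi> x) * u x))"
      unfolding dbar_along_mult[OF test_functionsD(1)[OF \<eta>] Ck] dbar_along_cauchy_conv[OF \<phi>]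
      by (rule arg_cong[where f = "integral\<^sup>L lborel"]) (auto simp: algebra_simps)
    also have "\<dots> = (LINT x|lborel. (dbar_along (axis l) \<eta> x * cauchy_conv l \<phi> x) * u x) - of_real cauchy_const * (LINT x|lborel. (\<eta> x * \<phi> x) * u x)"
      by (simp add: Bochner_Integration.integral_diff[OF 2 integrable_mult_right[OF 3]])
    finally have w: "of_real cauchy_const * (LINT x|lborel. (\<eta> x * \<phi> x) * u x) =
        (LINT x|lborel. (dbar_along (axis l) \<eta> x * cauchy_conv l \<phi> x) * u x) + (LINT x|lborel. (\<eta> x * cauchy_conv l \<phi> x) * P x)"
      unfolding weak[OF \<eta>\<Phi>] by (simp add: algebra_simps)
    have "(LINT x|lborel. G x * cauchy_conv l \<phi> x) =
        (LINT x|lborel. (dbar_along (axis l) \<eta> x * cauchy_conv l \<phi> x) * u x + (\<eta> x * cauchy_conv l \<phi> x) * P x)"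
      by (rule arg_cong[where f = "integral\<^sup>L lborel"]) (auto simp: G_def algebra_simps)
    also have "\<dots> = of_real cauchy_const * (LINT x|lborel. (\<eta> x * \<phi> x) * u x)"
      unfolding w by (rule Bochner_Integration.integral_add[OF 2 1])
    finally have eq: "(LINT x|lborel. \<phi> x * T x) = of_real cauchy_const * (LINT x|lborel. (\<eta> x * \<phi> x) * u x)"
      using T_eq[OF \<phi>] by simp
    have "(LINT x|lborel. (of_real cauchy_const * (\<eta> x * u x) - T x) * \<phi> x) =
        (LINT x|lborel. of_real cauchy_const * ((\<eta> x * \<phi> x) * u x) - \<phi> x * T x)"
      by (rule arg_cong[where f = "integral\<^sup>L lborel"]) (auto simp: algebra_simps)
    also have "\<dots> = 0"
      using eq by (simp add: Bochner_Integration.integral_diff[OF integrable_mult_right[OF 3] T_int[OF _ B s]])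
    finally show "(LINT x|lborel. (of_real cauchy_const * (\<eta> x * u x) - T x) * \<phi> x) = 0" .
  qed auto
  then show ?thesis by (simp add: T_def)
qed

text \<open>The form used for estimates: in \<open>ennreal\<close> both sides always make sense, so
  finiteness of the potential can be ignored until the absorption.\<close>

lemma cauchy_representation_le:
  fixes u P \<eta> :: "complex^'n \<Rightarrow> complex"
  assumes "u \<in> borel_measurable borel" "P \<in> borel_measurable borel"
    and "\<And>K. compact K \<Longrightarrow> K \<subseteq> \<Omega> \<Longrightarrow> integrable lborel (\<lambda>x. indicator K x *\<^sub>R u x)"
    and "\<And>K. compact K \<Longrightarrow> K \<subseteq> \<Omega> \<Longrightarrow> integrable lborel (\<lambda>x. indicator K x *\<^sub>R P x)"
    and "\<And>\<phi>. \<phi> \<in> test_functions \<Omega> \<Longrightarrow>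
      (LINT x|lborel. u x * dbar_along (axis l) \<phi> x) = - (LINT x|lborel. P x * \<phi> x)"
    and "\<eta> \<in> test_functions \<Omega>"
  shows "AE x in lborel. ennreal (cauchy_const * norm (\<eta> x) * norm (u x)) \<le>
    (\<integral>\<^sup>+z. ennreal ((norm (\<eta> (x - axis l z)) * norm (P (x - axis l z)) +
      norm (dbar_along (axis l) \<eta> (x - axis l z)) * norm (u (x - axis l z))) * inverse (norm z)) \<partial>lborel)"
  using cauchy_representation[OF assms]
proof (rule eventually_mono)
  fix x
  let ?g = "\<lambda>z. (\<eta> (x - axis l z) * P (x - axis l z) + dbar_along (axis l) \<eta> (x - axis l z) * u (x - axis l z)) * inverse z"
  assume eq: "of_real cauchy_const * (\<eta> x * u x) = (LINT z|lborel. ?g z)"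
  have "ennreal (cauchy_const * norm (\<eta> x) * norm (u x)) = ennreal (norm (LINT z|lborel. ?g z))"
    unfolding eq[symmetric] using cauchy_const_pos by (simp add: norm_mult mult.assoc)
  \<comment> \<open>If \<open>?g\<close> is not integrable, its \<open>LINT\<close> is 0 by
    convention and the bound is trivial.\<close>
  also have "\<dots> \<le> (\<integral>\<^sup>+z. ennreal (norm (?g z)) \<partial>lborel)"
    using integral_norm_bound_ennreal[of lborel ?g] by (cases "integrable lborel ?g") (auto simp: not_integrable_integral_eq)
  also have "\<dots> \<le> (\<integral>\<^sup>+z. ennreal ((norm (\<eta> (x - axis l z)) * norm (P (x - axis l z)) +
      norm (dbar_along (axis l) \<eta> (x - axis l z)) * norm (u (x - axis l z))) * inverse (norm z)) \<partial>lborel)"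
    unfolding norm_mult norm_inverse
    by (intro nn_integral_mono ennreal_leI mult_right_mono norm_triangle_le) (auto simp: norm_mult)
  finally show "ennreal (cauchy_const * norm (\<eta> x) * norm (u x)) \<le>
    (\<integral>\<^sup>+z. ennreal ((norm (\<eta> (x - axis l z)) * norm (P (x - axis l z)) +
      norm (dbar_along (axis l) \<eta> (x - axis l z)) * norm (u (x - axis l z))) * inverse (norm z)) \<partial>lborel)" .
qed

section \<open>Hardy-Littlewood-Sobolev and the absorption argument\<close>

text \<open>The summands are the contributions of the kernel near the singularity, of the integral
  of q^4, and of the kernel tail in \<open>truncated_potential_le\<close>.\<close>

definition hls_const :: real where "hls_const = 4 * pi + 1 + 16 / 3 * pi"

lemma hls_const_pos: "hls_const > 0"
  unfolding hls_const_def by (intro add_pos_pos mult_pos_pos pi_gt_zero) auto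

text \<open>Young's inequality for t^3 and 1/r with exponents 4/3 and 4. Comparing
  \<open>t * r\<close> with \<open>k\<close> gives it with both constants equal to 1.\<close>

lemma young_4_3:
  fixes t r k :: real
  assumes "t \<ge> 0" "r > 0" "k > 0"
  shows "t ^ 3 / r \<le> t ^ 4 / k + k ^ 3 / r ^ 4"
proof (cases "t * r \<ge> k")
  case True
  then have "t > 0" using assms by (metis less_eq_real_def mult_zero_left not_less)
  then have "t ^ 3 / r = t ^ 4 / (t * r)"
    by (simp add: eval_nat_numeral)
  also have "\<dots> \<le> t ^ 4 / k"
    using True assms by (intro divide_left_mono) auto
  finally show ?thesis using assms by (simp add: add_increasing2)
next
  case False
  have "t ^ 3 / r = (t * r) ^ 3 / r ^ 4"
    using assms by (simp add: eval_nat_numeral)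
  also have "\<dots> \<le> k ^ 3 / r ^ 4"
    using False assms by (intro divide_right_mono power_mono) auto
  finally show ?thesis using assms by (simp add: add_increasing)
qed

text \<open>The double integral is split according to whether \<open>q y \<le> q x\<close>, so that this pointwise bound of the
  truncated potential suffices. The density is written as \<open>q\<^sup>3\<close> to avoid fractional powers.\<close>

lemma truncated_potential_le:
  fixes q :: "complex \<Rightarrow> real"
  assumes [measurable]: "q \<in> borel_measurable borel" and q: "\<And>x. q x \<ge> 0"
    and \<Gamma>: "\<Gamma> > 0" "(\<integral>\<^sup>+x. ennreal (q x ^ 4) \<partial>lborel) \<le> ennreal (\<Gamma>\<^sup>2)" and s: "s > 0"
  shows "(\<integral>\<^sup>+y. ennreal (if q y \<le> s then q y ^ 3 / norm (x - y) else 0) \<partial>lborel) \<le> ennreal (hls_const * s * \<Gamma>)"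
proof -
  \<comment> \<open>This radius, together with the parameter \<open>\<Gamma> / s\<close> in Young's
    inequality, makes all three contributions proportional to \<open>s * \<Gamma>\<close>.\<close>
  define \<rho> where "\<rho> = \<Gamma> / s\<^sup>2"
  have \<rho>: "\<rho> > 0" using \<Gamma> s by (simp add: \<rho>_def)
  have [measurable]: "ball (0::complex) \<rho> \<in> sets borel" by auto
  have pt: "ennreal (if q y \<le> s then q y ^ 3 / norm (x - y) else 0) \<le>
      ennreal (s ^ 3) * (ennreal (inverse (norm (- x + y))) * indicator (ball 0 \<rho>) (- x + y)) +
      (ennreal (s / \<Gamma>) * ennreal (q y ^ 4) +
       ennreal ((\<Gamma> / s) ^ 3) * (ennreal (inverse (norm (- x + y) ^ 4)) * indicator (- ball 0 \<rho>) (- x + y)))" for y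
  proof (cases "q y \<le> s \<and> x \<noteq> y")
    case True
    have n: "norm (- x + y) = norm (x - y)" by (metis add.commute diff_conv_add_uminus norm_minus_commute)
    have r: "norm (x - y) > 0" using True by simp
    show ?thesis
    proof (cases "norm (x - y) < \<rho>")
      case small: True
      have "q y ^ 3 / norm (x - y) \<le> s ^ 3 * inverse (norm (x - y))"
        unfolding divide_inverse using True q by (intro mult_right_mono power_mono) auto
      then have "ennreal (q y ^ 3 / norm (x - y)) \<le> ennreal (s ^ 3) * ennreal (inverse (norm (x - y)))"
        using s by (simp add: ennreal_mult[symmetric] ennreal_leI)
      then show ?thesis
        using True small n by (simp add: add_increasing2)
    next
      case large: False
      have "q y ^ 3 / norm (x - y) \<le> q y ^ 4 / (\<Gamma> / s) + (\<Gamma> / s) ^ 3 / norm (x - y) ^ 4"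
        using q r \<Gamma>(1) s by (intro young_4_3) auto
      then have "ennreal (q y ^ 3 / norm (x - y)) \<le> ennreal (s / \<Gamma> * q y ^ 4 + (\<Gamma> / s) ^ 3 * inverse (norm (x - y) ^ 4))"
        by (intro ennreal_leI) (simp add: divide_inverse mult.commute)
      also have "\<dots> = ennreal (s / \<Gamma>) * ennreal (q y ^ 4) + ennreal ((\<Gamma> / s) ^ 3) * ennreal (inverse (norm (x - y) ^ 4))"
        using s \<Gamma>(1) q by (simp add: ennreal_plus[symmetric] ennreal_mult[symmetric] del: ennreal_plus power_divide)
      finally show ?thesis
        using True large n by (simp add: add_increasing del: power_divide)
    qed
  qed auto
  have 1: "(\<integral>\<^sup>+y. ennreal (inverse (norm (- x + y))) * indicator (ball 0 \<rho>) (- x + y) \<partial>lborel) \<le> ennreal (4 * pi * \<rho>)"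
    using nn_integral_translation[of "\<lambda>y. ennreal (inverse (norm y)) * indicator (ball 0 \<rho>) y" "- x"]
      nn_integral_inverse_norm_ball_le[OF \<rho>] by simp
  have 2: "(\<integral>\<^sup>+y. ennreal (inverse (norm (- x + y) ^ 4)) * indicator (- ball 0 \<rho>) (- x + y) \<partial>lborel) \<le> ennreal (16 / 3 * pi / \<rho>\<^sup>2)"
    using nn_integral_translation[of "\<lambda>y. ennreal (inverse (norm y ^ 4)) * indicator (- ball 0 \<rho>) y" "- x"]
      nn_integral_inverse_norm4_le[OF \<rho>] by simp
  have "(\<integral>\<^sup>+y. ennreal (if q y \<le> s then q y ^ 3 / norm (x - y) else 0) \<partial>lborel) \<le>
      (\<integral>\<^sup>+y. ennreal (s ^ 3) * (ennreal (inverse (norm (- x + y))) * indicator (ball 0 \<rho>) (- x + y)) +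
      (ennreal (s / \<Gamma>) * ennreal (q y ^ 4) +
       ennreal ((\<Gamma> / s) ^ 3) * (ennreal (inverse (norm (- x + y) ^ 4)) * indicator (- ball 0 \<rho>) (- x + y))) \<partial>lborel)"
    by (intro nn_integral_mono pt)
  also have "\<dots> = ennreal (s ^ 3) * (\<integral>\<^sup>+y. ennreal (inverse (norm (- x + y))) * indicator (ball 0 \<rho>) (- x + y) \<partial>lborel) +
      (ennreal (s / \<Gamma>) * (\<integral>\<^sup>+y. ennreal (q y ^ 4) \<partial>lborel) +
       ennreal ((\<Gamma> / s) ^ 3) * (\<integral>\<^sup>+y. ennreal (inverse (norm (- x + y) ^ 4)) * indicator (- ball 0 \<rho>) (- x + y) \<partial>lborel))"
    by (subst nn_integral_add, measurable, subst nn_integral_add, measurable)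
      (subst nn_integral_cmult, measurable, subst nn_integral_cmult, measurable, subst nn_integral_cmult, measurable)
  also have "\<dots> \<le> ennreal (s ^ 3) * ennreal (4 * pi * \<rho>) + (ennreal (s / \<Gamma>) * ennreal (\<Gamma>\<^sup>2) + ennreal ((\<Gamma> / s) ^ 3) * ennreal (16 / 3 * pi / \<rho>\<^sup>2))"
    by (intro add_mono mult_left_mono 1 2 \<Gamma>) auto
  also have "\<dots> = ennreal (s ^ 3 * (4 * pi * \<rho>) + (s / \<Gamma> * \<Gamma>\<^sup>2 + (\<Gamma> / s) ^ 3 * (16 / 3 * pi / \<rho>\<^sup>2)))"
    using s \<Gamma>(1) \<rho> by (simp add: ennreal_mult[symmetric] ennreal_plus[symmetric] del: ennreal_plus power_divide)
  also have "s ^ 3 * (4 * pi * \<rho>) + (s / \<Gamma> * \<Gamma>\<^sup>2 + (\<Gamma> / s) ^ 3 * (16 / 3 * pi / \<rho>\<^sup>2)) = hls_const * s * \<Gamma>"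
    using s \<Gamma>(1) by (simp add: hls_const_def \<rho>_def field_simps eval_nat_numeral)
  finally show ?thesis .
qed

text \<open>Hardy-Littlewood-Sobolev for the kernel 1/|x - y| in the plane with both densities q^3
  in L^(4/3): the norm of q^3 there is at most \<Gamma>^(3/2), whence \<Gamma>^3. On the half
  \<open>q y \<le> q x\<close> the truncated potential with \<open>s = q x\<close> leaves the
  integral of q^4; the other half follows by symmetry and produces the factor 2.\<close>

lemma hls_diagonal:
  fixes q :: "complex \<Rightarrow> real"
  assumes [measurable]: "q \<in> borel_measurable borel" and q: "\<And>x. q x \<ge> 0"
    and \<Gamma>: "\<Gamma> > 0" "(\<integral>\<^sup>+x. ennreal (q x ^ 4) \<partial>lborel) \<le> ennreal (\<Gamma>\<^sup>2)"
  shows "(\<integral>\<^sup>+x. \<integral>\<^sup>+y. ennreal (q x ^ 3 * (q y ^ 3 / norm (x - y))) \<partial>lborel \<partial>lborel) \<le> ennreal (2 * hls_const * \<Gamma> ^ 3)"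
proof -
  define F where "F x y = ennreal (q x ^ 3) * ennreal (if q y \<le> q x then q y ^ 3 / norm (x - y) else 0)" for x y
  have [measurable]: "case_prod F \<in> borel_measurable (borel \<Otimes>\<^sub>M borel)"
    unfolding F_def by measurable
  have le: "ennreal (q x ^ 3 * (q y ^ 3 / norm (x - y))) \<le> F x y + F y x" for x y
  proof (cases "q y \<le> q x")
    case True
    then show ?thesis
      using q by (simp add: F_def ennreal_mult[symmetric] add_increasing2)
  next
    case False
    then have "ennreal (q x ^ 3 * (q y ^ 3 / norm (x - y))) = F y x"
      using q by (simp add: F_def ennreal_mult[symmetric] norm_minus_commute ac_simps)
    then show ?thesis by (simp add: add_increasing)
  qed
  have F: "(\<integral>\<^sup>+x. \<integral>\<^sup>+y. F x y \<partial>lborel \<partial>lborel) \<le> ennreal (hls_const * \<Gamma> ^ 3)"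
  proof -
    have "(\<integral>\<^sup>+y. F x y \<partial>lborel) \<le> ennreal (hls_const * \<Gamma>) * ennreal (q x ^ 4)" for x
    proof (cases "q x = 0")
      case False
      then have "q x > 0" using q[of x] by simp
      have "(\<integral>\<^sup>+y. F x y \<partial>lborel) = ennreal (q x ^ 3) * (\<integral>\<^sup>+y. ennreal (if q y \<le> q x then q y ^ 3 / norm (x - y) else 0) \<partial>lborel)"
        unfolding F_def by (rule nn_integral_cmult) measurable
      also have "\<dots> \<le> ennreal (q x ^ 3) * ennreal (hls_const * q x * \<Gamma>)"
        by (intro mult_left_mono truncated_potential_le assms \<open>q x > 0\<close>) auto
      also have "\<dots> = ennreal (hls_const * \<Gamma>) * ennreal (q x ^ 4)"
        using q[of x] hls_const_pos \<Gamma>(1) by (simp add: ennreal_mult[symmetric] eval_nat_numeral ac_simps)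
      finally show ?thesis .
    qed (simp add: F_def)
    then have "(\<integral>\<^sup>+x. \<integral>\<^sup>+y. F x y \<partial>lborel \<partial>lborel) \<le> (\<integral>\<^sup>+x. ennreal (hls_const * \<Gamma>) * ennreal (q x ^ 4) \<partial>lborel)"
      by (rule nn_integral_mono)
    also have "\<dots> = ennreal (hls_const * \<Gamma>) * (\<integral>\<^sup>+x. ennreal (q x ^ 4) \<partial>lborel)"
      by (rule nn_integral_cmult) measurable
    also have "\<dots> \<le> ennreal (hls_const * \<Gamma>) * ennreal (\<Gamma>\<^sup>2)"
      by (intro mult_left_mono \<Gamma>) auto
    also have "\<dots> = ennreal (hls_const * \<Gamma> ^ 3)"
      using hls_const_pos \<Gamma>(1) by (simp add: ennreal_mult[symmetric] eval_nat_numeral ac_simps)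
    finally show ?thesis .
  qed
  have "(\<integral>\<^sup>+x. \<integral>\<^sup>+y. ennreal (q x ^ 3 * (q y ^ 3 / norm (x - y))) \<partial>lborel \<partial>lborel) \<le>
      (\<integral>\<^sup>+x. \<integral>\<^sup>+y. (F x y + F y x) \<partial>lborel \<partial>lborel)"
    by (intro nn_integral_mono le)
  also have "\<dots> = (\<integral>\<^sup>+x. \<integral>\<^sup>+y. F x y \<partial>lborel \<partial>lborel) + (\<integral>\<^sup>+x. \<integral>\<^sup>+y. F y x \<partial>lborel \<partial>lborel)"
    by (subst nn_integral_add, measurable, subst nn_integral_add, measurable)
  also have "(\<integral>\<^sup>+x. \<integral>\<^sup>+y. F y x \<partial>lborel \<partial>lborel) = (\<integral>\<^sup>+x. \<integral>\<^sup>+y. F x y \<partial>lborel \<partial>lborel)"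
    by (rule lborel_pair.Fubini') measurable
  also have "(\<integral>\<^sup>+x. \<integral>\<^sup>+y. F x y \<partial>lborel \<partial>lborel) + (\<integral>\<^sup>+x. \<integral>\<^sup>+y. F x y \<partial>lborel \<partial>lborel) \<le>
      ennreal (hls_const * \<Gamma> ^ 3) + ennreal (hls_const * \<Gamma> ^ 3)"
    by (intro add_mono F)
  also have "\<dots> = ennreal (2 * hls_const * \<Gamma> ^ 3)"
    using hls_const_pos \<Gamma>(1) by (simp add: ennreal_plus[symmetric] del: ennreal_plus)
  finally show ?thesis .
qed

text \<open>From Y^2 <= a X Y follows Y^(4/3) <= (a X Y)^(2/3), and Young's inequality with
  exponents 3/2 and 3 separates X Y from a^2. This pointwise version with a free parameter \<delta>
  replaces Hoelder's inequality; comparing the cube root of Y with \<delta> X proves it.\<close>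

lemma fourth_power_cube_root_le:
  fixes X Y a \<delta> :: real
  assumes "X \<ge> 0" "Y \<ge> 0" "Y \<le> a * X" "a \<ge> 0" "\<delta> > 0"
  shows "root 3 Y ^ 4 \<le> \<delta> * (X * Y) + a\<^sup>2 / \<delta>\<^sup>2"
proof -
  define y where "y = root 3 Y"
  have y: "y \<ge> 0" "Y = y ^ 3" using assms by (auto simp: y_def odd_real_root_pow)
  show ?thesis
    unfolding y_def[symmetric] unfolding y(2)
  proof (cases "y \<le> \<delta> * X")
    case True
    then have "y * y ^ 3 \<le> (\<delta> * X) * y ^ 3"
      using y(1) by (intro mult_right_mono) auto
    then have "y ^ 4 \<le> \<delta> * (X * y ^ 3)" by (simp add: eval_nat_numeral mult.assoc)
    then show "y ^ 4 \<le> \<delta> * (X * y ^ 3) + a\<^sup>2 / \<delta>\<^sup>2" by (simp add: add_increasing2)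
  next
    case False
    then have "y > 0" using assms by (meson less_le_trans mult_nonneg_nonneg not_le less_imp_le order_le_less_trans)
    have "X \<le> y / \<delta>" using False assms(5) by (simp add: field_simps)
    then have "y ^ 3 \<le> a * (y / \<delta>)"
      using assms(3,4) y(2) mult_left_mono order_trans by blast
    then have "y * y\<^sup>2 \<le> y * (a / \<delta>)" by (simp add: eval_nat_numeral mult.commute)
    then have "y\<^sup>2 \<le> a / \<delta>" by (simp only: mult_le_cancel_left_pos[OF \<open>y > 0\<close>])
    then have "(y\<^sup>2)\<^sup>2 \<le> (a / \<delta>)\<^sup>2" by (intro power_mono) auto
    then have "y ^ 4 \<le> a\<^sup>2 / \<delta>\<^sup>2" by (simp add: power_divide flip: power_mult)
    moreover have "0 \<le> \<delta> * (X * y ^ 3)" using assms y(1) by simp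
    ultimately show "y ^ 4 \<le> \<delta> * (X * y ^ 3) + a\<^sup>2 / \<delta>\<^sup>2" by linarith
  qed
qed

text \<open>The choice \<open>\<delta> = \<beta> / p\<close>, where \<open>p\<^sup>3\<close> is the integral to be bounded, balances the two terms of the
  previous lemma, so that the resulting inequality for \<open>p\<^sup>2\<close> is linear.\<close>

lemma carleman_absorption:
  fixes X Y H a :: "complex \<Rightarrow> real"
  assumes [measurable]: "X \<in> borel_measurable borel" "Y \<in> borel_measurable borel"
      "H \<in> borel_measurable borel" "a \<in> borel_measurable borel"
    and nonneg: "\<And>z. X z \<ge> 0" "\<And>z. Y z \<ge> 0" "\<And>z. H z \<ge> 0" "\<And>z. a z \<ge> 0"
    and disj: "\<And>z. Y z = 0 \<or> H z = 0"
    and YaX: "AE z in lborel. Y z \<le> a z * X z"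
    and C: "C > 0"
    and pot: "AE x in lborel. Y x \<noteq> 0 \<longrightarrow>
      ennreal (X x) \<le> ennreal C * (\<integral>\<^sup>+y. ennreal ((Y y + H y) / norm (x - y)) \<partial>lborel)"
    and K: "K = 2 * hls_const * C"
    and small: "(\<integral>\<^sup>+z. ennreal ((a z)\<^sup>2) \<partial>lborel) \<le> ennreal (1 / (64 * K\<^sup>2))"
    and N: "N \<ge> 0" "(\<integral>\<^sup>+z. ennreal (root 3 (H z) ^ 4) \<partial>lborel) \<le> ennreal N"
    and P: "P \<ge> 0" "(\<integral>\<^sup>+z. ennreal (X z * Y z) \<partial>lborel) = ennreal P"
  shows "P\<^sup>2 \<le> 8 * K\<^sup>2 * N ^ 3"
proof (cases "P = 0")
  case True
  then show ?thesis using N(1) by simp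
next
  case False
  have Kpos: "K > 0" using K C hls_const_pos by simp
  define p where "p = root 3 P"
  define k where "k = root 3 K"
  have p: "p > 0" "p ^ 3 = P" using False P(1) by (auto simp: p_def odd_real_root_pow)
  have k: "k > 0" "k ^ 3 = K" using Kpos by (auto simp: k_def odd_real_root_pow)
  \<comment> \<open>Chosen so that \<beta>^3 is the smallness threshold 1/(64 K^2) and 2 \<beta> k^2
    = 1/2, the share that can be absorbed.\<close>
  define \<beta> where "\<beta> = 1 / (4 * k\<^sup>2)"
  have \<beta>: "\<beta> > 0" "1 / (64 * K\<^sup>2) = \<beta> ^ 3"
    using k(1) by (auto simp: \<beta>_def k(2)[symmetric] power_divide power_mult_distrib simp flip: power_mult)
  define \<delta> where "\<delta> = \<beta> / p"
  have \<delta>: "\<delta> > 0" using \<beta> p by (simp add: \<delta>_def)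
  define q where "q z = root 3 (Y z + H z)" for z
  have [measurable]: "q \<in> borel_measurable borel" unfolding q_def by measurable
  have q: "q z \<ge> 0" "q z ^ 3 = Y z + H z" for z
    using nonneg[of z] by (auto simp: q_def odd_real_root_pow)
  \<comment> \<open>With \<open>\<delta> = \<beta> / p\<close> the terms \<delta> P and
    \<beta>^3/\<delta>^2 both equal \<beta> p^2, and \<open>N\<close> bounds the rest; thus
    \<Gamma>^2 bounds the integral of q^4.\<close>
  define \<Gamma> where "\<Gamma> = sqrt (2 * \<beta> * p\<^sup>2 + N)"
  have \<Gamma>_arg: "2 * \<beta> * p\<^sup>2 + N > 0" using \<beta> p N(1) by (simp add: add_pos_nonneg)
  then have \<Gamma>: "\<Gamma> > 0" "\<Gamma>\<^sup>2 = 2 * \<beta> * p\<^sup>2 + N" by (auto simp: \<Gamma>_def)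
  have "(\<integral>\<^sup>+z. ennreal (q z ^ 4) \<partial>lborel) \<le>
      (\<integral>\<^sup>+z. ennreal \<delta> * ennreal (X z * Y z) + (ennreal (1 / \<delta>\<^sup>2) * ennreal ((a z)\<^sup>2) + ennreal (root 3 (H z) ^ 4)) \<partial>lborel)"
  proof (rule nn_integral_mono_AE, use YaX in \<open>rule eventually_mono\<close>)
    fix z assume z: "Y z \<le> a z * X z"
    have "root 3 (Y z) ^ 4 \<le> \<delta> * (X z * Y z) + (a z)\<^sup>2 / \<delta>\<^sup>2"
      by (rule fourth_power_cube_root_le[OF nonneg(1,2) z nonneg(4) \<delta>])
    \<comment> \<open>At each point \<open>Y\<close> or \<open>H\<close> vanishes, so the cube root
      of their sum splits.\<close>
    then have "q z ^ 4 \<le> \<delta> * (X z * Y z) + (1 / \<delta>\<^sup>2 * (a z)\<^sup>2 + root 3 (H z) ^ 4)"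
      using disj[of z] nonneg[of z] \<delta> by (auto simp: q_def)
    then have "ennreal (q z ^ 4) \<le> ennreal (\<delta> * (X z * Y z) + (1 / \<delta>\<^sup>2 * (a z)\<^sup>2 + root 3 (H z) ^ 4))"
      by (rule ennreal_leI)
    also have "\<dots> = ennreal \<delta> * ennreal (X z * Y z) + (ennreal (1 / \<delta>\<^sup>2) * ennreal ((a z)\<^sup>2) + ennreal (root 3 (H z) ^ 4))"
      using \<delta> nonneg[of z] by (simp add: ennreal_mult[symmetric] ennreal_plus[symmetric] del: ennreal_plus)
    finally show "ennreal (q z ^ 4) \<le> \<dots>" .
  qed
  also have "\<dots> = ennreal \<delta> * (\<integral>\<^sup>+z. ennreal (X z * Y z) \<partial>lborel) +
      (ennreal (1 / \<delta>\<^sup>2) * (\<integral>\<^sup>+z. ennreal ((a z)\<^sup>2) \<partial>lborel) + (\<integral>\<^sup>+z. ennreal (root 3 (H z) ^ 4) \<partial>lborel))"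
    by (subst nn_integral_add, measurable, subst nn_integral_add, measurable)
      (subst nn_integral_cmult, measurable, subst nn_integral_cmult, measurable)
  also have "\<dots> \<le> ennreal \<delta> * ennreal P + (ennreal (1 / \<delta>\<^sup>2) * ennreal (\<beta> ^ 3) + ennreal N)"
    using small N(2) unfolding P(2) \<beta>(2) by (intro add_mono mult_left_mono) auto
  also have "\<dots> = ennreal (\<delta> * P + (1 / \<delta>\<^sup>2 * \<beta> ^ 3 + N))"
    using \<delta> P(1) \<beta>(1) N(1) by (simp add: ennreal_mult[symmetric] ennreal_plus[symmetric] del: ennreal_plus)
  also have "\<delta> * P + (1 / \<delta>\<^sup>2 * \<beta> ^ 3 + N) = \<Gamma>\<^sup>2"
    using \<beta>(1) p(1) unfolding \<Gamma>(2) p(2)[symmetric] \<delta>_def by (simp add: field_simps eval_nat_numeral)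
  finally have q4: "(\<integral>\<^sup>+z. ennreal (q z ^ 4) \<partial>lborel) \<le> ennreal (\<Gamma>\<^sup>2)" .
  have "ennreal P \<le> (\<integral>\<^sup>+x. ennreal C * (\<integral>\<^sup>+y. ennreal (q x ^ 3 * (q y ^ 3 / norm (x - y))) \<partial>lborel) \<partial>lborel)"
    unfolding P(2)[symmetric]
  proof (rule nn_integral_mono_AE, use pot in \<open>rule eventually_mono\<close>)
    fix x assume x: "Y x \<noteq> 0 \<longrightarrow> ennreal (X x) \<le> ennreal C * (\<integral>\<^sup>+y. ennreal ((Y y + H y) / norm (x - y)) \<partial>lborel)"
    show "ennreal (X x * Y x) \<le> ennreal C * (\<integral>\<^sup>+y. ennreal (q x ^ 3 * (q y ^ 3 / norm (x - y))) \<partial>lborel)"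
    proof (cases "Y x = 0")
      case False
      have "ennreal (X x * Y x) = ennreal (q x ^ 3) * ennreal (X x)"
        using disj[of x] False nonneg[of x] by (simp add: q(2) ennreal_mult[symmetric] mult.commute)
      also have "\<dots> \<le> ennreal (q x ^ 3) * (ennreal C * (\<integral>\<^sup>+y. ennreal ((Y y + H y) / norm (x - y)) \<partial>lborel))"
        using x False by (intro mult_left_mono) auto
      also have "\<dots> = ennreal C * (ennreal (q x ^ 3) * (\<integral>\<^sup>+y. ennreal (q y ^ 3 / norm (x - y)) \<partial>lborel))"
        by (simp add: q(2) ac_simps)
      also have "ennreal (q x ^ 3) * (\<integral>\<^sup>+y. ennreal (q y ^ 3 / norm (x - y)) \<partial>lborel) =
          (\<integral>\<^sup>+y. ennreal (q x ^ 3 * (q y ^ 3 / norm (x - y))) \<partial>lborel)"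
        using q(1) by (subst nn_integral_cmult[symmetric]) (auto simp: ennreal_mult[symmetric])
      finally show ?thesis .
    qed simp
  qed
  also have "\<dots> = ennreal C * (\<integral>\<^sup>+x. \<integral>\<^sup>+y. ennreal (q x ^ 3 * (q y ^ 3 / norm (x - y))) \<partial>lborel \<partial>lborel)"
    by (rule nn_integral_cmult) measurable
  also have "\<dots> \<le> ennreal C * ennreal (2 * hls_const * \<Gamma> ^ 3)"
    by (intro mult_left_mono hls_diagonal q \<Gamma>(1) q4) auto
  also have "\<dots> = ennreal (K * \<Gamma> ^ 3)"
    using C hls_const_pos \<Gamma>(1) by (simp add: K ennreal_mult[symmetric] ac_simps)
  finally have "P \<le> K * \<Gamma> ^ 3"
    using Kpos \<Gamma>(1) by (subst (asm) ennreal_le_iff) auto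
  then have "p ^ 3 \<le> (k * \<Gamma>) ^ 3" unfolding p(2)[symmetric] k(2)[symmetric] by (simp add: power_mult_distrib)
  then have "p \<le> k * \<Gamma>" using k(1) \<Gamma>(1) by (subst (asm) power_mono_iff) (use p in auto)
  then have "p\<^sup>2 \<le> (k * \<Gamma>)\<^sup>2" using p(1) by (intro power_mono) auto
  \<comment> \<open>This is the absorption: half of p^2 moves to the left. Cubing p^2 <= 2 k^2 N
    then gives the claim for P^2 = p^6.\<close>
  also have "\<dots> = p\<^sup>2 / 2 + k\<^sup>2 * N"
    using k(1) unfolding power_mult_distrib \<Gamma>(2) by (simp add: \<beta>_def field_simps)
  finally have "p\<^sup>2 \<le> 2 * k\<^sup>2 * N" by simp
  then have "(p\<^sup>2) ^ 3 \<le> (2 * k\<^sup>2 * N) ^ 3" by (intro power_mono) auto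
  then show ?thesis
    unfolding p(2)[symmetric] k(2)[symmetric] by (simp add: power_mult_distrib mult.commute flip: power_mult)
qed

section \<open>Unique continuation in a disc\<close>

lemma le_0_if_geometric_bound:
  fixes c \<theta> t :: real
  assumes "\<And>k. t \<le> c * \<theta> ^ k" "0 \<le> \<theta>" "\<theta> < 1"
  shows "t \<le> 0"
proof -
  have "(\<lambda>k. c * \<theta> ^ k) \<longlonglongrightarrow> c * 0"
    using assms by (intro tendsto_mult tendsto_const LIMSEQ_power_zero) auto
  then show ?thesis
    using assms(1) by (intro LIMSEQ_le_const[of "\<lambda>k. c * \<theta> ^ k"]) auto
qed

text \<open>On a bounded region L^2 controls L^(4/3); this turns the square integrability of the
  data into a bound for the error term \<open>H\<close>.\<close>

lemma root3_pow4_le: "h \<ge> 0 \<Longrightarrow> root 3 h ^ 4 \<le> 1 + h\<^sup>2" for h :: real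
proof -
  assume "h \<ge> 0"
  define t where "t = root 3 h"
  have t: "h = t ^ 3" "t \<ge> 0" using \<open>h \<ge> 0\<close> by (auto simp: t_def odd_real_root_pow)
  have "t ^ 4 \<le> 1 + t ^ 6"
  proof (cases "t \<le> 1")
    case True
    then have "t ^ 4 \<le> 1" using t by (simp add: power_le_one)
    then show ?thesis using t by (simp add: add_increasing2)
  next
    case False
    then have "t ^ 4 \<le> t ^ 6" by (intro power_increasing) auto
    then show ?thesis by simp
  qed
  then show ?thesis unfolding t_def[symmetric] by (simp add: t(1) flip: power_mult)
qed

text \<open>Only weights with exponent \<open>3 * k\<close> are used, whose cube roots are again powers. The integrability
  \<open>U2\<close>, \<open>D2\<close> makes the integral to be absorbed finite.\<close>

lemma unique_continuation_step:
  fixes U D a :: "complex \<Rightarrow> real"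
  assumes meas [measurable]: "U \<in> borel_measurable borel" "D \<in> borel_measurable borel" "a \<in> borel_measurable borel"
    and nonneg: "\<And>z. U z \<ge> 0" "\<And>z. D z \<ge> 0" "\<And>z. a z \<ge> 0"
    and r: "0 < r0" "r0 < r1" "r1 < r2" "r2 < R"
    and DaU: "AE z in lborel. z \<in> ball 0 R \<longrightarrow> D z \<le> a z * U z"
    and U2: "(\<integral>\<^sup>+z. ennreal ((U z)\<^sup>2) * indicator (ball 0 R) z \<partial>lborel) < \<infinity>"
    and D2: "(\<integral>\<^sup>+z. ennreal ((D z)\<^sup>2) * indicator (ball 0 R) z \<partial>lborel) < \<infinity>"
    and zero: "AE z in lborel. z \<in> ball 0 r0 \<longrightarrow> U z = 0"
    and C: "C > 0" and M: "M \<ge> 0" and K: "K = 2 * hls_const * C"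
    and small: "(\<integral>\<^sup>+z. ennreal ((a z)\<^sup>2) * indicator (ball 0 r1 - cball 0 r0) z \<partial>lborel) \<le> ennreal (1 / (64 * K\<^sup>2))"
    and pot: "\<And>m. AE z in lborel. z \<in> ball 0 r1 \<longrightarrow> ennreal (U z * inverse (norm z) ^ m) \<le>
      ennreal C * (\<integral>\<^sup>+y. ennreal (indicator (ball 0 r2) y * (D y + (if norm y < r1 then 0 else M * U y)) *
        inverse (norm y) ^ m / norm (z - y)) \<partial>lborel)"
  shows "AE z in lborel. z \<in> ball 0 r1 \<longrightarrow> U z = 0"
proof -
  have [measurable]: "ball (0::complex) s \<in> sets borel" "cball (0::complex) s \<in> sets borel" for s by auto
  have pos: "0 < r1" "0 < r2" "0 < R" using r by auto
  define h where "h z = D z + M * U z" for z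
  have h: "h z \<ge> 0" for z using nonneg[of z] M by (simp add: h_def)
  have [measurable]: "h \<in> borel_measurable borel" unfolding h_def by measurable
  have finite_h: "(\<integral>\<^sup>+z. ennreal (1 + (h z)\<^sup>2) * indicator (ball 0 R) z \<partial>lborel) < \<infinity>"
  proof -
    have "ennreal (1 + (h z)\<^sup>2) * indicator (ball 0 R) z \<le> indicator (ball 0 R) z + (ennreal 2 * (ennreal ((D z)\<^sup>2) * indicator (ball 0 R) z) +
        ennreal (2 * M\<^sup>2) * (ennreal ((U z)\<^sup>2) * indicator (ball 0 R) z))" for z
    proof (cases "z \<in> ball 0 R")
      case True
      have "(h z)\<^sup>2 \<le> 2 * (D z)\<^sup>2 + 2 * M\<^sup>2 * (U z)\<^sup>2"
        using sum_squares_bound[of "D z" "M * U z"] by (simp add: h_def power2_sum power_mult_distrib)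
      then have "ennreal (1 + (h z)\<^sup>2) \<le> ennreal (1 + (2 * (D z)\<^sup>2 + 2 * M\<^sup>2 * (U z)\<^sup>2))"
        by (intro ennreal_leI) simp
      also have "\<dots> = 1 + (ennreal 2 * ennreal ((D z)\<^sup>2) + ennreal (2 * M\<^sup>2) * ennreal ((U z)\<^sup>2))"
        by (subst ennreal_plus, simp, simp, subst ennreal_plus, simp, simp, subst ennreal_mult, simp, simp, subst ennreal_mult, simp_all)
      finally show ?thesis using True by simp
    qed simp
    then have "(\<integral>\<^sup>+z. ennreal (1 + (h z)\<^sup>2) * indicator (ball 0 R) z \<partial>lborel) \<le>
      (\<integral>\<^sup>+z. indicator (ball 0 R) z + (ennreal 2 * (ennreal ((D z)\<^sup>2) * indicator (ball 0 R) z) +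
        ennreal (2 * M\<^sup>2) * (ennreal ((U z)\<^sup>2) * indicator (ball 0 R) z)) \<partial>lborel)"
      by (rule nn_integral_mono)
    also have "\<dots> = emeasure lborel (ball (0::complex) R) + (ennreal 2 * (\<integral>\<^sup>+z. ennreal ((D z)\<^sup>2) * indicator (ball 0 R) z \<partial>lborel) +
        ennreal (2 * M\<^sup>2) * (\<integral>\<^sup>+z. ennreal ((U z)\<^sup>2) * indicator (ball 0 R) z \<partial>lborel))"
      by (simp add: nn_integral_add nn_integral_cmult)
    also have "\<dots> < \<infinity>"
      using U2 D2 pos by (auto simp: emeasure_ball ennreal_mult_less_top)
    finally show ?thesis .
  qed
  \<comment> \<open>This bound for the error outside \<open>ball 0 r1\<close> does not depend on the
    weight exponent \<open>k\<close>.\<close>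
  define N where "N = enn2real (\<integral>\<^sup>+z. ennreal (1 + (h z)\<^sup>2) * indicator (ball 0 R) z \<partial>lborel)"
  have N: "(\<integral>\<^sup>+z. ennreal (1 + (h z)\<^sup>2) * indicator (ball 0 R) z \<partial>lborel) = ennreal N" "N \<ge> 0"
    using finite_h by (auto simp: N_def less_top)
  \<comment> \<open>The circle of radius \<open>r0\<close> lies neither in the open disc where
    \<open>U\<close> vanishes nor in the annulus where \<open>a\<close> is small; it is a null
    set.\<close>
  have sphere: "AE z::complex in lborel. norm z \<noteq> r0"
  proof -
    have "negligible (sphere (0::complex) r0)" by (simp add: negligible_sphere)
    then have "AE z in lebesgue. z \<notin> sphere (0::complex) r0"
      by (intro AE_not_in) (simp add: negligible_iff_null_sets)
    then show ?thesis by (simp add: AE_completion_iff dist_norm)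
  qed
  \<comment> \<open>\<open>Y\<close> lives inside \<open>ball 0 r1\<close> and \<open>H\<close>
    outside, which is the disjointness demanded by the absorption lemma. \<open>H\<close> uses the
    larger density \<open>h\<close>, including \<open>D\<close> between the two radii.\<close>
  define X Y H where "X k z = indicator (ball 0 r1) z * (U z * inverse (norm z) ^ (3 * k))"
    and "Y k z = indicator (ball 0 r1) z * (D z * inverse (norm z) ^ (3 * k))"
    and "H k z = indicator (ball 0 r2 - ball 0 r1) z * (h z * inverse (norm z) ^ (3 * k))" for k and z :: complex
  define a' where "a' z = indicator (ball 0 r1 - cball 0 r0) z * a z" for z :: complex
  have [measurable]: "X k \<in> borel_measurable borel" "Y k \<in> borel_measurable borel" "H k \<in> borel_measurable borel"
    "a' \<in> borel_measurable borel" for k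
    unfolding X_def Y_def H_def a'_def by measurable
  have XY_eq: "X k z * Y k z = indicator (ball 0 r1) z * (U z * D z * inverse (norm z) ^ (6 * k))" for k z
    by (auto simp: X_def Y_def indicator_def power_add[symmetric] algebra_simps)
  have D0: "AE z in lborel. z \<in> ball 0 r0 \<longrightarrow> D z = 0"
    using zero DaU
  proof eventually_elim
    case (elim z)
    then show ?case using nonneg(2)[of z] r by auto
  qed
  have pot': "AE x in lborel. x \<in> ball 0 r1 \<longrightarrow>
      ennreal (X k x) \<le> ennreal C * (\<integral>\<^sup>+y. ennreal ((Y k y + H k y) / norm (x - y)) \<partial>lborel)" for k
    using pot[of "3 * k"]
  proof eventually_elim
    case (elim x)
    have "Y k y + H k y = indicator (ball 0 r2) y * (D y + (if norm y < r1 then 0 else M * U y)) * inverse (norm y) ^ (3 * k)" for y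
      using r by (auto simp: Y_def H_def h_def indicator_def)
    with elim show ?case by (simp add: X_def)
  qed
  \<comment> \<open>Almost everywhere that \<open>U\<close> is nonzero the weight is at most a power
    of \<open>inverse r0\<close>, so square integrability of \<open>U\<close> and \<open>D\<close>
    suffices.\<close>
  have XY_finite: "(\<integral>\<^sup>+z. ennreal (X k z * Y k z) \<partial>lborel) < \<infinity>" for k
  proof -
    have "(\<integral>\<^sup>+z. ennreal (X k z * Y k z) \<partial>lborel) \<le>
      (\<integral>\<^sup>+z. ennreal (inverse r0 ^ (6 * k)) * (ennreal ((U z)\<^sup>2) * indicator (ball 0 R) z + ennreal ((D z)\<^sup>2) * indicator (ball 0 R) z) \<partial>lborel)"
    proof (rule nn_integral_mono_AE, use zero in \<open>rule eventually_mono\<close>)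
      fix z :: complex assume z: "z \<in> ball 0 r0 \<longrightarrow> U z = 0"
      show "ennreal (X k z * Y k z) \<le> ennreal (inverse r0 ^ (6 * k)) * (ennreal ((U z)\<^sup>2) * indicator (ball 0 R) z + ennreal ((D z)\<^sup>2) * indicator (ball 0 R) z)"
      proof (cases "z \<in> ball 0 r1 \<and> U z \<noteq> 0")
        case True
        with z have n: "r0 \<le> norm z" "z \<in> ball 0 R" using r by auto
        have "U z * D z \<le> (U z)\<^sup>2 + (D z)\<^sup>2"
          using sum_squares_bound[of "U z" "D z"] mult_nonneg_nonneg[OF nonneg(1,2)[of z]] by linarith
        moreover have "inverse (norm z) ^ (6 * k) \<le> inverse r0 ^ (6 * k)"
          using n r by (intro power_mono le_imp_inverse_le) auto
        ultimately have "U z * D z * inverse (norm z) ^ (6 * k) \<le> ((U z)\<^sup>2 + (D z)\<^sup>2) * inverse r0 ^ (6 * k)"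
          using nonneg[of z] by (intro mult_mono) auto
        then have "ennreal (X k z * Y k z) \<le> ennreal (inverse r0 ^ (6 * k) * ((U z)\<^sup>2 + (D z)\<^sup>2))"
          using True unfolding XY_eq by (intro ennreal_leI) (simp add: mult.commute)
        also have "\<dots> = ennreal (inverse r0 ^ (6 * k)) * (ennreal ((U z)\<^sup>2) + ennreal ((D z)\<^sup>2))"
          using r by (simp add: ennreal_mult)
        finally show ?thesis using n by simp
      qed (auto simp: XY_eq)
    qed
    also have "\<dots> = ennreal (inverse r0 ^ (6 * k)) * ((\<integral>\<^sup>+z. ennreal ((U z)\<^sup>2) * indicator (ball 0 R) z \<partial>lborel) +
        (\<integral>\<^sup>+z. ennreal ((D z)\<^sup>2) * indicator (ball 0 R) z \<partial>lborel))"
      by (subst nn_integral_cmult, measurable, subst nn_integral_add, measurable)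
    also have "\<dots> < \<infinity>" using U2 D2 by (auto simp: ennreal_mult_less_top)
    finally show ?thesis .
  qed
  \<comment> \<open>The cube root of the weight is |z|^-k and its fourth power |z|^(-4k), which is
    largest at the inner radius \<open>r1\<close>.\<close>
  have H4: "(\<integral>\<^sup>+z. ennreal (root 3 (H k z) ^ 4) \<partial>lborel) \<le> ennreal (inverse r1 ^ (4 * k) * N)" for k
  proof -
    have "ennreal (root 3 (H k z) ^ 4) \<le> ennreal (inverse r1 ^ (4 * k)) * (ennreal (1 + (h z)\<^sup>2) * indicator (ball 0 R) z)" for z
    proof (cases "z \<in> ball 0 r2 - ball 0 r1")
      case True
      then have n: "r1 \<le> norm z" "z \<in> ball 0 R" using r by auto
      have "root 3 (inverse (norm z) ^ (3 * k)) = inverse (norm z) ^ k"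
        by (simp add: mult.commute[of 3] power_mult real_root_power_cancel)
      then have "root 3 (H k z) = root 3 (h z) * inverse (norm z) ^ k"
        using True by (simp add: H_def real_root_mult)
      then have "root 3 (H k z) ^ 4 = root 3 (h z) ^ 4 * inverse (norm z) ^ (4 * k)"
        by (simp add: power_mult_distrib power_mult[symmetric] mult.commute)
      also have "\<dots> \<le> (1 + (h z)\<^sup>2) * inverse r1 ^ (4 * k)"
        using n pos h by (intro mult_mono root3_pow4_le power_mono le_imp_inverse_le) auto
      finally have "ennreal (root 3 (H k z) ^ 4) \<le> ennreal (inverse r1 ^ (4 * k) * (1 + (h z)\<^sup>2))"
        by (intro ennreal_leI) (simp add: mult.commute)
      then show ?thesis using n pos by (simp add: ennreal_mult)
    qed (simp add: H_def)
    then have "(\<integral>\<^sup>+z. ennreal (root 3 (H k z) ^ 4) \<partial>lborel) \<le>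
        (\<integral>\<^sup>+z. ennreal (inverse r1 ^ (4 * k)) * (ennreal (1 + (h z)\<^sup>2) * indicator (ball 0 R) z) \<partial>lborel)"
      by (rule nn_integral_mono)
    also have "\<dots> = ennreal (inverse r1 ^ (4 * k) * N)"
      using pos N(2) by (subst nn_integral_cmult) (auto simp: N(1) ennreal_mult simp del: ennreal_plus)
    finally show ?thesis .
  qed
  have carleman: "(enn2real (\<integral>\<^sup>+z. ennreal (X k z * Y k z) \<partial>lborel))\<^sup>2 \<le> 8 * K\<^sup>2 * (inverse r1 ^ (4 * k) * N) ^ 3" for k
  proof (rule carleman_absorption[where X = "X k" and Y = "Y k" and H = "H k" and a = a' and C = C])
    show "AE z in lborel. Y k z \<le> a' z * X k z"
      using sphere D0 DaU
    proof eventually_elim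
      case (elim z)
      show ?case
      proof (cases "z \<in> ball 0 r1 \<and> r0 < norm z")
        case True
        then have "D z \<le> a z * U z" using elim r by auto
        then have "D z * inverse (norm z) ^ (3 * k) \<le> a z * U z * inverse (norm z) ^ (3 * k)"
          by (intro mult_right_mono) auto
        with True show ?thesis by (simp add: Y_def X_def a'_def mult.assoc)
      next
        case False
        with elim have "Y k z = 0" by (auto simp: Y_def)
        then show ?thesis using nonneg by (simp add: a'_def X_def)
      qed
    qed
    show "AE x in lborel. Y k x \<noteq> 0 \<longrightarrow>
        ennreal (X k x) \<le> ennreal C * (\<integral>\<^sup>+y. ennreal ((Y k y + H k y) / norm (x - y)) \<partial>lborel)"
      using pot'[of k] by eventually_elim (auto simp: Y_def)
    have "(\<integral>\<^sup>+z. ennreal ((a' z)\<^sup>2) \<partial>lborel) = (\<integral>\<^sup>+z. ennreal ((a z)\<^sup>2) * indicator (ball 0 r1 - cball 0 r0) z \<partial>lborel)"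
      by (intro nn_integral_cong) (auto simp: a'_def indicator_def)
    with small show "(\<integral>\<^sup>+z. ennreal ((a' z)\<^sup>2) \<partial>lborel) \<le> ennreal (1 / (64 * K\<^sup>2))" by simp
    show "(\<integral>\<^sup>+z. ennreal (X k z * Y k z) \<partial>lborel) = ennreal (enn2real (\<integral>\<^sup>+z. ennreal (X k z * Y k z) \<partial>lborel))"
      using XY_finite[of k] by (simp add: less_top)
  qed (use nonneg h N(2) pos C H4 K in \<open>auto simp: X_def Y_def H_def a'_def indicator_def\<close>)
  \<comment> \<open>On \<open>ball 0 \<rho>\<close> the weight of \<open>X k * Y k\<close> is at
    least \<rho>^(-6k), and squaring gives \<rho>^(-12k); the absorbed bound grows only like
    r1^(-12k). Their ratio (\<rho>/r1)^(12k) tends to 0.\<close>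
  have UD0: "AE z in lborel. z \<in> ball 0 \<rho> \<longrightarrow> U z * D z = 0" if \<rho>: "0 < \<rho>" "\<rho> < r1" for \<rho>
  proof -
    define I where "I = (\<integral>\<^sup>+z. ennreal (U z * D z) * indicator (ball 0 \<rho>) z \<partial>lborel)"
    define Q where "Q = enn2real I"
    have IQ: "ennreal (inverse \<rho> ^ (6 * k)) * I \<le> (\<integral>\<^sup>+z. ennreal (X k z * Y k z) \<partial>lborel)" for k
    proof -
      have "ennreal (inverse \<rho> ^ (6 * k)) * I = (\<integral>\<^sup>+z. ennreal (inverse \<rho> ^ (6 * k)) * (ennreal (U z * D z) * indicator (ball 0 \<rho>) z) \<partial>lborel)"
        unfolding I_def by (rule nn_integral_cmult[symmetric]) measurable
      also have "\<dots> \<le> (\<integral>\<^sup>+z. ennreal (X k z * Y k z) \<partial>lborel)"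
      proof (rule nn_integral_mono_AE, use AE_lborel_singleton[of 0] in \<open>rule eventually_mono\<close>)
        fix z :: complex assume "z \<noteq> 0"
        show "ennreal (inverse \<rho> ^ (6 * k)) * (ennreal (U z * D z) * indicator (ball 0 \<rho>) z) \<le> ennreal (X k z * Y k z)"
        proof (cases "z \<in> ball 0 \<rho>")
          case True
          have "inverse \<rho> ^ (6 * k) * (U z * D z) \<le> inverse (norm z) ^ (6 * k) * (U z * D z)"
            using True \<open>z \<noteq> 0\<close> \<rho> nonneg[of z] by (intro mult_right_mono power_mono le_imp_inverse_le) auto
          also have "\<dots> = X k z * Y k z"
            using True \<rho> by (simp add: XY_eq mult.commute)
          finally show ?thesis
            using True \<rho> nonneg[of z] by (simp add: ennreal_mult[symmetric] ennreal_leI)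
        qed simp
      qed
      finally show ?thesis .
    qed
    have "I < \<infinity>" using order_le_less_trans[OF IQ[of 0] XY_finite[of 0]] by simp
    then have I: "I = ennreal Q" "Q \<ge> 0" by (auto simp: Q_def less_top)
    have "Q\<^sup>2 \<le> (8 * K\<^sup>2 * N ^ 3) * ((\<rho> / r1) ^ 12) ^ k" for k
    proof -
      have "ennreal (inverse \<rho> ^ (6 * k) * Q) \<le> (\<integral>\<^sup>+z. ennreal (X k z * Y k z) \<partial>lborel)"
        using IQ[of k] I \<rho> by (simp add: ennreal_mult)
      then have "inverse \<rho> ^ (6 * k) * Q \<le> enn2real (\<integral>\<^sup>+z. ennreal (X k z * Y k z) \<partial>lborel)"
        using enn2real_mono[OF _ XY_finite[of k, unfolded infinity_ennreal_def]] I(2) \<rho> by fastforce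
      then have "(inverse \<rho> ^ (6 * k) * Q)\<^sup>2 \<le> (enn2real (\<integral>\<^sup>+z. ennreal (X k z * Y k z) \<partial>lborel))\<^sup>2"
        using I(2) \<rho> by (intro power_mono) auto
      also have "\<dots> \<le> 8 * K\<^sup>2 * (inverse r1 ^ (4 * k) * N) ^ 3" by (rule carleman)
      finally have "inverse \<rho> ^ (12 * k) * Q\<^sup>2 \<le> (8 * K\<^sup>2 * N ^ 3) * inverse r1 ^ (12 * k)"
        by (simp add: power_mult_distrib power_mult[symmetric] ac_simps)
      then have "\<rho> ^ (12 * k) * (inverse \<rho> ^ (12 * k) * Q\<^sup>2) \<le> \<rho> ^ (12 * k) * ((8 * K\<^sup>2 * N ^ 3) * inverse r1 ^ (12 * k))"
        using \<rho> by (intro mult_left_mono) auto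
      moreover have "\<rho> ^ (12 * k) * (inverse \<rho> ^ (12 * k) * Q\<^sup>2) = Q\<^sup>2"
        using \<rho> by (simp add: mult.assoc[symmetric] power_mult_distrib[symmetric])
      moreover have "\<rho> ^ (12 * k) * ((8 * K\<^sup>2 * N ^ 3) * inverse r1 ^ (12 * k)) = (8 * K\<^sup>2 * N ^ 3) * ((\<rho> / r1) ^ 12) ^ k"
        by (simp add: divide_inverse power_mult_distrib power_mult[symmetric] ac_simps)
      ultimately show ?thesis by simp
    qed
    then have "Q\<^sup>2 \<le> 0"
      by (rule le_0_if_geometric_bound) (use \<rho> pos in \<open>auto simp: power_less_one_iff\<close>)
    then have "I = 0" using I by simp
    then have "AE z in lborel. ennreal (U z * D z) * indicator (ball 0 \<rho>) z = 0"
      unfolding I_def by (subst (asm) nn_integral_0_iff_AE) auto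
    then show ?thesis
    proof eventually_elim
      case (elim z)
      with mult_nonneg_nonneg[OF nonneg(1,2)[of z]] show ?case
        by (auto simp: indicator_def ennreal_eq_0_iff)
    qed
  qed
  \<comment> \<open>Radii increasing to \<open>r1\<close>: countably many discs exhaust the open
    disc, so a single null set remains.\<close>
  define \<rho> where "\<rho> n = r1 * (1 - inverse (real (Suc (Suc n))))" for n
  have \<rho>: "0 < \<rho> n" "\<rho> n < r1" for n
  proof -
    have "0 < inverse (real (Suc (Suc n)))" "inverse (real (Suc (Suc n))) < 1"
      by (auto simp: inverse_less_1_iff)
    then show "0 < \<rho> n" "\<rho> n < r1" using pos(1) by (simp_all add: \<rho>_def del: of_nat_Suc)
  qed
  have "AE z in lborel. \<forall>n. z \<in> ball 0 (\<rho> n) \<longrightarrow> U z * D z = 0"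
    by (rule AE_all_countable[THEN iffD2]) (use UD0[OF \<rho>] in blast)
  then have D_0: "AE z in lborel. z \<in> ball 0 r1 \<longrightarrow> D z = 0"
    using DaU
  proof eventually_elim
    case (elim z)
    show ?case
    proof
      assume z: "z \<in> ball 0 r1"
      have "\<rho> \<longlonglongrightarrow> r1 * (1 - 0)"
        unfolding \<rho>_def[abs_def]
        by (intro tendsto_mult tendsto_diff tendsto_const LIMSEQ_Suc[OF LIMSEQ_inverse_real_of_nat])
      then have "eventually (\<lambda>n. norm z < \<rho> n) sequentially"
        using z by (intro order_tendstoD(1)[of \<rho> r1]) auto
      then obtain n where "norm z < \<rho> n" by (auto simp: eventually_sequentially)
      with elim(1) have "U z * D z = 0" by auto
      moreover have "D z \<le> a z * U z" using elim(2) z r by auto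
      ultimately show "D z = 0" using nonneg(2)[of z] by auto
    qed
  qed
  \<comment> \<open>Second use of the weights: with \<open>D = 0\<close> in the disc only the error
    outside it feeds the potential. A null set common to all \<open>k\<close> is fixed so that the
    limit can be taken at a given point.\<close>
  have "AE z in lborel. \<forall>k. z \<in> ball 0 r1 \<longrightarrow>
      ennreal (X k z) \<le> ennreal C * (\<integral>\<^sup>+y. ennreal ((Y k y + H k y) / norm (z - y)) \<partial>lborel)"
    by (rule AE_all_countable[THEN iffD2]) (use pot' in blast)
  then show ?thesis
    using AE_lborel_singleton[of 0]
  proof eventually_elim
    case (elim x)
    show ?case
    proof
      assume x: "x \<in> ball 0 r1"
      \<comment> \<open>All remaining sources satisfy |y| >= r1, hence lie at distance at least
        \<open>d\<close> from \<open>x\<close>; the kernel is bounded there and the weights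
        contribute the decaying factor (|x|/r1)^(3k).\<close>
      define d where "d = r1 - norm x"
      have d: "d > 0" using x by (simp add: d_def)
      have "U x \<le> (C * N / d) * ((norm x / r1) ^ 3) ^ k" for k
      proof -
        have "(\<integral>\<^sup>+y. ennreal ((Y k y + H k y) / norm (x - y)) \<partial>lborel) \<le>
            (\<integral>\<^sup>+y. ennreal (inverse r1 ^ (3 * k) / d) * (ennreal (1 + (h y)\<^sup>2) * indicator (ball 0 R) y) \<partial>lborel)"
        proof (rule nn_integral_mono_AE, use D_0 in \<open>rule eventually_mono\<close>)
          fix y :: complex assume "y \<in> ball 0 r1 \<longrightarrow> D y = 0"
          then have Y: "Y k y = 0" by (auto simp: Y_def)
          show "ennreal ((Y k y + H k y) / norm (x - y)) \<le> ennreal (inverse r1 ^ (3 * k) / d) * (ennreal (1 + (h y)\<^sup>2) * indicator (ball 0 R) y)"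
          proof (cases "y \<in> ball 0 r2 - ball 0 r1")
            case True
            then have n: "r1 \<le> norm y" "y \<in> ball 0 R" using r by auto
            have "d \<le> norm (x - y)"
              using n norm_triangle_ineq2[of y x] by (simp add: d_def norm_minus_commute)
            moreover have "h y \<le> 1 + (h y)\<^sup>2"
              using sum_squares_bound[of "h y" 1] h[of y] by simp
            ultimately have "(h y * inverse (norm y) ^ (3 * k)) / norm (x - y) \<le> ((1 + (h y)\<^sup>2) * inverse r1 ^ (3 * k)) / d"
              using n pos h d by (intro frac_le mult_mono power_mono le_imp_inverse_le) auto
            then have "ennreal ((Y k y + H k y) / norm (x - y)) \<le> ennreal ((inverse r1 ^ (3 * k) / d) * (1 + (h y)\<^sup>2))"
              using True by (intro ennreal_leI) (simp add: Y H_def mult.commute)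
            then show ?thesis
              using n pos d by (simp add: ennreal_mult[symmetric] ennreal_plus[symmetric] del: ennreal_plus)
          qed (simp add: Y H_def)
        qed
        also have "\<dots> = ennreal (inverse r1 ^ (3 * k) / d) * ennreal N"
          by (subst nn_integral_cmult) (auto simp: N(1) simp del: ennreal_plus)
        finally have "ennreal (X k x) \<le> ennreal C * (ennreal (inverse r1 ^ (3 * k) / d) * ennreal N)"
          using elim(1) x by (meson mult_left_mono order_trans zero_le)
        then have "X k x \<le> C * (inverse r1 ^ (3 * k) / d * N)"
          using C d pos N(2) by (simp add: ennreal_mult[symmetric] del: times_divide_eq_left times_divide_eq_right)
        then have "norm x ^ (3 * k) * (U x * inverse (norm x) ^ (3 * k)) \<le> norm x ^ (3 * k) * (C * (inverse r1 ^ (3 * k) / d * N))"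
          using x by (intro mult_left_mono) (auto simp: X_def)
        moreover have "norm x ^ (3 * k) * (U x * inverse (norm x) ^ (3 * k)) = U x"
          using elim(2) by (simp add: mult.left_commute power_mult_distrib[symmetric])
        moreover have "norm x ^ (3 * k) * (C * (inverse r1 ^ (3 * k) / d * N)) = (C * N / d) * ((norm x / r1) ^ 3) ^ k"
          by (simp add: divide_inverse power_mult_distrib power_mult[symmetric] ac_simps)
        ultimately show ?thesis by (simp only:)
      qed
      then have "U x \<le> 0"
        by (rule le_0_if_geometric_bound) (use x pos in \<open>auto simp: power_less_one_iff\<close>)
      then show "U x = 0" using nonneg(1)[of x] by simp
    qed
  qed
qed

text \<open>The supremum \<open>r0\<close> of the radii on which \<open>U\<close> vanishes is
  attained. If it were below \<open>R\<close>, absolute continuity of the integral of a^2 would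
  supply an annulus thin enough for one more step. The potential bound is assumed for rational radii
  only, so that on a complex line it can be verified outside one null set.\<close>

lemma unique_continuation_disc:
  fixes U D a :: "complex \<Rightarrow> real"
  assumes meas [measurable]: "U \<in> borel_measurable borel" "D \<in> borel_measurable borel" "a \<in> borel_measurable borel"
    and nonneg: "\<And>z. U z \<ge> 0" "\<And>z. D z \<ge> 0" "\<And>z. a z \<ge> 0"
    and r: "0 < \<epsilon>" "\<epsilon> < R"
    and DaU: "AE z in lborel. z \<in> ball 0 R \<longrightarrow> D z \<le> a z * U z"
    and U2: "(\<integral>\<^sup>+z. ennreal ((U z)\<^sup>2) * indicator (ball 0 R) z \<partial>lborel) < \<infinity>"
    and D2: "(\<integral>\<^sup>+z. ennreal ((D z)\<^sup>2) * indicator (ball 0 R) z \<partial>lborel) < \<infinity>"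
    and a2: "(\<integral>\<^sup>+z. ennreal ((a z)\<^sup>2) * indicator (ball 0 R) z \<partial>lborel) < \<infinity>"
    and zero: "AE z in lborel. z \<in> ball 0 \<epsilon> \<longrightarrow> U z = 0"
    and C: "C > 0"
    and pot: "\<And>r1 r2. r1 \<in> \<rat> \<Longrightarrow> r2 \<in> \<rat> \<Longrightarrow> \<epsilon> < r1 \<Longrightarrow> r1 < r2 \<Longrightarrow> r2 < R \<Longrightarrow>
      \<exists>M\<ge>0. \<forall>m. AE z in lborel. z \<in> ball 0 r1 \<longrightarrow> ennreal (U z * inverse (norm z) ^ m) \<le>
      ennreal C * (\<integral>\<^sup>+y. ennreal (indicator (ball 0 r2) y * (D y + (if norm y < r1 then 0 else M * U y)) *
        inverse (norm y) ^ m / norm (z - y)) \<partial>lborel)"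
  shows "AE z in lborel. z \<in> ball 0 R \<longrightarrow> U z = 0"
proof -
  have [measurable]: "ball (0::complex) s \<in> sets borel" "cball (0::complex) s \<in> sets borel" for s by auto
  define S where "S = {s. 0 < s \<and> s \<le> R \<and> (AE z in lborel. z \<in> ball 0 s \<longrightarrow> U z = 0)}"
  have \<epsilon>S: "\<epsilon> \<in> S" using r zero by (simp add: S_def)
  have bdd: "bdd_above S" by (rule bdd_aboveI[of _ R]) (simp add: S_def)
  define r0 where "r0 = Sup S"
  have r0: "\<epsilon> \<le> r0" "r0 \<le> R"
    using \<epsilon>S bdd by (auto simp: r0_def S_def intro!: cSup_upper cSup_least)
  have zero0: "AE z in lborel. z \<in> ball 0 r0 \<longrightarrow> U z = 0"
  proof -
    have "\<exists>s\<in>S. r0 - inverse (real (Suc n)) < s" for n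
      using less_cSup_iff[of S "r0 - inverse (real (Suc n))"] \<epsilon>S bdd by (auto simp: r0_def)
    then obtain s where s: "\<And>n. s n \<in> S" "\<And>n. r0 - inverse (real (Suc n)) < s n" by metis
    have "AE z in lborel. \<forall>n. z \<in> ball 0 (s n) \<longrightarrow> U z = 0"
      by (rule AE_all_countable[THEN iffD2]) (use s(1) in \<open>auto simp: S_def\<close>)
    then show ?thesis
    proof eventually_elim
      case (elim z)
      show ?case
      proof
        assume "z \<in> ball 0 r0"
        then obtain n where "inverse (real (Suc n)) < r0 - norm z"
          using reals_Archimedean[of "r0 - norm z"] by auto
        then have "norm z < s n" using s(2)[of n] by linarith
        with elim show "U z = 0" by auto
      qed
    qed
  qed
  have "r0 = R"
  proof (rule ccontr)
    assume "r0 \<noteq> R"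
    then have r0R: "r0 < R" using r0 by simp
    define K where "K = 2 * hls_const * C"
    have K: "K > 0" using C hls_const_pos by (simp add: K_def)
    \<comment> \<open>Removing the closed disc makes the shrinking annuli have empty intersection,
      so \<open>F n\<close> tends to 0 at every point, including the circle of radius
      \<open>r0\<close>.\<close>
    define F where "F n z = ennreal ((a z)\<^sup>2) * indicator (ball 0 (min R (r0 + inverse (real (Suc n)))) - cball 0 r0) z" for n and z :: complex
    have "(\<lambda>n. \<integral>\<^sup>+z. F n z \<partial>lborel) \<longlonglongrightarrow> (\<integral>\<^sup>+z. 0 \<partial>(lborel :: complex measure))"
    proof (rule nn_integral_dominated_convergence[where w = "\<lambda>z. ennreal ((a z)\<^sup>2) * indicator (ball 0 R) z"])
      show "AE z in lborel. F n z \<le> ennreal ((a z)\<^sup>2) * indicator (ball 0 R) z" for n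
        by (auto simp: F_def indicator_def)
      show "AE z in lborel. (\<lambda>n. F n z) \<longlonglongrightarrow> 0"
      proof (intro always_eventually allI)
        fix z :: complex
        have "eventually (\<lambda>n. F n z = 0) sequentially"
        proof (cases "r0 < norm z")
          case True
          have "eventually (\<lambda>n. inverse (real (Suc n)) < norm z - r0) sequentially"
            using True by (intro order_tendstoD(2)[OF LIMSEQ_inverse_real_of_nat]) simp
          then show ?thesis by eventually_elim (auto simp: F_def indicator_def)
        qed (auto simp: F_def indicator_def)
        then show "(\<lambda>n. F n z) \<longlonglongrightarrow> 0" by (rule tendsto_eventually)
      qed
    qed (use a2 in \<open>auto simp: F_def\<close>)
    then have "eventually (\<lambda>n. (\<integral>\<^sup>+z. F n z \<partial>lborel) < ennreal (1 / (64 * K\<^sup>2))) sequentially"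
      using K by (intro order_tendstoD(2)[where y = 0]) auto
    then obtain n where n: "(\<integral>\<^sup>+z. F n z \<partial>lborel) < ennreal (1 / (64 * K\<^sup>2))"
      by (auto simp: eventually_sequentially)
    have "r0 < min R (r0 + inverse (real (Suc n)))" using r0R by simp
    \<comment> \<open>Both radii are taken rational between \<open>r0\<close> and the outer radius
      of the thin annulus.\<close>
    then obtain r2 where r2: "r2 \<in> \<rat>" "r0 < r2" "r2 < min R (r0 + inverse (real (Suc n)))"
      using Rats_dense_in_real by blast
    obtain r1 where r1: "r1 \<in> \<rat>" "r0 < r1" "r1 < r2"
      using Rats_dense_in_real[OF r2(2)] by blast
    obtain M where M: "M \<ge> 0" and pot': "\<And>m. AE z in lborel. z \<in> ball 0 r1 \<longrightarrow> ennreal (U z * inverse (norm z) ^ m) \<le>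
      ennreal C * (\<integral>\<^sup>+y. ennreal (indicator (ball 0 r2) y * (D y + (if norm y < r1 then 0 else M * U y)) *
        inverse (norm y) ^ m / norm (z - y)) \<partial>lborel)"
      using pot[of r1 r2] r1 r2 r0 by force
    have "(\<integral>\<^sup>+z. ennreal ((a z)\<^sup>2) * indicator (ball 0 r1 - cball 0 r0) z \<partial>lborel) \<le> (\<integral>\<^sup>+z. F n z \<partial>lborel)"
      using r1 r2 by (intro nn_integral_mono) (auto simp: F_def indicator_def)
    then have "(\<integral>\<^sup>+z. ennreal ((a z)\<^sup>2) * indicator (ball 0 r1 - cball 0 r0) z \<partial>lborel) \<le> ennreal (1 / (64 * K\<^sup>2))"
      using n by simp
    then have "AE z in lborel. z \<in> ball 0 r1 \<longrightarrow> U z = 0"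
      using r1 r2 r0 r
      by (intro unique_continuation_step[OF meas nonneg _ r1(2,3) _ DaU U2 D2 zero0 C M K_def _ pot']) auto
    then have "r1 \<in> S" using r1 r2 r0 r by (auto simp: S_def)
    then have "r1 \<le> r0" unfolding r0_def using bdd by (rule cSup_upper)
    with r1 show False by simp
  qed
  with zero0 show ?thesis by simp
qed

section \<open>Cutoffs and restriction to lines\<close>

lemma Ck_function_derivative_real:
  assumes "\<And>k. Ck_function k (S :: real \<Rightarrow> complex)"
  shows "Ck_function k (\<lambda>t. frechet_derivative S (at t) 1)"
  using assms[of "Suc k"] by simp

text \<open>The pole of z^-m is invisible because \<open>S\<close> vanishes near 0. The derivative
  consists of terms of the same shape, one with \<open>Suc m\<close> and \<open>S\<close>, the other
  with \<open>m\<close> and the derivative of \<open>S\<close>; smoothness thus follows by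
  induction.\<close>

lemma polar_cutoff_has_derivative:
  fixes S :: "real \<Rightarrow> complex"
  assumes S: "\<And>k. Ck_function k S" "\<And>t. t < \<delta> \<Longrightarrow> S t = 0" and "\<delta> > 0"
  shows "((\<lambda>z. inverse z ^ m * S ((norm z)\<^sup>2)) has_derivative
    (\<lambda>v. (- of_nat m * v) * (inverse z ^ Suc m * S ((norm z)\<^sup>2)) +
         of_real (2 * (z \<bullet> v)) * (inverse z ^ m * frechet_derivative S (at ((norm z)\<^sup>2)) 1))) (at z)"
proof (cases "(norm z)\<^sup>2 < \<delta>")
  case True
  have "frechet_derivative S (at ((norm z)\<^sup>2)) = (\<lambda>v. 0)"
    using True S(2) by (intro frechet_derivative_outside_support[of "{\<delta>..}"]) (auto simp: not_less[symmetric])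
  moreover have "((\<lambda>z. inverse z ^ m * S ((norm z)\<^sup>2)) has_derivative (\<lambda>v. 0)) (at z)"
  proof (rule has_derivative_transform_within_open[where f = "\<lambda>z. 0"])
    have "continuous_on UNIV (\<lambda>z::complex. (norm z)\<^sup>2)" by (intro continuous_intros)
    from open_vimage[OF _ this, of "{..<\<delta>}"]
    show "open ((\<lambda>z::complex. (norm z)\<^sup>2) -` {..<\<delta>})" by simp
  qed (use True S(2) in auto)
  ultimately show ?thesis using True S(2) by simp
next
  case False
  then have z: "z \<noteq> 0" using assms(3) by auto
  have dS: "(S has_derivative (\<lambda>s. of_real s * frechet_derivative S (at t) 1)) (at t)" for t
  proof -
    have d: "(S has_derivative frechet_derivative S (at t)) (at t)"
      using Ck_function_Suc_has_derivative[OF S(1)[of "Suc 0"]] .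
    have "frechet_derivative S (at t) s = of_real s * frechet_derivative S (at t) 1" for s
      using linear_scale[OF has_derivative_linear[OF d], of s 1] by (simp add: scaleR_conv_of_real)
    then have "frechet_derivative S (at t) = (\<lambda>s. of_real s * frechet_derivative S (at t) 1)" by (intro ext)
    with d show ?thesis by (simp only:)
  qed
  have q: "((\<lambda>z::complex. (norm z)\<^sup>2) has_derivative (\<lambda>v. 2 * (z \<bullet> v))) (at z)"
    unfolding power2_norm_eq_inner by (auto intro!: derivative_eq_intros simp: inner_commute)
  have "((\<lambda>z. inverse z ^ m) has_field_derivative - of_nat m * inverse z ^ Suc m) (at z)"
    using z by (auto intro!: derivative_eq_intros simp: power_Suc2[symmetric] simp del: power_Suc) (cases m; simp add: field_simps)
  then have p: "((\<lambda>z. inverse z ^ m) has_derivative (\<lambda>v. (- of_nat m * inverse z ^ Suc m) * v)) (at z)"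
    by (simp only: has_field_derivative_def)
  show ?thesis
    by (rule has_derivative_eq_rhs[OF has_derivative_mult[OF p has_derivative_compose[OF q dS]]])
      (auto simp: algebra_simps)
qed

lemma Ck_function_polar_cutoff:
  fixes S :: "real \<Rightarrow> complex"
  assumes "\<And>k. Ck_function k S" "\<And>t. t < \<delta> \<Longrightarrow> S t = 0" "\<delta> > 0"
  shows "Ck_function k (\<lambda>z. inverse z ^ m * S ((norm z)\<^sup>2))"
  using assms
proof (induction k arbitrary: m S)
  case 0
  show ?case
    using has_derivative_continuous[OF polar_cutoff_has_derivative[OF 0]]
    by (auto intro!: continuous_at_imp_continuous_on)
next
  case (Suc k)
  note S = Suc.prems
  have S': "frechet_derivative S (at t) 1 = 0" if "t < \<delta>" for t
  proof -
    have "frechet_derivative S (at t) = (\<lambda>v. 0)"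
      using that S(2) by (intro frechet_derivative_outside_support[of "{\<delta>..}"]) (auto simp: not_less[symmetric])
    then show ?thesis by simp
  qed
  have lin: "bounded_linear (\<lambda>z::complex. complex_of_real (2 * (z \<bullet> v)))" for v
    by (intro bounded_linear_compose[OF bounded_linear_of_real] bounded_linear_const_mult
        bounded_linear_inner_left)
  show ?case
  proof (rule Ck_function_SucI[OF polar_cutoff_has_derivative[OF S]])
    fix v
    show "Ck_function k (\<lambda>z. (- of_nat m * v) * (inverse z ^ Suc m * S ((norm z)\<^sup>2)) +
         of_real (2 * (z \<bullet> v)) * (inverse z ^ m * frechet_derivative S (at ((norm z)\<^sup>2)) 1))"
      by (intro Ck_function_add Ck_function_mult[OF Ck_function_const] Ck_function_mult[OF Ck_function_linear[OF lin]]
          Suc.IH[OF S] Suc.IH[OF Ck_function_derivative_real[OF S(1)] S' S(3)])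
  qed
qed

text \<open>Since z^-m is holomorphic off 0, only the cutoff is differentiated. The factor 2 belongs
  to the normalisation of \<open>dbar_along\<close>.\<close>

lemma dbar_polar_cutoff:
  fixes S :: "real \<Rightarrow> complex"
  assumes "\<And>k. Ck_function k S" "\<And>t. t < \<delta> \<Longrightarrow> S t = 0" "\<delta> > 0"
  shows "dbar_along (\<lambda>z. z) (\<lambda>z. inverse z ^ m * S ((norm z)\<^sup>2)) z =
    2 * z * inverse z ^ m * frechet_derivative S (at ((norm z)\<^sup>2)) 1"
proof -
  have *: "frechet_derivative (\<lambda>z. inverse z ^ m * S ((norm z)\<^sup>2)) (at z) =
    (\<lambda>v. (- of_nat m * v) * (inverse z ^ Suc m * S ((norm z)\<^sup>2)) +
         of_real (2 * (z \<bullet> v)) * (inverse z ^ m * frechet_derivative S (at ((norm z)\<^sup>2)) 1))"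
    by (rule frechet_derivative_at[symmetric], rule polar_cutoff_has_derivative) (use assms in auto)
  have "dbar_along (\<lambda>z. z) (\<lambda>z. inverse z ^ m * S ((norm z)\<^sup>2)) z =
    2 * (Re z + \<i> * Im z) * (inverse z ^ m * frechet_derivative S (at ((norm z)\<^sup>2)) 1)"
    unfolding dbar_along_def * by (simp add: inner_complex_def algebra_simps)
  also have "Re z + \<i> * Im z = z" by (rule complex_eq[symmetric])
  finally show ?thesis by (simp add: mult.assoc)
qed

text \<open>The point is that \<open>M\<close> does not depend on \<open>m\<close>.\<close>

lemma polar_cutoff_exists:
  fixes \<epsilon> r1 r2 :: real
  assumes r: "0 < \<epsilon>" "\<epsilon> < r1" "r1 < r2"
  shows "\<exists>M\<ge>0. \<forall>m. \<exists>\<kappa>. (\<forall>k. Ck_function k \<kappa>) \<and> (\<forall>z. r2 \<le> norm z \<longrightarrow> \<kappa> z = 0 \<and> dbar_along (\<lambda>z. z) \<kappa> z = 0) \<and>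
    (\<forall>z. norm (\<kappa> z) \<le> inverse (norm z) ^ m) \<and>
    (\<forall>z. \<epsilon> \<le> norm z \<and> norm z < r1 \<longrightarrow> norm (\<kappa> z) = inverse (norm z) ^ m \<and> dbar_along (\<lambda>z. z) \<kappa> z = 0) \<and>
    (\<forall>z. r1 \<le> norm z \<longrightarrow> norm (dbar_along (\<lambda>z. z) \<kappa> z) \<le> M * inverse (norm z) ^ m)"
proof -
  define r3 where "r3 = (r1 + r2) / 2"
  have r3: "r1 < r3" "r3 < r2" "0 < r3" using r by (auto simp: r3_def)
  \<comment> \<open>In terms of the radius, the first step rises between \<epsilon>/2 and
    3\<epsilon>/4, inside the disc of radius \<epsilon>, and the second falls between
    \<open>r1\<close> and \<open>r3\<close>. As \<open>r3 < r2\<close>, the derivative too vanishes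
    from \<open>r2\<close> on.\<close>
  define S where "S t = smooth_step ((\<epsilon> / 2)\<^sup>2) ((3 * \<epsilon> / 4)\<^sup>2) t * (1 + (- 1) * smooth_step (r1\<^sup>2) (r3\<^sup>2) t)" for t
  have ab: "(\<epsilon> / 2)\<^sup>2 < (3 * \<epsilon> / 4)\<^sup>2" "r1\<^sup>2 < r3\<^sup>2"
    using r r3 by (auto intro!: power_strict_mono)
  note s1 = smooth_step[OF ab(1)] and s2 = smooth_step[OF ab(2)]
  have CS: "Ck_function k S" for k
    unfolding S_def[abs_def]
    by (intro Ck_function_mult Ck_function_add Ck_function_const s1(1) s2(1))
  have S0: "S t = 0" if "t < (\<epsilon> / 2)\<^sup>2" for t
    using s1(2)[of t] that by (simp add: S_def)
  have \<delta>: "(\<epsilon> / 2)\<^sup>2 > 0" using r by simp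
  have S1: "S t = 1" if "(3 * \<epsilon> / 4)\<^sup>2 \<le> t" "t \<le> r1\<^sup>2" for t
    using s1(3)[of t] s2(2)[of t] that by (simp add: S_def)
  have S2: "S t = 0" if "r3\<^sup>2 \<le> t" for t
    using s2(3)[of t] that by (simp add: S_def)
  have Sle: "norm (S t) \<le> 1" for t
    using s1(4)[of t] s2(5)[of t] by (simp add: S_def norm_mult mult_le_one)
  define S' where "S' t = frechet_derivative S (at t) 1" for t
  have "continuous_on {r1\<^sup>2..r2\<^sup>2} S'"
    using Ck_function_derivative_real[OF CS, of 0] unfolding S'_def[abs_def] by (auto intro: continuous_on_subset)
  then have "bounded (S' ` {r1\<^sup>2..r2\<^sup>2})"
    by (intro compact_imp_bounded compact_continuous_image compact_Icc)
  then obtain B where B: "B > 0" "\<And>t. r1\<^sup>2 \<le> t \<Longrightarrow> t \<le> r2\<^sup>2 \<Longrightarrow> norm (S' t) \<le> B"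
    by (auto simp: bounded_pos)
  have S'0: "S' t = 0" if "(3 * \<epsilon> / 4)\<^sup>2 < t" "t < r1\<^sup>2" for t
  proof -
    have "((\<lambda>t. 1) has_derivative (\<lambda>v. 0)) (at t)" by simp
    then have "(S has_derivative (\<lambda>v. 0)) (at t)"
      by (rule has_derivative_transform_within_open[where s = "{(3 * \<epsilon> / 4)\<^sup>2<..<r1\<^sup>2}"]) (use that S1 in auto)
    from frechet_derivative_at[OF this, symmetric] show ?thesis by (simp add: S'_def)
  qed
  have S'2: "S' t = 0" if "r3\<^sup>2 < t" for t
  proof -
    have "frechet_derivative S (at t) = (\<lambda>v. 0)"
      using that S2 by (intro frechet_derivative_outside_support[of "{..r3\<^sup>2}"]) (auto simp: not_less[symmetric])
    then show ?thesis by (simp add: S'_def)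
  qed
  show ?thesis
  \<comment> \<open>The constant combines the factor 2 |z| <= 2 \<open>r2\<close> of the dbar
    derivative with the bound \<open>B\<close> for the derivative of \<open>S\<close>; the power of
    z enters only as the weight.\<close>
  proof (intro exI[of _ "2 * r2 * B"] conjI allI)
    show "0 \<le> 2 * r2 * B" using B(1) r by simp
    fix m
    define \<kappa> where "\<kappa> z = inverse z ^ m * S ((norm z)\<^sup>2)" for z
    have db: "dbar_along (\<lambda>z. z) \<kappa> z = 2 * z * inverse z ^ m * S' ((norm z)\<^sup>2)" for z
      unfolding \<kappa>_def[abs_def] S'_def by (rule dbar_polar_cutoff[OF CS S0 \<delta>])
    show "\<exists>\<kappa>. (\<forall>k. Ck_function k \<kappa>) \<and> (\<forall>z. r2 \<le> norm z \<longrightarrow> \<kappa> z = 0 \<and> dbar_along (\<lambda>z. z) \<kappa> z = 0) \<and>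
      (\<forall>z. norm (\<kappa> z) \<le> inverse (norm z) ^ m) \<and>
      (\<forall>z. \<epsilon> \<le> norm z \<and> norm z < r1 \<longrightarrow> norm (\<kappa> z) = inverse (norm z) ^ m \<and> dbar_along (\<lambda>z. z) \<kappa> z = 0) \<and>
      (\<forall>z. r1 \<le> norm z \<longrightarrow> norm (dbar_along (\<lambda>z. z) \<kappa> z) \<le> 2 * r2 * B * inverse (norm z) ^ m)"
    proof (intro exI[of _ \<kappa>] conjI allI impI)
      show "Ck_function k \<kappa>" for k
        unfolding \<kappa>_def[abs_def] by (rule Ck_function_polar_cutoff[OF CS S0 \<delta>])
      fix z :: complex
      have r3z: "r3\<^sup>2 < (norm z)\<^sup>2" if "r2 \<le> norm z"
        using that r3 by (intro power_strict_mono) auto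
      show "norm (\<kappa> z) \<le> inverse (norm z) ^ m"
        using mult_left_mono[OF Sle[of "(norm z)\<^sup>2"], of "inverse (norm z) ^ m"]
        by (simp add: \<kappa>_def norm_mult norm_power norm_inverse)
      show "\<kappa> z = 0" "dbar_along (\<lambda>z. z) \<kappa> z = 0" if "r2 \<le> norm z"
        using S2[of "(norm z)\<^sup>2"] S'2[of "(norm z)\<^sup>2"] r3z[OF that] unfolding db by (simp_all add: \<kappa>_def)
      show "norm (\<kappa> z) = inverse (norm z) ^ m" "dbar_along (\<lambda>z. z) \<kappa> z = 0"
        if z: "\<epsilon> \<le> norm z \<and> norm z < r1"
      proof -
        have "(3 * \<epsilon> / 4)\<^sup>2 < (norm z)\<^sup>2" "(norm z)\<^sup>2 < r1\<^sup>2"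
          using z r by (auto intro!: power_strict_mono)
        then show "norm (\<kappa> z) = inverse (norm z) ^ m" "dbar_along (\<lambda>z. z) \<kappa> z = 0"
          using S1[of "(norm z)\<^sup>2"] S'0[of "(norm z)\<^sup>2"] unfolding db
          by (simp_all add: \<kappa>_def norm_mult norm_power norm_inverse)
      qed
      show "norm (dbar_along (\<lambda>z. z) \<kappa> z) \<le> 2 * r2 * B * inverse (norm z) ^ m" if z: "r1 \<le> norm z"
      proof (cases "norm z \<le> r2")
        case True
        have "norm (S' ((norm z)\<^sup>2)) \<le> B"
          using z True r by (intro B(2) power_mono) auto
        then have "(2 * norm z) * norm (S' ((norm z)\<^sup>2)) * inverse (norm z) ^ m \<le> (2 * r2) * B * inverse (norm z) ^ m"
          using True B(1) r by (intro mult_right_mono mult_mono) auto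
        then show ?thesis unfolding db by (simp add: norm_mult norm_power norm_inverse ac_simps)
      next
        case False
        then have "S' ((norm z)\<^sup>2) = 0" using S'2 r3z by simp
        then show ?thesis using B(1) r unfolding db by simp
      qed
    qed
  qed
qed

section \<open>Reflections, null sets and finiteness on complex lines\<close>

lemma nn_integral_reflection:
  fixes f :: "complex \<Rightarrow> ennreal"
  assumes [measurable]: "f \<in> borel_measurable borel"
  shows "(\<integral>\<^sup>+x. f (c - x) \<partial>lborel) = (\<integral>\<^sup>+x. f x \<partial>lborel)"
proof -
  have "(\<integral>\<^sup>+x. f x \<partial>lborel) =
      (\<integral>\<^sup>+x. f x \<partial>(density (distr lborel borel (\<lambda>x::complex. c + (- 1) *\<^sub>R x)) (\<lambda>_. ennreal (\<bar>- 1\<bar> ^ DIM(complex)))))"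
    using lborel_affine[of "-1" c] by simp
  then show ?thesis
    by (simp add: nn_integral_density nn_integral_distr)
qed

lemma AE_translation:
  fixes c :: "'a::euclidean_space"
  assumes "AE z in lborel. Q z"
  shows "AE z in lborel. Q (c + z)"
proof -
  obtain N where N: "{x. \<not> Q x} \<subseteq> N" "N \<in> sets borel" "emeasure lborel N = 0"
    using assms by (auto simp: eventually_ae_filter null_sets_def)
  note [measurable] = N(2)
  have "(\<integral>\<^sup>+z. indicator N (c + z) \<partial>lborel) = (\<integral>\<^sup>+z. indicator N z \<partial>lborel)"
    by (rule nn_integral_translation) measurable
  then have "(\<integral>\<^sup>+z. indicator N (c + z) \<partial>lborel) = 0"
    using N by simp
  then have "AE z in lborel. (indicator N (c + z) :: ennreal) = 0"
    by (subst (asm) nn_integral_0_iff_AE) auto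
  then show ?thesis
    by eventually_elim (use N(1) in \<open>auto simp: indicator_def split: if_splits\<close>)
qed

text \<open>Lines are parametrised by all base points \<open>x\<close> of the space, not by a transversal. Fubini then reduces to
  translation invariance and the space need not be split into coordinates.\<close>

lemma nn_integral_lines:
  fixes f :: "complex^'n \<Rightarrow> ennreal" and g :: "complex \<Rightarrow> ennreal"
  assumes [measurable]: "f \<in> borel_measurable borel" "g \<in> borel_measurable borel"
  shows "(\<integral>\<^sup>+x. \<integral>\<^sup>+z. f (x + axis l z) * g z \<partial>lborel \<partial>lborel) = (\<integral>\<^sup>+x. f x \<partial>lborel) * (\<integral>\<^sup>+z. g z \<partial>lborel)"
proof -
  have "(\<integral>\<^sup>+x. \<integral>\<^sup>+z. f (x + axis l z) * g z \<partial>lborel \<partial>lborel) = (\<integral>\<^sup>+z. \<integral>\<^sup>+x. f (axis l z + x) * g z \<partial>lborel \<partial>lborel)"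
    by (subst add.commute, rule lborel_pair.Fubini') measurable
  also have "\<dots> = (\<integral>\<^sup>+z. (\<integral>\<^sup>+x. f x \<partial>lborel) * g z \<partial>lborel)"
    by (subst nn_integral_multc, measurable, subst nn_integral_translation, auto)
  also have "\<dots> = (\<integral>\<^sup>+x. f x \<partial>lborel) * (\<integral>\<^sup>+z. g z \<partial>lborel)"
    by (rule nn_integral_cmult) measurable
  finally show ?thesis .
qed

lemma AE_on_lines:
  fixes Q :: "complex^'n \<Rightarrow> bool"
  assumes "AE x in lborel. Q x"
  shows "AE x in lborel. AE z in lborel. Q (x + axis l z)"
proof -
  obtain N where N: "{x. \<not> Q x} \<subseteq> N" "N \<in> sets borel" "emeasure lborel N = 0"
    using assms by (auto simp: eventually_ae_filter null_sets_def)
  note [measurable] = N(2)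
  have "(\<integral>\<^sup>+x. \<integral>\<^sup>+z. indicator N (x + axis l z) * 1 \<partial>lborel \<partial>lborel) = 0"
    by (subst nn_integral_lines) (use N in auto)
  then have "AE x in lborel. (\<integral>\<^sup>+z. indicator N (x + axis l z) \<partial>lborel) = 0"
    by (subst (asm) nn_integral_0_iff_AE) auto
  then show ?thesis
  proof eventually_elim
    case (elim x)
    then have "AE z in lborel. (indicator N (x + axis l z) :: ennreal) = 0"
      by (subst (asm) nn_integral_0_iff_AE) auto
    then show ?case
      by eventually_elim (use N(1) in \<open>auto simp: indicator_def split: if_splits\<close>)
  qed
qed

text \<open>With constant weight 1 the line integrals give 0 = |N| times the infinite area of the
  plane, which forces |N| = 0.\<close>

lemma AE_from_lines:
  fixes N :: "(complex^'n) set"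
  assumes [measurable]: "N \<in> sets borel"
    and ae: "AE x in lborel. AE z in lborel. x + axis l z \<notin> N"
  shows "AE x in lborel. x \<notin> N"
proof -
  have "AE x in lborel. (\<integral>\<^sup>+z. indicator N (x + axis l z) * 1 \<partial>lborel) = 0"
    using ae
  proof eventually_elim
    case (elim x)
    then have "AE z in lborel. (indicator N (x + axis l z) :: ennreal) * 1 = 0"
      by eventually_elim simp
    then show ?case by (subst nn_integral_0_iff_AE) auto
  qed
  then have "(\<integral>\<^sup>+x. \<integral>\<^sup>+z. indicator N (x + axis l z) * 1 \<partial>lborel \<partial>lborel) = 0"
    by (subst nn_integral_0_iff_AE) auto
  then have "emeasure lborel N * emeasure lborel (UNIV :: complex set) = 0"
    by (subst (asm) nn_integral_lines) auto
  then have "emeasure lborel N = 0" by simp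
  then have "N \<in> null_sets lborel" by auto
  then show ?thesis by (rule AE_not_in)
qed

text \<open>Every disc on the line lies in one of countably many discs of integer radius about 0, so
  one null set of base points serves all centres and radii.\<close>

lemma AE_finite_on_lines:
  fixes f :: "complex^'n \<Rightarrow> ennreal"
  assumes [measurable]: "f \<in> borel_measurable borel" and fin: "(\<integral>\<^sup>+x. f x \<partial>lborel) < \<infinity>"
  shows "AE x in lborel. \<forall>c R. (\<integral>\<^sup>+z. f (x + axis l (c + z)) * indicator (ball 0 R) z \<partial>lborel) < \<infinity>"
proof -
  have [measurable]: "ball (0::complex) s \<in> sets borel" for s by auto
  have "AE x in lborel. \<forall>n. (\<integral>\<^sup>+z. f (x + axis l z) * indicator (ball 0 (real n)) z \<partial>lborel) \<noteq> \<infinity>"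
  proof (rule AE_all_countable[THEN iffD2], intro allI nn_integral_PInf_AE)
    fix n
    have "(\<integral>\<^sup>+x. \<integral>\<^sup>+z. f (x + axis l z) * indicator (ball 0 (real n)) z \<partial>lborel \<partial>lborel) < \<infinity>"
      using fin by (subst nn_integral_lines) (auto simp: emeasure_ball ennreal_mult_less_top)
    then show "(\<integral>\<^sup>+x. \<integral>\<^sup>+z. f (x + axis l z) * indicator (ball 0 (real n)) z \<partial>lborel \<partial>lborel) \<noteq> \<infinity>" by simp
  qed measurable
  then show ?thesis
  proof eventually_elim
    case (elim x)
    show ?case
    proof (intro allI)
      fix c :: complex and R :: real
      obtain n where n: "norm c + R \<le> real n" using real_arch_simple by blast
      have "(\<integral>\<^sup>+z. f (x + axis l (c + z)) * indicator (ball 0 R) z \<partial>lborel) \<le>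
          (\<integral>\<^sup>+z. f (x + axis l (c + z)) * indicator (ball 0 (real n)) (c + z) \<partial>lborel)"
      proof (intro nn_integral_mono)
        fix z :: complex
        have "norm (c + z) < real n" if "norm z < R" using that n norm_triangle_ineq[of c z] by linarith
        then show "f (x + axis l (c + z)) * indicator (ball 0 R) z \<le> f (x + axis l (c + z)) * indicator (ball 0 (real n)) (c + z)"
          by (auto simp: indicator_def)
      qed
      also have "\<dots> = (\<integral>\<^sup>+z. f (x + axis l z) * indicator (ball 0 (real n)) z \<partial>lborel)"
        by (rule nn_integral_translation[of "\<lambda>z. f (x + axis l z) * indicator (ball 0 (real n)) z"]) measurable
      also have "\<dots> < \<infinity>" using elim by (simp add: less_top)
      finally show "(\<integral>\<^sup>+z. f (x + axis l (c + z)) * indicator (ball 0 R) z \<partial>lborel) < \<infinity>" .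
    qed
  qed
qed

section \<open>Propagation in polydiscs\<close>

lemma compact_closed_polydisc: "compact {x :: complex^'n. \<forall>j. norm (x $ j - p $ j) \<le> \<rho> j}"
proof -
  have "closed {x :: complex^'n. \<forall>j. norm (x $ j - p $ j) \<le> \<rho> j}"
    by (intro closed_Collect_all closed_Collect_le continuous_intros)
  moreover have "bounded {x :: complex^'n. \<forall>j. norm (x $ j - p $ j) \<le> \<rho> j}"
  proof (rule boundedI)
    fix x :: "complex^'n" assume x: "x \<in> {x. \<forall>j. norm (x $ j - p $ j) \<le> \<rho> j}"
    have "norm (x - p) \<le> (\<Sum>j\<in>UNIV. norm ((x - p) $ j))"
      unfolding norm_vec_def by (rule L2_set_le_sum) simp
    also have "\<dots> \<le> (\<Sum>j\<in>UNIV. \<rho> j)" using x by (intro sum_mono) auto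
    finally show "norm x \<le> norm p + (\<Sum>j\<in>UNIV. \<rho> j)"
      using norm_triangle_sub[of x p] by linarith
  qed
  ultimately show ?thesis by (simp add: compact_eq_bounded_closed)
qed

lemma axis_minus: "x + axis l (- z) = x - axis l (z :: complex)"
  by (simp add: axis_def vec_eq_iff)

lemma AE_reflection:
  fixes c :: complex
  assumes "AE z in lborel. Q z"
  shows "AE z in lborel. Q (c - z)"
proof -
  obtain N where N: "{x. \<not> Q x} \<subseteq> N" "N \<in> sets borel" "emeasure lborel N = 0"
    using assms by (auto simp: eventually_ae_filter null_sets_def)
  note [measurable] = N(2)
  have "(\<integral>\<^sup>+z. indicator N (c - z) \<partial>lborel) = (\<integral>\<^sup>+z. indicator N z \<partial>lborel)"
    by (rule nn_integral_reflection) measurable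
  then have "(\<integral>\<^sup>+z. indicator N (c - z) \<partial>lborel) = 0"
    using N by simp
  then have "AE z in lborel. (indicator N (c - z) :: ennreal) = 0"
    by (subst (asm) nn_integral_0_iff_AE) auto
  then show ?thesis
    by eventually_elim (use N(1) in \<open>auto simp: indicator_def split: if_splits\<close>)
qed

text \<open>A cutoff in the coordinates other than \<open>l\<close>. Being constant along the line,
  it is a positive common factor in the estimate and cancels.\<close>

definition transversal_bump :: "'n::finite \<Rightarrow> complex^'n \<Rightarrow> ('n \<Rightarrow> real) \<Rightarrow> complex^'n \<Rightarrow> complex" where
  "transversal_bump l p \<rho> x = (\<Prod>j\<in>UNIV - {l}. flat 0 ((\<rho> j)\<^sup>2 - (norm (x $ j - p $ j))\<^sup>2))"

lemma bounded_linear_component: "bounded_linear (\<lambda>x::complex^'n. x $ j)"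
  by (rule bounded_linear_vec_nth)

lemma Ck_function_component:
  assumes "Ck_function k \<kappa>"
  shows "Ck_function k (\<lambda>x::complex^'n. \<kappa> (x $ j - p))"
  using Ck_function_affine[OF bounded_linear_component assms, of "- p" j] by simp

lemma Ck_function_transversal_bump: "Ck_function k (transversal_bump l p \<rho>)"
proof -
  have "bounded_linear (\<lambda>t::real. - t)" by (rule bounded_linear_minus[OF bounded_linear_ident])
  from Ck_function_affine[OF this Ck_function_flat]
  have "Ck_function k (\<lambda>t. flat 0 (s - t))" for s by simp
  from Ck_function_component[OF Ck_function_compose_norm_sq[OF this]]
  show ?thesis unfolding transversal_bump_def[abs_def] by (intro Ck_function_prod)
qed

lemma transversal_bump_eq_0_iff:
  assumes "\<And>j. \<rho> j > 0"
  shows "transversal_bump l p \<rho> x = 0 \<longleftrightarrow> \<not> (\<forall>j. j \<noteq> l \<longrightarrow> norm (x $ j - p $ j) < \<rho> j)"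
proof -
  have "flat 0 ((\<rho> j)\<^sup>2 - (norm (x $ j - p $ j))\<^sup>2) = 0 \<longleftrightarrow> \<not> norm (x $ j - p $ j) < \<rho> j" for j
    using assms[of j] power2_le_imp_le[of "\<rho> j" "norm (x $ j - p $ j)"] power_mono[of "\<rho> j" "norm (x $ j - p $ j)" 2]
    by (auto simp: flat_0_eq_0_iff)
  then show ?thesis by (auto simp: transversal_bump_def)
qed

lemma transversal_bump_line: "transversal_bump l p \<rho> (x + axis l z) = transversal_bump l p \<rho> x"
  unfolding transversal_bump_def by (intro prod.cong refl) (auto simp: axis_def)

text \<open>One coordinate radius grows from \<epsilon> to \<open>\<rho> l\<close>. The
  representation inequality with the product of a polar cutoff in coordinate \<open>l\<close> and a
  transversal bump is restricted to almost every line in direction \<open>l\<close>, where it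
  becomes the potential hypothesis of \<open>unique_continuation_disc\<close>. Countable choices of
  radii keep the exceptional lines negligible.\<close>

lemma polydisc_step:
  fixes u P :: "'m::finite \<Rightarrow> complex^'n \<Rightarrow> complex" and a :: "complex^'n \<Rightarrow> real"
  assumes meas: "\<And>j. u j \<in> borel_measurable borel" "\<And>j. P j \<in> borel_measurable borel" "a \<in> borel_measurable borel"
    and sub: "{x. \<forall>j. norm (x $ j - p $ j) \<le> \<rho> j} \<subseteq> \<Omega>" and \<rho>: "\<And>j. \<rho> j > 0"
    and int_u: "\<And>j K. compact K \<Longrightarrow> K \<subseteq> \<Omega> \<Longrightarrow> integrable lborel (\<lambda>x. indicator K x *\<^sub>R u j x)"
    and int_P: "\<And>j K. compact K \<Longrightarrow> K \<subseteq> \<Omega> \<Longrightarrow> integrable lborel (\<lambda>x. indicator K x *\<^sub>R P j x)"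
    and weak: "\<And>j \<phi>. \<phi> \<in> test_functions \<Omega> \<Longrightarrow>
      (LINT x|lborel. u j x * dbar_along (axis l) \<phi> x) = - (LINT x|lborel. P j x * \<phi> x)"
    and a: "\<And>x. a x \<ge> 0"
    and bound: "AE x in lborel. x \<in> \<Omega> \<longrightarrow> (\<Sum>j\<in>UNIV. norm (P j x)) \<le> a x * (\<Sum>j\<in>UNIV. norm (u j x))"
    and U2: "(\<integral>\<^sup>+x. ennreal ((\<Sum>j\<in>UNIV. norm (u j x))\<^sup>2) * indicator {x. \<forall>j. norm (x $ j - p $ j) \<le> \<rho> j} x \<partial>lborel) < \<infinity>"
    and D2: "(\<integral>\<^sup>+x. ennreal ((\<Sum>j\<in>UNIV. norm (P j x))\<^sup>2) * indicator {x. \<forall>j. norm (x $ j - p $ j) \<le> \<rho> j} x \<partial>lborel) < \<infinity>"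
    and a2: "(\<integral>\<^sup>+x. ennreal ((a x)\<^sup>2) * indicator {x. \<forall>j. norm (x $ j - p $ j) \<le> \<rho> j} x \<partial>lborel) < \<infinity>"
    and \<epsilon>: "0 < \<epsilon>" "\<epsilon> < \<rho> l"
    and zero: "AE x in lborel. (\<forall>j. norm (x $ j - p $ j) < (if j = l then \<epsilon> else \<rho> j)) \<longrightarrow> (\<forall>j. u j x = 0)"
  shows "AE x in lborel. (\<forall>j. norm (x $ j - p $ j) < \<rho> j) \<longrightarrow> (\<forall>j. u j x = 0)"
proof -
  note [measurable] = meas
  have [measurable]: "ball (0::complex) s \<in> sets borel" for s by auto
  let ?Kp = "{x. \<forall>j. norm (x $ j - p $ j) \<le> \<rho> j}"
  have [measurable]: "?Kp \<in> sets borel" using compact_closed_polydisc[of p \<rho>] by (rule borel_compact)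
  define U where "U x = (\<Sum>j\<in>UNIV. norm (u j x))" for x
  define D where "D x = (\<Sum>j\<in>UNIV. norm (P j x))" for x
  have [measurable]: "U \<in> borel_measurable borel" "D \<in> borel_measurable borel"
    unfolding U_def D_def by measurable
  have U: "U x \<ge> 0" "U x = 0 \<longleftrightarrow> (\<forall>j. u j x = 0)" for x
    by (auto simp: U_def sum_nonneg sum_nonneg_eq_0_iff)
  have D: "D x \<ge> 0" for x by (auto simp: D_def sum_nonneg)
  \<comment> \<open>The cylinder over the other coordinates: a line in direction \<open>l\<close>
    lies in it entirely or misses it.\<close>
  define W where "W = {x :: complex^'n. \<forall>j. j \<noteq> l \<longrightarrow> norm (x $ j - p $ j) < \<rho> j}"
  \<comment> \<open>The density in the potential hypothesis of
    \<open>unique_continuation_disc\<close>. The complex argument \<eta> is the coordinate on the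
    line, kept apart from the point \<open>y\<close>; it is unrelated to the cutoff of the same name
    below.\<close>
  define g where "g r1 r2 M m \<eta> y = indicator (ball 0 r2) \<eta> * (D y + (if norm \<eta> < r1 then 0 else M * U y)) * inverse (norm \<eta>) ^ m"
    for r1 r2 M :: real and m :: nat and \<eta> :: complex and y :: "complex^'n"
  have W_line: "x + axis l z \<in> W \<longleftrightarrow> x \<in> W" for x z
    by (auto simp: W_def axis_def)
  have zero': "AE x in lborel. x \<in> W \<and> norm (x $ l - p $ l) < \<epsilon> \<longrightarrow> U x = 0"
    using zero by eventually_elim (auto simp: U(2) W_def)
  have zero_line: "AE x in lborel. AE z in lborel. x - axis l z \<in> W \<and> norm (x $ l - p $ l - z) < \<epsilon> \<longrightarrow> U (x - axis l z) = 0"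
  proof -
    have "AE x in lborel. AE z in lborel. (x + axis l z) \<in> W \<and> norm ((x + axis l z) $ l - p $ l) < \<epsilon> \<longrightarrow> U (x + axis l z) = 0"
      by (rule AE_on_lines[OF zero'])
    then show ?thesis
    proof eventually_elim
      case (elim x)
      from AE_reflection[OF elim, of 0] show ?case
        by eventually_elim (simp add: axis_minus algebra_simps)
    qed
  qed
  \<comment> \<open>\<open>M\<close> is chosen before \<open>m\<close>, as the limit in
    \<open>m\<close> requires.\<close>
  have ineq: "\<exists>M\<ge>0. \<forall>m. AE x in lborel. x \<in> W \<and> norm (x $ l - p $ l) < r1 \<longrightarrow>
      ennreal (U x * inverse (norm (x $ l - p $ l)) ^ m) \<le> ennreal (1 / cauchy_const) *
        (\<integral>\<^sup>+z. ennreal (g r1 r2 M m (x $ l - p $ l - z) (x - axis l z) * inverse (norm z)) \<partial>lborel)"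
    if r: "\<epsilon> < r1" "r1 < r2" "r2 < \<rho> l" for r1 r2
  proof -
    obtain M where M: "M \<ge> 0" "\<And>m. \<exists>\<kappa>. (\<forall>k. Ck_function k \<kappa>) \<and> (\<forall>z. r2 \<le> norm z \<longrightarrow> \<kappa> z = 0 \<and> dbar_along (\<lambda>z. z) \<kappa> z = 0) \<and>
      (\<forall>z. norm (\<kappa> z) \<le> inverse (norm z) ^ m) \<and>
      (\<forall>z. \<epsilon> \<le> norm z \<and> norm z < r1 \<longrightarrow> norm (\<kappa> z) = inverse (norm z) ^ m \<and> dbar_along (\<lambda>z. z) \<kappa> z = 0) \<and>
      (\<forall>z. r1 \<le> norm z \<longrightarrow> norm (dbar_along (\<lambda>z. z) \<kappa> z) \<le> M * inverse (norm z) ^ m)"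
      using polar_cutoff_exists[OF \<epsilon>(1) r(1,2)] by blast
    show ?thesis
    proof (intro exI[of _ M] conjI allI M(1))
      fix m
      obtain \<kappa> where \<kappa>: "\<And>k. Ck_function k \<kappa>" "\<And>z. r2 \<le> norm z \<Longrightarrow> \<kappa> z = 0" "\<And>z. r2 \<le> norm z \<Longrightarrow> dbar_along (\<lambda>z. z) \<kappa> z = 0"
        "\<And>z. norm (\<kappa> z) \<le> inverse (norm z) ^ m"
        "\<And>z. \<epsilon> \<le> norm z \<Longrightarrow> norm z < r1 \<Longrightarrow> norm (\<kappa> z) = inverse (norm z) ^ m"
        "\<And>z. \<epsilon> \<le> norm z \<Longrightarrow> norm z < r1 \<Longrightarrow> dbar_along (\<lambda>z. z) \<kappa> z = 0"
        "\<And>z. r1 \<le> norm z \<Longrightarrow> norm (dbar_along (\<lambda>z. z) \<kappa> z) \<le> M * inverse (norm z) ^ m"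
        using M(2)[of m] by (elim exE conjE) (rule that; blast)
      let ?E = "transversal_bump l p \<rho>"
      define \<eta> where "\<eta> x = \<kappa> (x $ l - p $ l) * ?E x" for x
      have Ck\<eta>: "Ck_function k \<eta>" for k
        unfolding \<eta>_def[abs_def] by (intro Ck_function_mult Ck_function_component \<kappa>(1) Ck_function_transversal_bump)
      have \<eta>: "\<eta> \<in> test_functions \<Omega>"
      proof (rule test_functionsI[OF Ck\<eta> compact_closed_polydisc sub])
        fix x assume "\<eta> x \<noteq> 0"
        then have "?E x \<noteq> 0" "\<kappa> (x $ l - p $ l) \<noteq> 0" by (auto simp: \<eta>_def)
        then have "\<forall>j. j \<noteq> l \<longrightarrow> norm (x $ j - p $ j) < \<rho> j" "norm (x $ l - p $ l) < r2"
          using transversal_bump_eq_0_iff[of \<rho> l p x] \<rho> \<kappa>(2)[of "x $ l - p $ l"] by (auto simp: not_le[symmetric])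
        then have "norm (x $ j - p $ j) \<le> \<rho> j" for j using r by (cases "j = l") auto
        then show "x \<in> ?Kp" by simp
      qed
      have \<eta>_line: "\<eta> (x - axis l z) = \<kappa> (x $ l - p $ l - z) * ?E x" for x z
        using transversal_bump_line[of l p \<rho> x "- z"] unfolding axis_minus
        by (simp add: \<eta>_def algebra_simps)
      have d\<eta>: "dbar_along (axis l) \<eta> y = dbar_along (\<lambda>z. z) \<kappa> (y $ l - p $ l) * ?E y" for y
      proof -
        \<comment> \<open>Base point on the line whose \<open>l\<close> coordinate is that of
          \<open>p\<close>, so that the line parameter equals the argument of
          \<open>\<kappa>\<close>.\<close>
        define y0 where "y0 = y - axis l (y $ l - p $ l)"
        have y: "y = y0 + axis l (y $ l - p $ l)" by (simp add: y0_def)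
        have E: "?E (y0 + axis l z) = ?E y" for z
          by (simp only: y0_def axis_minus[symmetric] transversal_bump_line)
        have "(y0 + axis l z) $ l - p $ l = z" for z by (simp add: y0_def)
        then have "(\<lambda>z. \<eta> (y0 + axis l z)) = (\<lambda>z. \<kappa> z * ?E y)"
          unfolding \<eta>_def E by simp
        then have "dbar_along (axis l) \<eta> (y0 + axis l (y $ l - p $ l)) = dbar_along (\<lambda>z. z) (\<lambda>z. \<kappa> z * ?E y) (y $ l - p $ l)"
          using dbar_along_line[OF Ck\<eta>, of l y0] by simp
        also have "\<dots> = dbar_along (\<lambda>z. z) \<kappa> (y $ l - p $ l) * ?E y"
          by (subst dbar_along_mult[OF \<kappa>(1) Ck_function_const]) (simp add: dbar_along_def)
        finally show ?thesis using y by simp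
      qed
      have d\<eta>_line: "dbar_along (axis l) \<eta> (x - axis l z) = dbar_along (\<lambda>z. z) \<kappa> (x $ l - p $ l - z) * ?E x" for x z
        using transversal_bump_line[of l p \<rho> x "- z"] unfolding axis_minus
        by (simp add: d\<eta> algebra_simps)
      have "AE x in lborel. \<forall>j. ennreal (cauchy_const * norm (\<eta> x) * norm (u j x)) \<le>
        (\<integral>\<^sup>+z. ennreal ((norm (\<eta> (x - axis l z)) * norm (P j (x - axis l z)) +
          norm (dbar_along (axis l) \<eta> (x - axis l z)) * norm (u j (x - axis l z))) * inverse (norm z)) \<partial>lborel)"
        by (rule eventually_all_finite) (intro cauchy_representation_le[OF meas(1,2) int_u int_P weak \<eta>])
      then show "AE x in lborel. x \<in> W \<and> norm (x $ l - p $ l) < r1 \<longrightarrow>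
        ennreal (U x * inverse (norm (x $ l - p $ l)) ^ m) \<le> ennreal (1 / cauchy_const) *
        (\<integral>\<^sup>+z. ennreal (g r1 r2 M m (x $ l - p $ l - z) (x - axis l z) * inverse (norm z)) \<partial>lborel)"
        using zero' zero_line
      proof eventually_elim
        case (elim x)
        show ?case
        proof (intro impI, cases "norm (x $ l - p $ l) < \<epsilon>")
          case True
          assume "x \<in> W \<and> norm (x $ l - p $ l) < r1"
          with elim(2) True have "U x = 0" by blast
          then show "ennreal (U x * inverse (norm (x $ l - p $ l)) ^ m) \<le> ennreal (1 / cauchy_const) *
            (\<integral>\<^sup>+z. ennreal (g r1 r2 M m (x $ l - p $ l - z) (x - axis l z) * inverse (norm z)) \<partial>lborel)" by simp
        next
          case False
          assume x: "x \<in> W \<and> norm (x $ l - p $ l) < r1"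
          \<comment> \<open>Value of the transversal bump along the whole line; positive on
            \<open>W\<close>, so it can be divided out at the end.\<close>
          define e where "e = norm (?E x)"
          have e: "e > 0" using x transversal_bump_eq_0_iff[of \<rho> l p x] \<rho> by (auto simp: e_def W_def)
          let ?w = "x $ l - p $ l"
          have "ennreal (cauchy_const * norm (\<eta> x) * U x) = (\<Sum>j\<in>UNIV. ennreal (cauchy_const * norm (\<eta> x) * norm (u j x)))"
            unfolding U_def sum_distrib_left using cauchy_const_pos by (subst sum_ennreal) auto
          also have "\<dots> \<le> (\<Sum>j\<in>UNIV. \<integral>\<^sup>+z. ennreal ((norm (\<eta> (x - axis l z)) * norm (P j (x - axis l z)) +
            norm (dbar_along (axis l) \<eta> (x - axis l z)) * norm (u j (x - axis l z))) * inverse (norm z)) \<partial>lborel)"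
            using elim(1) by (intro sum_mono) blast
          also have "\<dots> = (\<integral>\<^sup>+z. (\<Sum>j\<in>UNIV. ennreal ((norm (\<eta> (x - axis l z)) * norm (P j (x - axis l z)) +
            norm (dbar_along (axis l) \<eta> (x - axis l z)) * norm (u j (x - axis l z))) * inverse (norm z))) \<partial>lborel)"
          proof (rule nn_integral_sum[symmetric])
            note [measurable] = test_functionsD(3)[OF \<eta>] test_functionsD(3)[OF test_functions_dbar_along[OF \<eta>]]
            fix j
            show "(\<lambda>z. ennreal ((norm (\<eta> (x - axis l z)) * norm (P j (x - axis l z)) +
              norm (dbar_along (axis l) \<eta> (x - axis l z)) * norm (u j (x - axis l z))) * inverse (norm z))) \<in> borel_measurable lborel"
              by measurable
          qed
          also have "\<dots> = (\<integral>\<^sup>+z. ennreal ((norm (\<eta> (x - axis l z)) * D (x - axis l z) +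
            norm (dbar_along (axis l) \<eta> (x - axis l z)) * U (x - axis l z)) * inverse (norm z)) \<partial>lborel)"
            unfolding U_def D_def sum_distrib_left sum_distrib_right sum.distrib[symmetric]
            by (intro nn_integral_cong sum_ennreal) auto
          also have "\<dots> \<le> (\<integral>\<^sup>+z. ennreal e * ennreal (g r1 r2 M m (?w - z) (x - axis l z) * inverse (norm z)) \<partial>lborel)"
          proof (rule nn_integral_mono_AE, use elim(3) in \<open>rule eventually_mono\<close>)
            fix z assume z: "x - axis l z \<in> W \<and> norm (?w - z) < \<epsilon> \<longrightarrow> U (x - axis l z) = 0"
            have W: "x - axis l z \<in> W" using x W_line[of x "- z"] by (simp add: axis_minus)
            let ?y = "x - axis l z"
            have "norm (\<kappa> (?w - z)) * D ?y + norm (dbar_along (\<lambda>z. z) \<kappa> (?w - z)) * U ?y \<le> g r1 r2 M m (?w - z) ?y"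
            proof (cases "norm (?w - z) < r2")
              case True
              have "norm (\<kappa> (?w - z)) * D ?y \<le> inverse (norm (?w - z)) ^ m * D ?y"
                using D by (intro mult_right_mono \<kappa>(4)) auto
              moreover have "norm (dbar_along (\<lambda>z. z) \<kappa> (?w - z)) * U ?y \<le> (if norm (?w - z) < r1 then 0 else M * U ?y) * inverse (norm (?w - z)) ^ m"
              proof (cases "norm (?w - z) < r1")
                case True
                \<comment> \<open>Inside radius \<open>r1\<close> the cutoff is differentiated only
                  within the disc of radius \<epsilon>, where \<open>U\<close> vanishes.\<close>
                then have "dbar_along (\<lambda>z. z) \<kappa> (?w - z) = 0 \<or> U ?y = 0"
                  using z W \<kappa>(6)[of "?w - z"] by (cases "norm (?w - z) < \<epsilon>") auto
                then show ?thesis using True by auto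
              next
                case False
                then have "norm (dbar_along (\<lambda>z. z) \<kappa> (?w - z)) * U ?y \<le> (M * inverse (norm (?w - z)) ^ m) * U ?y"
                  using U by (intro mult_right_mono \<kappa>(7)) auto
                then show ?thesis using False by (simp add: ac_simps)
              qed
              ultimately show ?thesis using True by (simp add: g_def algebra_simps)
            next
              case False
              then show ?thesis using \<kappa>(2)[of "?w - z"] \<kappa>(3)[of "?w - z"] by (simp add: g_def)
            qed
            then have "e * ((norm (\<kappa> (?w - z)) * D ?y + norm (dbar_along (\<lambda>z. z) \<kappa> (?w - z)) * U ?y) * inverse (norm z)) \<le>
                e * (g r1 r2 M m (?w - z) ?y * inverse (norm z))"
              using e by (intro mult_left_mono mult_right_mono) auto
            moreover have "(norm (\<eta> ?y) * D ?y + norm (dbar_along (axis l) \<eta> ?y) * U ?y) * inverse (norm z) =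
                e * ((norm (\<kappa> (?w - z)) * D ?y + norm (dbar_along (\<lambda>z. z) \<kappa> (?w - z)) * U ?y) * inverse (norm z))"
              unfolding \<eta>_line d\<eta>_line by (simp add: norm_mult e_def algebra_simps)
            ultimately have "(norm (\<eta> ?y) * D ?y + norm (dbar_along (axis l) \<eta> ?y) * U ?y) * inverse (norm z) \<le>
                e * (g r1 r2 M m (?w - z) ?y * inverse (norm z))"
              by (simp only:)
            from ennreal_leI[OF this]
            show "ennreal ((norm (\<eta> ?y) * D ?y + norm (dbar_along (axis l) \<eta> ?y) * U ?y) * inverse (norm z)) \<le>
                ennreal e * ennreal (g r1 r2 M m (?w - z) ?y * inverse (norm z))"
              by (simp only: ennreal_mult'[OF less_imp_le[OF e]])
          qed
          also have "\<dots> = ennreal e * (\<integral>\<^sup>+z. ennreal (g r1 r2 M m (?w - z) (x - axis l z) * inverse (norm z)) \<partial>lborel)"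
            unfolding g_def by (rule nn_integral_cmult) measurable
          finally have "ennreal (cauchy_const * norm (\<eta> x) * U x) \<le> \<dots>" .
          moreover have "norm (\<eta> x) = inverse (norm ?w) ^ m * e"
            using False x \<kappa>(5)[of ?w] by (simp add: \<eta>_def norm_mult e_def)
          then have "ennreal (cauchy_const * norm (\<eta> x) * U x) = ennreal e * (ennreal cauchy_const * ennreal (U x * inverse (norm ?w) ^ m))"
            using e cauchy_const_pos U(1)[of x] by (simp add: ennreal_mult[symmetric] ac_simps)
          ultimately have "ennreal cauchy_const * ennreal (U x * inverse (norm ?w) ^ m) \<le>
            (\<integral>\<^sup>+z. ennreal (g r1 r2 M m (?w - z) (x - axis l z) * inverse (norm z)) \<partial>lborel)"
            using e by (simp add: ennreal_mult_le_mult_iff)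
          then have "ennreal (1 / cauchy_const) * (ennreal cauchy_const * ennreal (U x * inverse (norm ?w) ^ m)) \<le> ennreal (1 / cauchy_const) *
            (\<integral>\<^sup>+z. ennreal (g r1 r2 M m (?w - z) (x - axis l z) * inverse (norm z)) \<partial>lborel)"
            by (rule mult_left_mono) simp
          moreover have "ennreal (1 / cauchy_const) * (ennreal cauchy_const * ennreal (U x * inverse (norm ?w) ^ m)) = ennreal (U x * inverse (norm ?w) ^ m)"
            using cauchy_const_pos U(1)[of x] by (simp add: ennreal_mult[symmetric])
          ultimately show "ennreal (U x * inverse (norm ?w) ^ m) \<le> ennreal (1 / cauchy_const) *
            (\<integral>\<^sup>+z. ennreal (g r1 r2 M m (?w - z) (x - axis l z) * inverse (norm z)) \<partial>lborel)" by simp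
        qed
      qed
    qed
  qed
  \<comment> \<open>Choosing \<open>M\<close> as a function of the radii alone makes each inequality
    a statement about almost every \<open>x\<close>, with the constant independent of the
    line.\<close>
  have "\<exists>M. \<forall>r1 r2. \<epsilon> < r1 \<and> r1 < r2 \<and> r2 < \<rho> l \<longrightarrow> M r1 r2 \<ge> 0 \<and> (\<forall>m. AE x in lborel. x \<in> W \<and> norm (x $ l - p $ l) < r1 \<longrightarrow>
      ennreal (U x * inverse (norm (x $ l - p $ l)) ^ m) \<le> ennreal (1 / cauchy_const) *
        (\<integral>\<^sup>+z. ennreal (g r1 r2 (M r1 r2) m (x $ l - p $ l - z) (x - axis l z) * inverse (norm z)) \<partial>lborel))"
    using ineq by (intro choice allI) blast
  then obtain M where M: "\<And>r1 r2. \<epsilon> < r1 \<Longrightarrow> r1 < r2 \<Longrightarrow> r2 < \<rho> l \<Longrightarrow> M r1 r2 \<ge> 0"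
    "\<And>r1 r2 m. \<epsilon> < r1 \<Longrightarrow> r1 < r2 \<Longrightarrow> r2 < \<rho> l \<Longrightarrow> AE x in lborel. x \<in> W \<and> norm (x $ l - p $ l) < r1 \<longrightarrow>
      ennreal (U x * inverse (norm (x $ l - p $ l)) ^ m) \<le> ennreal (1 / cauchy_const) *
        (\<integral>\<^sup>+z. ennreal (g r1 r2 (M r1 r2) m (x $ l - p $ l - z) (x - axis l z) * inverse (norm z)) \<partial>lborel)"
    by blast
  define I where "I r1 r2 m x \<longleftrightarrow> x \<in> W \<and> norm (x $ l - p $ l) < r1 \<longrightarrow>
      ennreal (U x * inverse (norm (x $ l - p $ l)) ^ m) \<le> ennreal (1 / cauchy_const) *
        (\<integral>\<^sup>+z. ennreal (g r1 r2 (M r1 r2) m (x $ l - p $ l - z) (x - axis l z) * inverse (norm z)) \<partial>lborel)" for r1 r2 m x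
  \<comment> \<open>Rational radii and natural exponents are countably many, so a single null set of
    lines is discarded.\<close>
  have I_lines: "AE x in lborel. \<forall>q1 q2 :: rat. \<forall>m. \<epsilon> < of_rat q1 \<and> of_rat q1 < (of_rat q2 :: real) \<and> of_rat q2 < \<rho> l \<longrightarrow>
      (AE z in lborel. I (of_rat q1) (of_rat q2) m (x + axis l z))"
    unfolding AE_all_countable
  proof (intro allI)
    fix q1 q2 :: rat and m
    show "AE x in lborel. \<epsilon> < of_rat q1 \<and> of_rat q1 < (of_rat q2 :: real) \<and> of_rat q2 < \<rho> l \<longrightarrow>
      (AE z in lborel. I (of_rat q1) (of_rat q2) m (x + axis l z))"
    proof (cases "\<epsilon> < of_rat q1 \<and> of_rat q1 < (of_rat q2 :: real) \<and> of_rat q2 < \<rho> l")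
      case True
      then have "AE x in lborel. I (of_rat q1) (of_rat q2) m x"
        unfolding I_def by (intro M(2)) auto
      from AE_on_lines[OF this, of l] show ?thesis by (rule eventually_mono) blast
    next
      case False
      then show ?thesis by (intro AE_I2) blast
    qed
  qed
  have bound': "AE x in lborel. x \<in> \<Omega> \<longrightarrow> D x \<le> a x * U x"
    using bound by (simp add: U_def D_def)
  have fin: "AE x in lborel. \<forall>c R. (\<integral>\<^sup>+z. (ennreal ((U (x + axis l (c + z)))\<^sup>2) * indicator ?Kp (x + axis l (c + z))) * indicator (ball 0 R) z \<partial>lborel) < \<infinity>"
    "AE x in lborel. \<forall>c R. (\<integral>\<^sup>+z. (ennreal ((D (x + axis l (c + z)))\<^sup>2) * indicator ?Kp (x + axis l (c + z))) * indicator (ball 0 R) z \<partial>lborel) < \<infinity>"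
    "AE x in lborel. \<forall>c R. (\<integral>\<^sup>+z. (ennreal ((a (x + axis l (c + z)))\<^sup>2) * indicator ?Kp (x + axis l (c + z))) * indicator (ball 0 R) z \<partial>lborel) < \<infinity>"
    by (rule AE_finite_on_lines[where f = "\<lambda>x. ennreal ((U x)\<^sup>2) * indicator ?Kp x"], measurable, use U2 in \<open>simp add: U_def\<close>)
      (rule AE_finite_on_lines[where f = "\<lambda>x. ennreal ((D x)\<^sup>2) * indicator ?Kp x"], measurable, use D2 in \<open>simp add: D_def\<close>,
       rule AE_finite_on_lines[where f = "\<lambda>x. ennreal ((a x)\<^sup>2) * indicator ?Kp x"], measurable, use a2 in simp)
  define N where "N = {x. (\<forall>j. norm (x $ j - p $ j) < \<rho> j) \<and> U x \<noteq> 0}"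
  have "{x :: complex^'n. \<forall>j. norm (x $ j - p $ j) < \<rho> j} = (\<Inter>j. {x. norm (x $ j - p $ j) < \<rho> j})" by auto
  moreover have "open \<dots>"
    by (intro open_INT ballI open_Collect_less continuous_intros) auto
  ultimately have "{x :: complex^'n. \<forall>j. norm (x $ j - p $ j) < \<rho> j} \<in> sets borel" by (simp add: borel_open)
  moreover have "{x. U x \<noteq> 0} \<in> sets borel" by measurable
  ultimately have N_meas: "N \<in> sets borel"
    unfolding N_def Collect_conj_eq by (rule sets.Int)
  have "AE x in lborel. AE z in lborel. x + axis l z \<notin> N"
    using I_lines AE_on_lines[OF bound', of l] AE_on_lines[OF zero', of l] fin
  proof eventually_elim
    case (elim x)
    \<comment> \<open>The shift centres the parametrisation: \<open>\<sigma> z\<close> has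
      \<open>l\<close> coordinate \<open>p $ l + z\<close>, so the disc on the line is centred at
      0.\<close>
    define c where "c = p $ l - x $ l"
    define \<sigma> where "\<sigma> z = x + axis l (c + z)" for z
    have \<sigma>_l: "\<sigma> z $ l - p $ l = z" for z by (simp add: \<sigma>_def c_def)
    have \<sigma>_meas [measurable]: "\<sigma> \<in> borel_measurable borel" unfolding \<sigma>_def by measurable
    have \<sigma>_diff: "\<sigma> z - axis l w = \<sigma> (z - w)" for z w
      unfolding \<sigma>_def by (simp add: axis_def vec_eq_iff)
    show ?case
    proof (cases "x \<in> W")
      case False
      have "N \<subseteq> W" by (auto simp: N_def W_def)
      with False W_line show ?thesis by (intro AE_I2) blast
    next
      case True
      then have \<sigma>W: "\<sigma> z \<in> W" for z by (simp add: \<sigma>_def W_line)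
      have \<sigma>K: "\<sigma> z \<in> ?Kp" if "norm z < \<rho> l" for z
      proof -
        have "norm (\<sigma> z $ j - p $ j) \<le> \<rho> j" for j
          using \<sigma>W[of z] \<sigma>_l[of z] that by (cases "j = l") (auto simp: W_def less_imp_le)
        then show ?thesis by simp
      qed
      have fin': "(\<integral>\<^sup>+z. ennreal ((f (\<sigma> z))\<^sup>2) * indicator (ball 0 (\<rho> l)) z \<partial>lborel) < \<infinity>"
        if "\<forall>c R. (\<integral>\<^sup>+z. (ennreal ((f (x + axis l (c + z)))\<^sup>2) * indicator ?Kp (x + axis l (c + z))) * indicator (ball 0 R) z \<partial>lborel) < \<infinity>"
        for f :: "complex^'n \<Rightarrow> real"
      proof -
        have "(\<integral>\<^sup>+z. ennreal ((f (\<sigma> z))\<^sup>2) * indicator (ball 0 (\<rho> l)) z \<partial>lborel) =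
            (\<integral>\<^sup>+z. (ennreal ((f (\<sigma> z))\<^sup>2) * indicator ?Kp (\<sigma> z)) * indicator (ball 0 (\<rho> l)) z \<partial>lborel)"
          using \<sigma>K by (intro nn_integral_cong) (auto simp: indicator_def)
        also have "\<dots> < \<infinity>"
          using spec[OF spec[OF that, of c], of "\<rho> l"] by (simp only: \<sigma>_def)
        finally show ?thesis .
      qed
      have "AE z in lborel. z \<in> ball 0 (\<rho> l) \<longrightarrow> U (\<sigma> z) = 0"
      proof (rule unique_continuation_disc[where D = "\<lambda>z. D (\<sigma> z)" and a = "\<lambda>z. a (\<sigma> z)" and C = "1 / cauchy_const"])
        show "AE z in lborel. z \<in> ball 0 (\<rho> l) \<longrightarrow> D (\<sigma> z) \<le> a (\<sigma> z) * U (\<sigma> z)"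
          using AE_translation[OF elim(2), of c]
        proof eventually_elim
          case (elim z)
          then show ?case using \<sigma>K[of z] sub unfolding \<sigma>_def[symmetric] by auto
        qed
        show "AE z in lborel. z \<in> ball 0 \<epsilon> \<longrightarrow> U (\<sigma> z) = 0"
          using AE_translation[OF elim(3), of c]
        proof eventually_elim
          case (elim z)
          then show ?case using \<sigma>W[of z] \<sigma>_l[of z] unfolding \<sigma>_def[symmetric] by auto
        qed
        show "\<exists>M\<ge>0. \<forall>m. AE z in lborel. z \<in> ball 0 r1 \<longrightarrow> ennreal (U (\<sigma> z) * inverse (norm z) ^ m) \<le>
          ennreal (1 / cauchy_const) * (\<integral>\<^sup>+y. ennreal (indicator (ball 0 r2) y * (D (\<sigma> y) + (if norm y < r1 then 0 else M * U (\<sigma> y))) *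
            inverse (norm y) ^ m / norm (z - y)) \<partial>lborel)"
          if r: "r1 \<in> \<rat>" "r2 \<in> \<rat>" "\<epsilon> < r1" "r1 < r2" "r2 < \<rho> l" for r1 r2
        proof (intro exI[of _ "M r1 r2"] conjI allI M(1) r)
          fix m
          obtain q1 q2 where q: "r1 = of_rat q1" "r2 = of_rat q2" using r(1,2) by (auto elim!: Rats_cases)
          then have "AE z in lborel. I r1 r2 m (x + axis l z)" using elim(1) r by blast
          from AE_translation[OF this, of c]
          show "AE z in lborel. z \<in> ball 0 r1 \<longrightarrow> ennreal (U (\<sigma> z) * inverse (norm z) ^ m) \<le>
            ennreal (1 / cauchy_const) * (\<integral>\<^sup>+y. ennreal (indicator (ball 0 r2) y * (D (\<sigma> y) + (if norm y < r1 then 0 else M r1 r2 * U (\<sigma> y))) *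
              inverse (norm y) ^ m / norm (z - y)) \<partial>lborel)"
          proof eventually_elim
            case (elim z)
            \<comment> \<open>The representation integrates over displacements from the point;
              reflecting them about \<open>z\<close> puts the potential into the form with kernel
              1/|z - y|.\<close>
            have "(\<integral>\<^sup>+w. ennreal (g r1 r2 (M r1 r2) m (z - w) (\<sigma> (z - w)) * inverse (norm w)) \<partial>lborel) =
                (\<integral>\<^sup>+y. ennreal (g r1 r2 (M r1 r2) m y (\<sigma> y) * inverse (norm (z - y))) \<partial>lborel)"
              using nn_integral_reflection[of "\<lambda>y. ennreal (g r1 r2 (M r1 r2) m y (\<sigma> y) * inverse (norm (z - y)))" z]
              unfolding g_def by simp
            moreover have "I r1 r2 m (\<sigma> z)" using elim by (simp add: \<sigma>_def)
            ultimately show ?case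
              using \<sigma>W[of z] unfolding I_def \<sigma>_l \<sigma>_diff by (auto simp: g_def divide_inverse)
          qed
        qed
        show "0 < 1 / cauchy_const" using cauchy_const_pos by simp
        show "(\<integral>\<^sup>+z. ennreal ((U (\<sigma> z))\<^sup>2) * indicator (ball 0 (\<rho> l)) z \<partial>lborel) < \<infinity>" by (rule fin'[OF elim(4)])
        show "(\<integral>\<^sup>+z. ennreal ((D (\<sigma> z))\<^sup>2) * indicator (ball 0 (\<rho> l)) z \<partial>lborel) < \<infinity>" by (rule fin'[OF elim(5)])
        show "(\<integral>\<^sup>+z. ennreal ((a (\<sigma> z))\<^sup>2) * indicator (ball 0 (\<rho> l)) z \<partial>lborel) < \<infinity>" by (rule fin'[OF elim(6)])
      qed (use U(1) D a \<epsilon> in auto)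
      then have "AE z in lborel. \<sigma> z \<notin> N"
      proof eventually_elim
        case (elim z)
        show ?case
        proof
          assume "\<sigma> z \<in> N"
          then have "norm (\<sigma> z $ l - p $ l) < \<rho> l" "U (\<sigma> z) \<noteq> 0"
            unfolding N_def by blast+
          with elim \<sigma>_l[of z] show False by simp
        qed
      qed
      from AE_translation[OF this, of "- c"] show ?thesis by (simp add: \<sigma>_def)
    qed
  qed
  from AE_from_lines[OF N_meas this] show ?thesis
    by eventually_elim (auto simp: N_def U(2))
qed

section \<open>Borel representatives\<close>

text \<open>Product measures and restrictions to lines are handled with Borel functions, whereas the
  function spaces are defined by Lebesgue measurability. Real and imaginary parts are treated
  separately because the completion lemma is for real functions.\<close>

lemma ex_borel_representative:
  fixes f :: "'a::euclidean_space \<Rightarrow> complex"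
  assumes "open \<Omega>" "f \<in> borel_measurable (lebesgue_on \<Omega>)"
  shows "\<exists>f'\<in>borel_measurable borel. AE x in lborel. x \<in> \<Omega> \<longrightarrow> f x = f' x"
proof -
  have f: "(\<lambda>x. indicator \<Omega> x *\<^sub>R f x) \<in> borel_measurable lebesgue"
    using assms by (subst (asm) borel_measurable_restrict_space_iff) auto
  then have Re_f: "(\<lambda>x. Re (indicator \<Omega> x *\<^sub>R f x)) \<in> borel_measurable lebesgue"
    and Im_f: "(\<lambda>x. Im (indicator \<Omega> x *\<^sub>R f x)) \<in> borel_measurable lebesgue"
    by measurable
  obtain p where p: "p \<in> borel_measurable lborel" "AE x in lborel. Re (indicator \<Omega> x *\<^sub>R f x) = p x"
    using completion_ex_borel_measurable_real[OF Re_f] by blast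
  obtain q where q: "q \<in> borel_measurable lborel" "AE x in lborel. Im (indicator \<Omega> x *\<^sub>R f x) = q x"
    using completion_ex_borel_measurable_real[OF Im_f] by blast
  have "AE x in lborel. x \<in> \<Omega> \<longrightarrow> f x = Complex (p x) (q x)"
    using p(2) q(2) by eventually_elim (auto simp: complex_eq_iff)
  moreover have "(\<lambda>x. Complex (p x) (q x)) \<in> borel_measurable borel"
    unfolding Complex_eq using p(1) q(1) by simp
  ultimately show ?thesis by (intro bexI[of _ "\<lambda>x. Complex (p x) (q x)"])
qed

lemma L1_loc_representative_integrable:
  fixes f :: "'a::euclidean_space \<Rightarrow> complex"
  assumes "open \<Omega>" "f \<in> L1_loc \<Omega>" and [measurable]: "f' \<in> borel_measurable borel"
    and eq: "AE x in lborel. x \<in> \<Omega> \<longrightarrow> f x = f' x" and K: "compact K" "K \<subseteq> \<Omega>"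
  shows "integrable lborel (\<lambda>x. indicator K x *\<^sub>R f' x)"
proof -
  have [measurable]: "K \<in> sets borel" using K by (simp add: borel_compact)
  have int: "integrable lebesgue (\<lambda>x. indicator K x *\<^sub>R f x)"
    using assms by (auto simp: L1_loc_def set_integrable_def)
  have "AE x in lebesgue. x \<in> \<Omega> \<longrightarrow> f x = f' x"
    using eq by (simp add: AE_completion_iff)
  then have "AE x in lebesgue. indicator K x *\<^sub>R f x = indicator K x *\<^sub>R f' x"
    by eventually_elim (use K in \<open>auto simp: indicator_def\<close>)
  moreover have meas: "(\<lambda>x. indicator K x *\<^sub>R f' x) \<in> borel_measurable lborel" by measurable
  ultimately have "integrable lebesgue (\<lambda>x. indicator K x *\<^sub>R f' x)"
    using int measurable_completion[OF meas] by (subst integrable_cong_AE[symmetric]) (auto intro: borel_measurable_integrable)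
  then show ?thesis using integrable_completion[OF meas] by simp
qed

lemma L2_loc_representative_finite:
  fixes f :: "'a::euclidean_space \<Rightarrow> complex"
  assumes "f \<in> L2_loc \<Omega>" and eq: "AE x in lborel. x \<in> \<Omega> \<longrightarrow> f x = f' x" and K: "compact K" "K \<subseteq> \<Omega>"
  shows "(\<integral>\<^sup>+x. ennreal ((norm (f' x))\<^sup>2) * indicator K x \<partial>lborel) < \<infinity>"
proof -
  have "integrable lebesgue (\<lambda>x. indicator K x *\<^sub>R (norm (f x))\<^sup>2)"
    using assms by (auto simp: L2_loc_def set_integrable_def)
  then have "(\<integral>\<^sup>+x. ennreal (norm (indicator K x *\<^sub>R (norm (f x))\<^sup>2)) \<partial>lebesgue) < \<infinity>"
    by (simp add: integrable_iff_bounded)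
  also have "(\<integral>\<^sup>+x. ennreal (norm (indicator K x *\<^sub>R (norm (f x))\<^sup>2)) \<partial>lebesgue) =
      (\<integral>\<^sup>+x. ennreal ((norm (f' x))\<^sup>2) * indicator K x \<partial>lborel)"
    unfolding nn_integral_completion
    by (rule nn_integral_cong_AE, use eq in \<open>rule eventually_mono\<close>) (use K in \<open>auto simp: indicator_def\<close>)
  finally show ?thesis .
qed

lemma integral_representative_test_function:
  fixes f :: "'a::euclidean_space \<Rightarrow> complex"
  assumes "open \<Omega>" "f \<in> borel_measurable (lebesgue_on \<Omega>)" and [measurable]: "f' \<in> borel_measurable borel"
    and eq: "AE x in lborel. x \<in> \<Omega> \<longrightarrow> f x = f' x" and \<phi>: "\<phi> \<in> test_functions \<Omega>"
  shows "(LINT x:\<Omega>|lebesgue. f x * \<phi> x) = (LINT x|lborel. f' x * \<phi> x)"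
proof -
  note [measurable] = test_functionsD(3)[OF \<phi>]
  have f: "(\<lambda>x. indicator \<Omega> x *\<^sub>R f x) \<in> borel_measurable lebesgue"
    using assms(1,2) by (subst (asm) borel_measurable_restrict_space_iff) auto
  have meas: "(\<lambda>x. f' x * \<phi> x) \<in> borel_measurable lborel" "\<phi> \<in> borel_measurable lborel" by simp_all
  have \<phi>0: "\<phi> x = 0" if "x \<notin> \<Omega>" for x
    using test_functions_supportE[OF \<phi>] that by (metis subsetD)
  have "(LINT x:\<Omega>|lebesgue. f x * \<phi> x) = (LINT x|lebesgue. (indicator \<Omega> x *\<^sub>R f x) * \<phi> x)"
    by (simp add: set_lebesgue_integral_def)
  also have "\<dots> = (LINT x|lebesgue. f' x * \<phi> x)"
  proof (rule integral_cong_AE)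
    show "(\<lambda>x. (indicator \<Omega> x *\<^sub>R f x) * \<phi> x) \<in> borel_measurable lebesgue"
      by (intro borel_measurable_times f measurable_completion meas)
    show "(\<lambda>x. f' x * \<phi> x) \<in> borel_measurable lebesgue" by (intro measurable_completion meas)
    have "AE x in lebesgue. x \<in> \<Omega> \<longrightarrow> f x = f' x" using eq by (simp add: AE_completion_iff)
    then show "AE x in lebesgue. (indicator \<Omega> x *\<^sub>R f x) * \<phi> x = f' x * \<phi> x"
      by eventually_elim (use \<phi>0 in \<open>auto simp: indicator_def\<close>)
  qed
  also have "\<dots> = (LINT x|lborel. f' x * \<phi> x)" by (rule integral_completion) (rule meas)
  finally show ?thesis .
qed

text \<open>This ties the arbitrary choice in \<open>weak_deriv\<close> to the square integrable
  weak derivative provided by \<open>H1_loc\<close>.\<close>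

lemma has_weak_deriv_AE_unique:
  fixes u :: "'a::euclidean_space \<Rightarrow> complex"
  assumes \<Omega>: "open \<Omega>" and w: "has_weak_deriv \<Omega> v u w1" "has_weak_deriv \<Omega> v u w2"
  shows "AE x in lborel. x \<in> \<Omega> \<longrightarrow> w1 x = w2 x"
proof -
  have L1: "w1 \<in> L1_loc \<Omega>" "w2 \<in> L1_loc \<Omega>" using w by (auto simp: has_weak_deriv_def)
  then have m: "w1 \<in> borel_measurable (lebesgue_on \<Omega>)" "w2 \<in> borel_measurable (lebesgue_on \<Omega>)"
    by (auto simp: L1_loc_def)
  obtain p where p: "p \<in> borel_measurable borel" "AE x in lborel. x \<in> \<Omega> \<longrightarrow> w1 x = p x"
    using ex_borel_representative[OF \<Omega> m(1)] by blast
  obtain q where q: "q \<in> borel_measurable borel" "AE x in lborel. x \<in> \<Omega> \<longrightarrow> w2 x = q x"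
    using ex_borel_representative[OF \<Omega> m(2)] by blast
  note int_p = L1_loc_representative_integrable[OF \<Omega> L1(1) p]
  note int_q = L1_loc_representative_integrable[OF \<Omega> L1(2) q]
  have "AE x in lborel. x \<in> \<Omega> \<longrightarrow> p x - q x = 0"
  proof (rule AE_eq_0_if_integral_test_functions[OF \<Omega>])
    show "(\<lambda>x. p x - q x) \<in> borel_measurable borel" using p(1) q(1) by simp
    show "integrable lborel (\<lambda>x. indicator K x *\<^sub>R (p x - q x))" if "compact K" "K \<subseteq> \<Omega>" for K
      using Bochner_Integration.integrable_diff[OF int_p[OF that] int_q[OF that]] by (simp add: scaleR_diff_right)
    fix \<phi> assume \<phi>: "\<phi> \<in> test_functions \<Omega>"
    have i: "integrable lborel (\<lambda>x. p x * \<phi> x)" "integrable lborel (\<lambda>x. q x * \<phi> x)"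
      using integrable_test_function_mult[OF \<phi> p(1) int_p] integrable_test_function_mult[OF \<phi> q(1) int_q]
      by (simp_all add: mult.commute)
    have "(LINT x|lborel. p x * \<phi> x) = (LINT x:\<Omega>|lebesgue. w1 x * \<phi> x)"
      by (rule integral_representative_test_function[OF \<Omega> m(1) p \<phi>, symmetric])
    also have "\<dots> = (LINT x:\<Omega>|lebesgue. w2 x * \<phi> x)"
    proof -
      have "- (LINT x:\<Omega>|lebesgue. w1 x * \<phi> x) = - (LINT x:\<Omega>|lebesgue. w2 x * \<phi> x)"
        using w \<phi> unfolding has_weak_deriv_def by metis
      then show ?thesis by simp
    qed
    also have "\<dots> = (LINT x|lborel. q x * \<phi> x)"
      by (rule integral_representative_test_function[OF \<Omega> m(2) q \<phi>])
    finally show "(LINT x|lborel. (p x - q x) * \<phi> x) = 0"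
      using i by (simp add: left_diff_distrib)
  qed
  then show ?thesis using p(2) q(2) by eventually_elim auto
qed

text \<open>\<open>F\<close> is a Borel version of \<open>f\<close>, and \<open>W v\<close> one of
  its weak derivative in direction \<open>v\<close>. All properties used later are bundled so that
  both can be chosen at once for every component.\<close>

definition borel_H1_representative ::
    "'a::euclidean_space set \<Rightarrow> ('a \<Rightarrow> complex) \<Rightarrow> ('a \<Rightarrow> complex) \<Rightarrow> ('a \<Rightarrow> 'a \<Rightarrow> complex) \<Rightarrow> bool" where
  "borel_H1_representative \<Omega> f F W \<longleftrightarrow> F \<in> borel_measurable borel \<and> (AE x in lborel. x \<in> \<Omega> \<longrightarrow> f x = F x) \<and>
     (\<forall>K. compact K \<longrightarrow> K \<subseteq> \<Omega> \<longrightarrow> integrable lborel (\<lambda>x. indicator K x *\<^sub>R F x) \<and>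
        (\<integral>\<^sup>+x. ennreal ((norm (F x))\<^sup>2) * indicator K x \<partial>lborel) < \<infinity>) \<and>
     (\<forall>v\<in>Basis. W v \<in> borel_measurable borel \<and> (AE x in lborel. x \<in> \<Omega> \<longrightarrow> weak_deriv \<Omega> v f x = W v x) \<and>
        (\<forall>K. compact K \<longrightarrow> K \<subseteq> \<Omega> \<longrightarrow> integrable lborel (\<lambda>x. indicator K x *\<^sub>R W v x) \<and>
           (\<integral>\<^sup>+x. ennreal ((norm (W v x))\<^sup>2) * indicator K x \<partial>lborel) < \<infinity>) \<and>
        (\<forall>\<phi>\<in>test_functions \<Omega>. (LINT x|lborel. F x * frechet_derivative \<phi> (at x) v) = - (LINT x|lborel. W v x * \<phi> x)))"

lemma H1_loc_representative:
  fixes f :: "'a::euclidean_space \<Rightarrow> complex"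
  assumes \<Omega>: "open \<Omega>" and f: "f \<in> H1_loc \<Omega>"
  shows "\<exists>F W. borel_H1_representative \<Omega> f F W"
proof -
  have fL2: "f \<in> L2_loc \<Omega>" using f by (simp add: H1_loc_def)
  then have fm: "f \<in> borel_measurable (lebesgue_on \<Omega>)" by (simp add: L2_loc_def)
  \<comment> \<open>Local integrability of \<open>f\<close> is part of
    \<open>has_weak_deriv\<close>, so any one basis direction supplies it.\<close>
  obtain b :: 'a where "b \<in> Basis" by (rule nonempty_Basis[THEN ex_in_conv[THEN iffD2], THEN exE])
  then have fL1: "f \<in> L1_loc \<Omega>" using f by (auto simp: H1_loc_def has_weak_deriv_def)
  obtain F where F: "F \<in> borel_measurable borel" "AE x in lborel. x \<in> \<Omega> \<longrightarrow> f x = F x"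
    using ex_borel_representative[OF \<Omega> fm] by blast
  have "\<exists>W. W \<in> borel_measurable borel \<and> (AE x in lborel. x \<in> \<Omega> \<longrightarrow> weak_deriv \<Omega> v f x = W x) \<and>
        (\<forall>K. compact K \<longrightarrow> K \<subseteq> \<Omega> \<longrightarrow> integrable lborel (\<lambda>x. indicator K x *\<^sub>R W x) \<and>
           (\<integral>\<^sup>+x. ennreal ((norm (W x))\<^sup>2) * indicator K x \<partial>lborel) < \<infinity>) \<and>
        (\<forall>\<phi>\<in>test_functions \<Omega>. (LINT x|lborel. F x * frechet_derivative \<phi> (at x) v) = - (LINT x|lborel. W x * \<phi> x))"
    if v: "v \<in> Basis" for v
  proof -
    obtain w where w: "w \<in> L2_loc \<Omega>" "has_weak_deriv \<Omega> v f w"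
      using f v by (auto simp: H1_loc_def)
    have "has_weak_deriv \<Omega> v f (weak_deriv \<Omega> v f)"
      unfolding weak_deriv_def by (rule someI[of "has_weak_deriv \<Omega> v f", OF w(2)])
    from has_weak_deriv_AE_unique[OF \<Omega> this w(2)]
    have wd: "AE x in lborel. x \<in> \<Omega> \<longrightarrow> weak_deriv \<Omega> v f x = w x" .
    have wm: "w \<in> borel_measurable (lebesgue_on \<Omega>)" and wL1: "w \<in> L1_loc \<Omega>"
      using w by (auto simp: L2_loc_def has_weak_deriv_def)
    obtain W where W: "W \<in> borel_measurable borel" "AE x in lborel. x \<in> \<Omega> \<longrightarrow> w x = W x"
      using ex_borel_representative[OF \<Omega> wm] by blast
    have "AE x in lborel. x \<in> \<Omega> \<longrightarrow> weak_deriv \<Omega> v f x = W x"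
      using wd W(2) by eventually_elim auto
    moreover have "(LINT x|lborel. F x * frechet_derivative \<phi> (at x) v) = - (LINT x|lborel. W x * \<phi> x)"
      if \<phi>: "\<phi> \<in> test_functions \<Omega>" for \<phi>
    proof -
      have "(LINT x:\<Omega>|lebesgue. f x * frechet_derivative \<phi> (at x) v) = - (LINT x:\<Omega>|lebesgue. w x * \<phi> x)"
        using w(2) \<phi> by (auto simp: has_weak_deriv_def)
      then show ?thesis
        unfolding integral_representative_test_function[OF \<Omega> fm F test_functions_deriv[OF \<phi>]]
          integral_representative_test_function[OF \<Omega> wm W \<phi>] .
    qed
    ultimately show ?thesis
      using W(1) L1_loc_representative_integrable[OF \<Omega> wL1 W] L2_loc_representative_finite[OF w(1) W(2)]
      by (intro exI[of _ W]) blast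
  qed
  then have "\<exists>W. \<forall>v\<in>Basis. W v \<in> borel_measurable borel \<and> (AE x in lborel. x \<in> \<Omega> \<longrightarrow> weak_deriv \<Omega> v f x = W v x) \<and>
        (\<forall>K. compact K \<longrightarrow> K \<subseteq> \<Omega> \<longrightarrow> integrable lborel (\<lambda>x. indicator K x *\<^sub>R W v x) \<and>
           (\<integral>\<^sup>+x. ennreal ((norm (W v x))\<^sup>2) * indicator K x \<partial>lborel) < \<infinity>) \<and>
        (\<forall>\<phi>\<in>test_functions \<Omega>. (LINT x|lborel. F x * frechet_derivative \<phi> (at x) v) = - (LINT x|lborel. W v x * \<phi> x))"
    by (intro bchoice ballI)
  then obtain W where W: "\<forall>v\<in>Basis. W v \<in> borel_measurable borel \<and> (AE x in lborel. x \<in> \<Omega> \<longrightarrow> weak_deriv \<Omega> v f x = W v x) \<and>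
        (\<forall>K. compact K \<longrightarrow> K \<subseteq> \<Omega> \<longrightarrow> integrable lborel (\<lambda>x. indicator K x *\<^sub>R W v x) \<and>
           (\<integral>\<^sup>+x. ennreal ((norm (W v x))\<^sup>2) * indicator K x \<partial>lborel) < \<infinity>) \<and>
        (\<forall>\<phi>\<in>test_functions \<Omega>. (LINT x|lborel. F x * frechet_derivative \<phi> (at x) v) = - (LINT x|lborel. W v x * \<phi> x))"
    by (rule exE)
  then have "borel_H1_representative \<Omega> f F W"
    unfolding borel_H1_representative_def
    using F L1_loc_representative_integrable[OF \<Omega> fL1 F] L2_loc_representative_finite[OF fL2 F(2)]
    by (intro conjI allI impI)
  then show ?thesis by blast
qed

text \<open>Cauchy-Schwarz for a finite sum: the square of the sum is at most the number of terms
  times the sum of squares.\<close>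

lemma nn_integral_sum_squared_finite:
  fixes f :: "'i \<Rightarrow> 'a::euclidean_space \<Rightarrow> real"
  assumes "finite I" and meas: "\<And>i. i \<in> I \<Longrightarrow> f i \<in> borel_measurable borel" and [measurable]: "K \<in> sets borel"
    and fin: "\<And>i. i \<in> I \<Longrightarrow> (\<integral>\<^sup>+x. ennreal ((f i x)\<^sup>2) * indicator K x \<partial>lborel) < \<infinity>"
  shows "(\<integral>\<^sup>+x. ennreal ((\<Sum>i\<in>I. f i x)\<^sup>2) * indicator K x \<partial>lborel) < \<infinity>"
proof -
  have "(\<integral>\<^sup>+x. ennreal ((\<Sum>i\<in>I. f i x)\<^sup>2) * indicator K x \<partial>lborel) \<le>
      (\<integral>\<^sup>+x. ennreal (real (card I)) * (\<Sum>i\<in>I. ennreal ((f i x)\<^sup>2) * indicator K x) \<partial>lborel)"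
  proof (rule nn_integral_mono)
    fix x
    have "(\<Sum>i\<in>I. f i x)\<^sup>2 \<le> (\<Sum>i\<in>I. (f i x)\<^sup>2) * real (card I)"
      using sum_squared_le_sum_of_squares[of "\<lambda>i. f i x" I] by simp
    then have "ennreal ((\<Sum>i\<in>I. f i x)\<^sup>2) \<le> ennreal (real (card I) * (\<Sum>i\<in>I. (f i x)\<^sup>2))"
      by (intro ennreal_leI) (simp add: mult.commute)
    also have "\<dots> = ennreal (real (card I)) * (\<Sum>i\<in>I. ennreal ((f i x)\<^sup>2))"
      by (simp add: ennreal_mult sum_nonneg)
    finally show "ennreal ((\<Sum>i\<in>I. f i x)\<^sup>2) * indicator K x \<le>
        ennreal (real (card I)) * (\<Sum>i\<in>I. ennreal ((f i x)\<^sup>2) * indicator K x)"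
      by (auto simp: indicator_def)
  qed
  also have "\<dots> = ennreal (real (card I)) * (\<Sum>i\<in>I. \<integral>\<^sup>+x. ennreal ((f i x)\<^sup>2) * indicator K x \<partial>lborel)"
    using meas by (subst nn_integral_cmult, measurable, subst nn_integral_sum) auto
  also have "\<dots> < \<infinity>"
    using fin assms(1) by (auto simp: ennreal_mult_less_top)
  finally show ?thesis .
qed

section \<open>Unique continuation on connected open sets\<close>

text \<open>By Lindelof, countably many of the balls already cover, so their null sets can be
  united.\<close>

lemma AE_open_local:
  fixes \<Omega> :: "'a::euclidean_space set"
  assumes "\<And>x. x \<in> \<Omega> \<Longrightarrow> \<exists>r>0. AE y in lborel. y \<in> ball x r \<longrightarrow> Q y"
  shows "AE y in lborel. y \<in> \<Omega> \<longrightarrow> Q y"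
proof -
  define \<F> where "\<F> = {B. \<exists>x r. B = ball x r \<and> (AE y in lborel. y \<in> ball x r \<longrightarrow> Q y)}"
  have "\<And>S. S \<in> \<F> \<Longrightarrow> open S" by (auto simp: \<F>_def)
  then obtain \<F>' where \<F>': "\<F>' \<subseteq> \<F>" "countable \<F>'" "\<Union>\<F>' = \<Union>\<F>"
    by (rule Lindelof)
  have "AE y in lborel. \<forall>B\<in>\<F>'. y \<in> B \<longrightarrow> Q y"
    using \<F>'(2) by (rule AE_ball_countable[THEN iffD2]) (use \<F>'(1) in \<open>auto simp: \<F>_def\<close>)
  moreover have "\<Omega> \<subseteq> \<Union>\<F>'"
    unfolding \<F>'(3)
  proof
    fix x assume "x \<in> \<Omega>"
    then obtain r where "r > 0" "AE y in lborel. y \<in> ball x r \<longrightarrow> Q y" using assms by blast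
    then have "ball x r \<in> \<F>" "x \<in> ball x r" by (auto simp: \<F>_def)
    then show "x \<in> \<Union>\<F>" by blast
  qed
  ultimately show ?thesis by (auto elim!: eventually_mono)
qed

lemma norm_vec_le_if_components:
  fixes x :: "complex^'n" and e :: real
  assumes "\<And>j. norm (x $ j) \<le> e"
  shows "norm x \<le> CARD('n) * e"
proof -
  have "norm x \<le> (\<Sum>j\<in>UNIV. norm (x $ j))"
    unfolding norm_vec_def by (rule L2_set_le_sum) simp
  also have "\<dots> \<le> (\<Sum>j\<in>(UNIV::'n set). e)" by (intro sum_mono assms)
  finally show ?thesis by simp
qed

text \<open>The set \<open>T\<close> of points near which \<open>Q\<close> holds almost everywhere
  is open, and so is its complement in \<open>\<Omega>\<close>: around each p outside
  \<open>T\<close> a radius is fixed such that a point of \<open>T\<close> close to p would be the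
  centre of an admissible polydisc covering a neighbourhood of p. Connectedness does the
  rest.\<close>

lemma polydisc_propagation_imp_AE:
  fixes \<Omega> :: "(complex^'n) set"
  assumes \<Omega>: "open \<Omega>" "connected \<Omega>"
    and V: "open V" "V \<noteq> {}" "V \<subseteq> \<Omega>" "AE x in lborel. x \<in> V \<longrightarrow> Q x"
    and step: "\<And>p \<epsilon> R. 0 < \<epsilon> \<Longrightarrow> \<epsilon> < R \<Longrightarrow> {x. \<forall>j. norm (x $ j - p $ j) \<le> R} \<subseteq> \<Omega> \<Longrightarrow>
      (AE x in lborel. (\<forall>j. norm (x $ j - p $ j) < \<epsilon>) \<longrightarrow> Q x) \<Longrightarrow>
      (AE x in lborel. (\<forall>j. norm (x $ j - p $ j) < R) \<longrightarrow> Q x)"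
  shows "AE x in lborel. x \<in> \<Omega> \<longrightarrow> Q x"
proof -
  define T where "T = {x \<in> \<Omega>. \<exists>r>0. AE y in lborel. y \<in> ball x r \<longrightarrow> Q y}"
  have "open T"
    unfolding open_contains_ball
  proof
    fix x assume "x \<in> T"
    then obtain r where r: "r > 0" "AE y in lborel. y \<in> ball x r \<longrightarrow> Q y" and x: "x \<in> \<Omega>"
      by (auto simp: T_def)
    obtain s where s: "s > 0" "ball x s \<subseteq> \<Omega>" using x \<Omega>(1) open_contains_ball by blast
    have "y \<in> T" if y: "y \<in> ball x (min s (r / 2))" for y
    proof -
      have sub: "ball y (r / 2) \<subseteq> ball x r"
      proof
        fix w assume "w \<in> ball y (r / 2)"
        then show "w \<in> ball x r" using y dist_triangle[of x w y] by simp
      qed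
      then have "AE w in lborel. w \<in> ball y (r / 2) \<longrightarrow> Q w" using r(2) by eventually_elim (use sub in blast)
      moreover have "y \<in> \<Omega>" using y s by auto
      moreover have "r / 2 > 0" using r by simp
      ultimately show ?thesis unfolding T_def by blast
    qed
    then show "\<exists>e>0. ball x e \<subseteq> T" using r s by (intro exI[of _ "min s (r / 2)"]) auto
  qed
  moreover have "open (\<Omega> - T)"
    unfolding open_contains_ball
  proof
    fix p assume p: "p \<in> \<Omega> - T"
    then obtain \<delta> where \<delta>: "\<delta> > 0" "cball p \<delta> \<subseteq> \<Omega>" using \<Omega>(1) open_contains_cball by blast
    \<comment> \<open>The polydisc of radius \<open>2 * R\<close> about \<open>p\<close> stays in
      \<open>cball p \<delta>\<close>. Hence for \<open>q\<close> within \<open>R / 2\<close> of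
      \<open>p\<close> the closed polydisc of radius \<open>R\<close> about \<open>q\<close> lies in
      \<open>\<Omega>\<close>, and its interior contains \<open>ball p (R / 2)\<close>.\<close>
    define R where "R = \<delta> / (2 * CARD('n))"
    have R: "R > 0" using \<delta> by (simp add: R_def)
    have big: "x \<in> \<Omega>" if "\<And>j. norm (x $ j - p $ j) \<le> 2 * R" for x
    proof -
      have "norm (x - p) \<le> CARD('n) * (2 * R)" by (rule norm_vec_le_if_components) (use that in simp)
      then have "norm (x - p) \<le> \<delta>" by (simp add: R_def)
      then show ?thesis using \<delta>(2) by (auto simp: dist_norm norm_minus_commute)
    qed
    have "q \<in> \<Omega> - T" if q: "q \<in> ball p (R / 2)" for q
    proof -
      have qp: "norm (q $ j - p $ j) < R / 2" for j
        using q Finite_Cartesian_Product.norm_nth_le[of "q - p" j] by (simp add: dist_norm norm_minus_commute)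
      have "norm (q $ j - p $ j) \<le> 2 * R" for j using qp[of j] R by linarith
      then have "q \<in> \<Omega>" by (rule big)
      moreover have "q \<notin> T"
      proof
        assume "q \<in> T"
        then obtain r where r: "r > 0" "AE y in lborel. y \<in> ball q r \<longrightarrow> Q y" by (auto simp: T_def)
        \<comment> \<open>Division by the dimension places the polydisc of radius \<epsilon> about
          \<open>q\<close> inside \<open>ball q r\<close>; the other bound keeps \<epsilon> below
          \<open>R\<close>.\<close>
        define \<epsilon> where "\<epsilon> = min (R / 2) (r / (2 * CARD('n)))"
        have \<epsilon>: "0 < \<epsilon>" "\<epsilon> < R" using R r by (auto simp: \<epsilon>_def)
        have "AE x in lborel. (\<forall>j. norm (x $ j - q $ j) < \<epsilon>) \<longrightarrow> Q x"
          using r(2)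
        proof eventually_elim
          case (elim x)
          show ?case
          proof
            assume x: "\<forall>j. norm (x $ j - q $ j) < \<epsilon>"
            have "norm (x - q) \<le> CARD('n) * \<epsilon>" by (rule norm_vec_le_if_components) (use x in \<open>simp add: less_imp_le\<close>)
            also have "\<dots> \<le> CARD('n) * (r / (2 * CARD('n)))" by (intro mult_left_mono) (auto simp: \<epsilon>_def)
            also have "\<dots> < r" using r by simp
            finally show "Q x" using elim by (simp add: dist_norm norm_minus_commute)
          qed
        qed
        moreover have "{x. \<forall>j. norm (x $ j - q $ j) \<le> R} \<subseteq> \<Omega>"
        proof
          fix x assume x: "x \<in> {x. \<forall>j. norm (x $ j - q $ j) \<le> R}"
          have "norm (x $ j - p $ j) \<le> 2 * R" for j
          proof -
            have "norm (x $ j - q $ j) \<le> R" using x by blast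
            then show ?thesis
              using qp[of j] norm_triangle_ineq[of "x $ j - q $ j" "q $ j - p $ j"] R by simp
          qed
          then show "x \<in> \<Omega>" by (rule big)
        qed
        ultimately have Q: "AE x in lborel. (\<forall>j. norm (x $ j - q $ j) < R) \<longrightarrow> Q x"
          using step[OF \<epsilon>] by blast
        have "AE x in lborel. x \<in> ball p (R / 2) \<longrightarrow> Q x"
          using Q
        proof eventually_elim
          case (elim x)
          show ?case
          proof
            assume x: "x \<in> ball p (R / 2)"
            have "norm (x $ j - q $ j) < R" for j
            proof -
              have "norm (x $ j - p $ j) < R / 2"
                using x Finite_Cartesian_Product.norm_nth_le[of "x - p" j] by (simp add: dist_norm norm_minus_commute)
              then show ?thesis
                using qp[of j] norm_triangle_ineq4[of "x $ j - p $ j" "q $ j - p $ j"] by simp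
            qed
            with elim show "Q x" by blast
          qed
        qed
        moreover have "R / 2 > 0" using R by simp
        ultimately have "p \<in> T" using p unfolding T_def by blast
        with p show False by blast
      qed
      ultimately show ?thesis by blast
    qed
    then show "\<exists>e>0. ball p e \<subseteq> \<Omega> - T" using R by (intro exI[of _ "R / 2"]) auto
  qed
  moreover have "V \<subseteq> T"
  proof
    fix x assume x: "x \<in> V"
    then obtain r where r: "r > 0" "ball x r \<subseteq> V" using V(1) open_contains_ball by blast
    have "AE y in lborel. y \<in> ball x r \<longrightarrow> Q y" using V(4) by eventually_elim (use r in blast)
    then show "x \<in> T" using x r V(3) unfolding T_def by blast
  qed
  ultimately have "\<Omega> \<subseteq> T"
    using connectedD[OF \<Omega>(2), of T "\<Omega> - T"] V by (auto simp: T_def)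
  then show ?thesis by (intro AE_open_local) (auto simp: T_def)
qed

text \<open>The inhomogeneity \<open>h\<close> cancels in the difference of the solutions. After
  passing to Borel representatives, that difference satisfies one scalar inequality for each form
  index \<open>l\<close>, which is all that the polydisc step sees of the system.\<close>

theorem corollary1p4:
  fixes \<Omega> U :: "(complex^'n::finite) set"
    and A :: "complex^'n \<Rightarrow> ('n form01)^'m^'m::finite"
    and h :: "complex^'n \<Rightarrow> ('n form01)^'m"
    and f g :: "complex^'n \<Rightarrow> complex^'m"
  assumes "open \<Omega>" "connected \<Omega>"
    and "\<And>j k l. (\<lambda>z. A z $ j $ k $ l) \<in> L2_loc \<Omega>"
    and "\<And>j. (\<lambda>z. f z $ j) \<in> H1_loc \<Omega>"
    and "\<And>j. (\<lambda>z. g z $ j) \<in> H1_loc \<Omega>"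
    and "dbar_solution \<Omega> A h f"
    and "dbar_solution \<Omega> A h g"
    and "open U" "U \<noteq> {}" "U \<subseteq> \<Omega>"
    and "AE z in lebesgue. z \<in> U \<longrightarrow> f z = g z"
  shows "AE z in lebesgue. z \<in> \<Omega> \<longrightarrow> f z = g z"
proof -
  note \<Omega> = assms(1,2)
  have "\<forall>j. \<exists>F W. borel_H1_representative \<Omega> (\<lambda>z. f z $ j) F W"
    using H1_loc_representative[OF \<Omega>(1) assms(4)] by blast
  then obtain F WF where F: "\<And>j. borel_H1_representative \<Omega> (\<lambda>z. f z $ j) (F j) (WF j)" by metis
  have "\<forall>j. \<exists>F W. borel_H1_representative \<Omega> (\<lambda>z. g z $ j) F W"
    using H1_loc_representative[OF \<Omega>(1) assms(5)] by blast
  then obtain G WG where G: "\<And>j. borel_H1_representative \<Omega> (\<lambda>z. g z $ j) (G j) (WG j)" by metis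
  have Am: "(\<lambda>z. A z $ j $ k $ l) \<in> borel_measurable (lebesgue_on \<Omega>)" for j k l
    using assms(3)[of j k l] by (simp add: L2_loc_def)
  define B where "B j k l = (SOME B. B \<in> borel_measurable borel \<and> (AE z in lborel. z \<in> \<Omega> \<longrightarrow> A z $ j $ k $ l = B z))" for j k l
  have "B j k l \<in> borel_measurable borel \<and> (AE z in lborel. z \<in> \<Omega> \<longrightarrow> A z $ j $ k $ l = B j k l z)" for j k l
  proof -
    have "\<exists>B. B \<in> borel_measurable borel \<and> (AE z in lborel. z \<in> \<Omega> \<longrightarrow> A z $ j $ k $ l = B z)"
      using ex_borel_representative[OF \<Omega>(1) Am[of j k l]] by blast
    from someI_ex[OF this] show ?thesis unfolding B_def .
  qed
  then have B: "\<And>j k l. B j k l \<in> borel_measurable borel"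
    "\<And>j k l. AE z in lborel. z \<in> \<Omega> \<longrightarrow> A z $ j $ k $ l = B j k l z" by blast+
  have axis_Basis: "(axis l 1 :: complex^'n) \<in> Basis" "(axis l \<i> :: complex^'n) \<in> Basis" for l
    by (simp_all add: Basis_complex_def)
  define u where "u j x = F j x - G j x" for j x
  \<comment> \<open>Twice the dbar derivative of the difference, matching the normalisation of
    \<open>dbar_along\<close>; hence the factor 2 in \<open>a\<close>.\<close>
  define P where "P l j x = (WF j (axis l 1) x - WG j (axis l 1) x) + \<i> * (WF j (axis l \<i>) x - WG j (axis l \<i>) x)" for l j x
  \<comment> \<open>The sum over all matrix entries is a crude bound for the matrix acting on the
    l^1 norm, and it stays square integrable on compact sets.\<close>
  define a where "a l x = (\<Sum>i\<in>UNIV. 2 * norm (B (fst i) (snd i) l x))" for l and x :: "complex^'n"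
  have [measurable]: "F j \<in> borel_measurable borel" "G j \<in> borel_measurable borel"
    "WF j (axis l 1) \<in> borel_measurable borel" "WG j (axis l 1) \<in> borel_measurable borel"
    "WF j (axis l \<i>) \<in> borel_measurable borel" "WG j (axis l \<i>) \<in> borel_measurable borel" for j l
    using F[of j] G[of j] axis_Basis by (auto simp: borel_H1_representative_def)
  note [measurable] = B(1)
  have meas [measurable]: "u j \<in> borel_measurable borel" "P l j \<in> borel_measurable borel" "a l \<in> borel_measurable borel" for j l
    unfolding u_def P_def a_def by measurable
  have int_u: "integrable lborel (\<lambda>x. indicator K x *\<^sub>R u j x)" if "compact K" "K \<subseteq> \<Omega>" for K j
  proof -
    have "integrable lborel (\<lambda>x. indicator K x *\<^sub>R F j x)" "integrable lborel (\<lambda>x. indicator K x *\<^sub>R G j x)"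
      using F[of j] G[of j] that by (auto simp: borel_H1_representative_def)
    then show ?thesis unfolding u_def scaleR_diff_right by (rule Bochner_Integration.integrable_diff)
  qed
  have int_W: "integrable lborel (\<lambda>x. indicator K x *\<^sub>R (WF j v x - WG j v x))"
    if "compact K" "K \<subseteq> \<Omega>" "v \<in> Basis" for K j v
  proof -
    have "integrable lborel (\<lambda>x. indicator K x *\<^sub>R WF j v x)" "integrable lborel (\<lambda>x. indicator K x *\<^sub>R WG j v x)"
      using F[of j] G[of j] that by (auto simp: borel_H1_representative_def)
    then show ?thesis unfolding scaleR_diff_right by (rule Bochner_Integration.integrable_diff)
  qed
  have int_P: "integrable lborel (\<lambda>x. indicator K x *\<^sub>R P l j x)" if "compact K" "K \<subseteq> \<Omega>" for K l j
    using Bochner_Integration.integrable_add[OF int_W[OF that axis_Basis(1)] integrable_mult_right[OF int_W[OF that axis_Basis(2)], of \<i>], of j l j l]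
    by (simp add: P_def scaleR_add_right)
  have weak: "(LINT x|lborel. u j x * dbar_along (axis l) \<phi> x) = - (LINT x|lborel. P l j x * \<phi> x)"
    if \<phi>: "\<phi> \<in> test_functions \<Omega>" for \<phi> l j
  proof -
    have w: "(LINT x|lborel. u j x * frechet_derivative \<phi> (at x) v) = - (LINT x|lborel. (WF j v x - WG j v x) * \<phi> x)"
      "integrable lborel (\<lambda>x. u j x * frechet_derivative \<phi> (at x) v)"
      "integrable lborel (\<lambda>x. (WF j v x - WG j v x) * \<phi> x)" if v: "v \<in> Basis" for v
    proof -
      have Fj: "F j \<in> borel_measurable borel" "\<And>K. compact K \<Longrightarrow> K \<subseteq> \<Omega> \<Longrightarrow> integrable lborel (\<lambda>x. indicator K x *\<^sub>R F j x)"
        "WF j v \<in> borel_measurable borel" "\<And>K. compact K \<Longrightarrow> K \<subseteq> \<Omega> \<Longrightarrow> integrable lborel (\<lambda>x. indicator K x *\<^sub>R WF j v x)"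
        "(LINT x|lborel. F j x * frechet_derivative \<phi> (at x) v) = - (LINT x|lborel. WF j v x * \<phi> x)"
        using F[of j] v \<phi> unfolding borel_H1_representative_def by blast+
      have Gj: "G j \<in> borel_measurable borel" "\<And>K. compact K \<Longrightarrow> K \<subseteq> \<Omega> \<Longrightarrow> integrable lborel (\<lambda>x. indicator K x *\<^sub>R G j x)"
        "WG j v \<in> borel_measurable borel" "\<And>K. compact K \<Longrightarrow> K \<subseteq> \<Omega> \<Longrightarrow> integrable lborel (\<lambda>x. indicator K x *\<^sub>R WG j v x)"
        "(LINT x|lborel. G j x * frechet_derivative \<phi> (at x) v) = - (LINT x|lborel. WG j v x * \<phi> x)"
        using G[of j] v \<phi> unfolding borel_H1_representative_def by blast+
      have i: "integrable lborel (\<lambda>x. F j x * frechet_derivative \<phi> (at x) v)" "integrable lborel (\<lambda>x. G j x * frechet_derivative \<phi> (at x) v)"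
        "integrable lborel (\<lambda>x. WF j v x * \<phi> x)" "integrable lborel (\<lambda>x. WG j v x * \<phi> x)"
        using integrable_test_function_mult[OF test_functions_deriv[OF \<phi>] Fj(1,2)]
          integrable_test_function_mult[OF test_functions_deriv[OF \<phi>] Gj(1,2)]
          integrable_test_function_mult[OF \<phi> Fj(3,4)] integrable_test_function_mult[OF \<phi> Gj(3,4)]
        by (simp_all add: mult.commute)
      show "integrable lborel (\<lambda>x. u j x * frechet_derivative \<phi> (at x) v)" "integrable lborel (\<lambda>x. (WF j v x - WG j v x) * \<phi> x)"
        unfolding u_def left_diff_distrib using i by (auto intro: Bochner_Integration.integrable_diff)
      show "(LINT x|lborel. u j x * frechet_derivative \<phi> (at x) v) = - (LINT x|lborel. (WF j v x - WG j v x) * \<phi> x)"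
        unfolding u_def left_diff_distrib
        using Fj(5) Gj(5) by (simp add: Bochner_Integration.integral_diff i)
    qed
    have "(LINT x|lborel. u j x * dbar_along (axis l) \<phi> x) =
        (LINT x|lborel. u j x * frechet_derivative \<phi> (at x) (axis l 1) + \<i> * (u j x * frechet_derivative \<phi> (at x) (axis l \<i>)))"
      by (rule arg_cong[where f = "integral\<^sup>L lborel"]) (auto simp: dbar_along_def algebra_simps)
    also have "\<dots> = (LINT x|lborel. u j x * frechet_derivative \<phi> (at x) (axis l 1)) + \<i> * (LINT x|lborel. u j x * frechet_derivative \<phi> (at x) (axis l \<i>))"
      using Bochner_Integration.integral_add[OF w(2)[OF axis_Basis(1)] integrable_mult_right[OF w(2)[OF axis_Basis(2)], of \<i>], of l l] by simp
    also have "\<dots> = - ((LINT x|lborel. (WF j (axis l 1) x - WG j (axis l 1) x) * \<phi> x) + (LINT x|lborel. \<i> * ((WF j (axis l \<i>) x - WG j (axis l \<i>) x) * \<phi> x)))"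
      unfolding w(1)[OF axis_Basis(1)] w(1)[OF axis_Basis(2)] integral_mult_right_zero by simp
    also have "\<dots> = - (LINT x|lborel. (WF j (axis l 1) x - WG j (axis l 1) x) * \<phi> x + \<i> * ((WF j (axis l \<i>) x - WG j (axis l \<i>) x) * \<phi> x))"
      using Bochner_Integration.integral_add[OF w(3)[OF axis_Basis(1)] integrable_mult_right[OF w(3)[OF axis_Basis(2)], of \<i>], of l l] by simp
    also have "(\<lambda>x. (WF j (axis l 1) x - WG j (axis l 1) x) * \<phi> x + \<i> * ((WF j (axis l \<i>) x - WG j (axis l \<i>) x) * \<phi> x)) = (\<lambda>x. P l j x * \<phi> x)"
      by (auto simp: P_def algebra_simps)
    finally show ?thesis .
  qed
  have F_eq: "AE z in lborel. \<forall>j. z \<in> \<Omega> \<longrightarrow> f z $ j = F j z" and G_eq: "AE z in lborel. \<forall>j. z \<in> \<Omega> \<longrightarrow> g z $ j = G j z"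
    using F G by (intro eventually_all_finite; simp add: borel_H1_representative_def)+
  have B_eq: "AE z in lborel. \<forall>j k l. z \<in> \<Omega> \<longrightarrow> A z $ j $ k $ l = B j k l z"
    by (intro eventually_all_finite B(2))
  have wd: "AE z in lborel. \<forall>j l. z \<in> \<Omega> \<longrightarrow> weak_deriv \<Omega> (axis l 1) (\<lambda>z. f z $ j) z = WF j (axis l 1) z \<and>
      weak_deriv \<Omega> (axis l \<i>) (\<lambda>z. f z $ j) z = WF j (axis l \<i>) z \<and>
      weak_deriv \<Omega> (axis l 1) (\<lambda>z. g z $ j) z = WG j (axis l 1) z \<and>
      weak_deriv \<Omega> (axis l \<i>) (\<lambda>z. g z $ j) z = WG j (axis l \<i>) z"
  proof (intro eventually_all_finite)
    fix j l
    have "AE z in lborel. z \<in> \<Omega> \<longrightarrow> weak_deriv \<Omega> v (\<lambda>z. f z $ j) z = WF j v z"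
      "AE z in lborel. z \<in> \<Omega> \<longrightarrow> weak_deriv \<Omega> v (\<lambda>z. g z $ j) z = WG j v z" if "v \<in> Basis" for v
      using F[of j] G[of j] that unfolding borel_H1_representative_def by blast+
    note * = this(1)[OF axis_Basis(1), of l] this(1)[OF axis_Basis(2), of l] this(2)[OF axis_Basis(1), of l] this(2)[OF axis_Basis(2), of l]
    show "AE z in lborel. z \<in> \<Omega> \<longrightarrow> weak_deriv \<Omega> (axis l 1) (\<lambda>z. f z $ j) z = WF j (axis l 1) z \<and>
      weak_deriv \<Omega> (axis l \<i>) (\<lambda>z. f z $ j) z = WF j (axis l \<i>) z \<and>
      weak_deriv \<Omega> (axis l 1) (\<lambda>z. g z $ j) z = WG j (axis l 1) z \<and>
      weak_deriv \<Omega> (axis l \<i>) (\<lambda>z. g z $ j) z = WG j (axis l \<i>) z"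
      using * by eventually_elim blast
  qed
  have bound: "AE x in lborel. x \<in> \<Omega> \<longrightarrow> (\<Sum>j\<in>UNIV. norm (P l j x)) \<le> a l x * (\<Sum>j\<in>UNIV. norm (u j x))" for l
    using F_eq G_eq B_eq wd assms(6,7)[unfolded dbar_solution_def AE_completion_iff]
  proof eventually_elim
    case (elim z)
    show ?case
    proof
      assume z: "z \<in> \<Omega>"
      have "norm (P l j z) \<le> (\<Sum>k\<in>UNIV. 2 * norm (B j k l z)) * (\<Sum>k\<in>UNIV. norm (u k z))" for j
      proof -
        \<comment> \<open>The half is the one in \<open>weak_dzbar\<close>; from here on the
          pointwise equations for \<open>f\<close> and \<open>g\<close> are subtracted.\<close>
        have "P l j z / 2 = dbar \<Omega> f z $ j $ l - dbar \<Omega> g z $ j $ l"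
          using elim(4) z by (simp add: P_def dbar_def weak_dzbar_def field_simps)
        also have "\<dots> = form_matrix_mult (A z) (f z) $ j $ l - form_matrix_mult (A z) (g z) $ j $ l"
          using elim(5,6) z by simp
        also have "\<dots> = (\<Sum>k\<in>UNIV. u k z * B j k l z)"
          using elim(1-3) z by (simp add: form_matrix_mult_def u_def left_diff_distrib sum_subtractf)
        finally have "P l j z = (\<Sum>k\<in>UNIV. 2 * B j k l z * u k z)"
          by (simp add: sum_distrib_left[symmetric] mult.assoc mult.commute[of "u _ _"])
        then have "norm (P l j z) \<le> (\<Sum>k\<in>UNIV. (2 * norm (B j k l z)) * norm (u k z))"
          by (simp only:) (rule sum_norm_le, simp add: norm_mult)
        also have "\<dots> \<le> (\<Sum>k\<in>UNIV. (2 * norm (B j k l z)) * (\<Sum>k\<in>UNIV. norm (u k z)))"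
          by (intro sum_mono mult_left_mono member_le_sum) auto
        finally show ?thesis by (simp add: sum_distrib_right)
      qed
      then have "(\<Sum>j\<in>UNIV. norm (P l j z)) \<le> (\<Sum>j\<in>UNIV. (\<Sum>k\<in>UNIV. 2 * norm (B j k l z)) * (\<Sum>k\<in>UNIV. norm (u k z)))"
        by (rule sum_mono)
      also have "\<dots> = a l z * (\<Sum>j\<in>UNIV. norm (u j z))"
        by (simp add: a_def sum_distrib_right[symmetric] UNIV_Times_UNIV[symmetric] sum.cartesian_product[symmetric] del: UNIV_Times_UNIV)
          (simp add: sum.cartesian_product split_def)
      finally show "(\<Sum>j\<in>UNIV. norm (P l j z)) \<le> a l z * (\<Sum>j\<in>UNIV. norm (u j z))" .
    qed
  qed
  have sq_diff: "(\<integral>\<^sup>+x. ennreal ((norm (X x - Y x))\<^sup>2) * indicator K x \<partial>lborel) < \<infinity>"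
    if [measurable]: "X \<in> borel_measurable borel" "Y \<in> borel_measurable borel" "K \<in> sets borel"
      and "(\<integral>\<^sup>+x. ennreal ((norm (X x))\<^sup>2) * indicator K x \<partial>lborel) < \<infinity>" "(\<integral>\<^sup>+x. ennreal ((norm (Y x))\<^sup>2) * indicator K x \<partial>lborel) < \<infinity>"
    for X Y :: "complex^'n \<Rightarrow> complex" and K
  proof -
    \<comment> \<open>The two functions are indexed by \<open>bool\<close>, so that the lemma on
      finite sums applies.\<close>
    have "(\<integral>\<^sup>+x. ennreal ((norm (X x - Y x))\<^sup>2) * indicator K x \<partial>lborel) \<le>
        (\<integral>\<^sup>+x. ennreal ((\<Sum>b\<in>UNIV. norm (if b then X x else Y x))\<^sup>2) * indicator K x \<partial>lborel)"
      by (intro nn_integral_mono mult_right_mono ennreal_leI power_mono) (auto simp: UNIV_bool norm_triangle_ineq4 add.commute)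
    also have "\<dots> < \<infinity>"
    proof (rule nn_integral_sum_squared_finite)
      show "(\<integral>\<^sup>+x. ennreal ((norm (if b then X x else Y x))\<^sup>2) * indicator K x \<partial>lborel) < \<infinity>" for b
        using that by (cases b) auto
    qed auto
    finally show ?thesis .
  qed
  have U2: "(\<integral>\<^sup>+x. ennreal ((\<Sum>j\<in>UNIV. norm (u j x))\<^sup>2) * indicator K x \<partial>lborel) < \<infinity>" if K: "compact K" "K \<subseteq> \<Omega>" for K
  proof (rule nn_integral_sum_squared_finite)
    show Kb: "K \<in> sets borel" using K by (simp add: borel_compact)
    show "(\<integral>\<^sup>+x. ennreal ((norm (u j x))\<^sup>2) * indicator K x \<partial>lborel) < \<infinity>" for j
      unfolding u_def using F[of j] G[of j] K Kb by (intro sq_diff) (auto simp: borel_H1_representative_def)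
  qed auto
  have D2: "(\<integral>\<^sup>+x. ennreal ((\<Sum>j\<in>UNIV. norm (P l j x))\<^sup>2) * indicator K x \<partial>lborel) < \<infinity>" if K: "compact K" "K \<subseteq> \<Omega>" for K l
  proof (rule nn_integral_sum_squared_finite)
    show Kb: "K \<in> sets borel" using K by (simp add: borel_compact)
    have W: "(\<integral>\<^sup>+x. ennreal ((norm (WF j v x - WG j v x))\<^sup>2) * indicator K x \<partial>lborel) < \<infinity>" if "v \<in> Basis" for j v
      using F[of j] G[of j] K Kb that by (intro sq_diff) (auto simp: borel_H1_representative_def)
    show "(\<integral>\<^sup>+x. ennreal ((norm (P l j x))\<^sup>2) * indicator K x \<partial>lborel) < \<infinity>" for j
    proof -
      \<comment> \<open>Written as a difference, with \<i> replaced by its negative, so that the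
        bound for differences covers this sum too.\<close>
      have "P l j = (\<lambda>x. (WF j (axis l 1) x - WG j (axis l 1) x) - (- \<i>) * (WF j (axis l \<i>) x - WG j (axis l \<i>) x))"
        by (auto simp: P_def)
      moreover have "(\<integral>\<^sup>+x. ennreal ((norm ((WF j (axis l 1) x - WG j (axis l 1) x) - (- \<i>) * (WF j (axis l \<i>) x - WG j (axis l \<i>) x)))\<^sup>2) * indicator K x \<partial>lborel) < \<infinity>"
        using Kb W[OF axis_Basis(1), of j l] W[OF axis_Basis(2), of j l]
        by (intro sq_diff[of "\<lambda>x. WF j (axis l 1) x - WG j (axis l 1) x" "\<lambda>x. (- \<i>) * (WF j (axis l \<i>) x - WG j (axis l \<i>) x)"])
          (auto simp: norm_mult)
      ultimately show ?thesis by simp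
    qed
  qed auto
  have a2: "(\<integral>\<^sup>+x. ennreal ((a l x)\<^sup>2) * indicator K x \<partial>lborel) < \<infinity>" if K: "compact K" "K \<subseteq> \<Omega>" for K l
    unfolding a_def
  proof (rule nn_integral_sum_squared_finite)
    show Kb [measurable]: "K \<in> sets borel" using K by (simp add: borel_compact)
    fix i :: "'m \<times> 'm"
    have "(\<integral>\<^sup>+x. ennreal ((2 * norm (B (fst i) (snd i) l x))\<^sup>2) * indicator K x \<partial>lborel) =
        (\<integral>\<^sup>+x. 4 * (ennreal ((norm (B (fst i) (snd i) l x))\<^sup>2) * indicator K x) \<partial>lborel)"
      by (intro nn_integral_cong) (simp add: power_mult_distrib ennreal_mult mult.assoc)
    also have "\<dots> = 4 * (\<integral>\<^sup>+x. ennreal ((norm (B (fst i) (snd i) l x))\<^sup>2) * indicator K x \<partial>lborel)"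
      by (rule nn_integral_cmult) measurable
    also have "\<dots> < \<infinity>"
      using L2_loc_representative_finite[OF assms(3) B(2) K] by (auto simp: ennreal_mult_less_top)
    finally show "(\<integral>\<^sup>+x. ennreal ((2 * norm (B (fst i) (snd i) l x))\<^sup>2) * indicator K x \<partial>lborel) < \<infinity>" .
  qed auto
  have a_nonneg: "a l x \<ge> 0" for l x by (auto simp: a_def intro!: sum_nonneg)
  have "AE x in lborel. x \<in> \<Omega> \<longrightarrow> (\<forall>j. u j x = 0)"
  proof (rule polydisc_propagation_imp_AE[OF \<Omega> assms(8,9,10)])
    have "AE z in lborel. z \<in> U \<longrightarrow> f z = g z" using assms(11) by (simp add: AE_completion_iff)
    then show "AE x in lborel. x \<in> U \<longrightarrow> (\<forall>j. u j x = 0)"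
      using F_eq G_eq by eventually_elim (use assms(10) in \<open>auto simp: u_def\<close>)
  next
    fix p \<epsilon> R
    assume \<epsilon>: "0 < \<epsilon>" "\<epsilon> < R" and sub: "{x. \<forall>j. norm (x $ j - p $ j) \<le> R} \<subseteq> \<Omega>"
      and zero: "AE x in lborel. (\<forall>j. norm (x $ j - p $ j) < \<epsilon>) \<longrightarrow> (\<forall>j. u j x = 0)"
    \<comment> \<open>\<open>S\<close> collects the coordinates already enlarged to radius
      \<open>R\<close>; the others still have radius \<epsilon>. The induction applies
      \<open>polydisc_step\<close> with the form index \<open>l\<close> of the newly inserted
      coordinate.\<close>
    have "AE x in lborel. (\<forall>j. norm (x $ j - p $ j) < (if j \<in> S then R else \<epsilon>)) \<longrightarrow> (\<forall>j. u j x = 0)" for S :: "'n set"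
      using finite[of S]
    proof (induction S rule: finite_induct)
      case empty
      then show ?case using zero by simp
    next
      case (insert l S)
      define \<rho> where "\<rho> j = (if j \<in> insert l S then R else \<epsilon>)" for j
      have sub': "{x. \<forall>j. norm (x $ j - p $ j) \<le> \<rho> j} \<subseteq> \<Omega>"
      proof (rule subset_trans[OF _ sub], rule Collect_mono, intro impI allI)
        fix x j assume "\<forall>j. norm (x $ j - p $ j) \<le> \<rho> j"
        then have "norm (x $ j - p $ j) \<le> \<rho> j" by blast
        also have "\<rho> j \<le> R" using \<epsilon> by (simp add: \<rho>_def)
        finally show "norm (x $ j - p $ j) \<le> R" .
      qed
      note K = compact_closed_polydisc[of p \<rho>] sub'
      have "AE x in lborel. (\<forall>j. norm (x $ j - p $ j) < \<rho> j) \<longrightarrow> (\<forall>j. u j x = 0)"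
      proof (rule polydisc_step[where P = "P l" and a = "a l" and \<epsilon> = \<epsilon> and l = l, OF meas sub' _ int_u int_P weak a_nonneg bound U2[OF K] D2[OF K] a2[OF K]])
        have "(if j \<in> S then R else \<epsilon>) = (if j = l then \<epsilon> else \<rho> j)" for j
          using insert.hyps(2) by (auto simp: \<rho>_def)
        with insert.IH show "AE x in lborel. (\<forall>j. norm (x $ j - p $ j) < (if j = l then \<epsilon> else \<rho> j)) \<longrightarrow> (\<forall>j. u j x = 0)"
          by simp
      qed (use \<epsilon> in \<open>auto simp: \<rho>_def\<close>)
      then show ?case by (simp add: \<rho>_def)
    qed
    from this[of UNIV] show "AE x in lborel. (\<forall>j. norm (x $ j - p $ j) < R) \<longrightarrow> (\<forall>j. u j x = 0)" by simp
  qed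
  then have "AE z in lborel. z \<in> \<Omega> \<longrightarrow> f z = g z"
    using F_eq G_eq by eventually_elim (auto simp: u_def vec_eq_iff)
  then show ?thesis by (simp add: AE_completion_iff)
qed

end
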